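(* If $\mathsf{E}_0|Z_1|^2<\infty$ and $Z_1$ is non-arithmetic, then $$\mathcal{J}(T_A)=\frac1I\left(\log A+\varkappa-C_\infty\right)+o(1)\quad\text{as }A\to\infty,$$ where $o(1)\to 0$ as $A\to\infty$.
   Context: Changepoint model: $X_1,X_2,\dots$ are independent; $f$ and $g$ are known probability densities with respect to a dominating measure. For $\nu\in\{0,1,2,\dots\}\cup\{\infty\}$, under $\mathsf{P}_\nu$ (expectation $\mathsf{E}_\nu$) the observations $X_1,\dots,X_\nu$ have density $f$ and $X_{\nu+1},X_{\nu+2},\dots$ have density $g$; so under $\mathsf{P}_\infty$ all observations are i.i.d. with density $f$, and under $\mathsf{P}_0$ i.i.d. with density $g$. Put $\Lambda_i=g(X_i)/f(X_i)$, $Z_i=\log\Lambda_i$, $S_n=Z_1+\cdots+Z_n$, and $I=\mathsf{E}_0Z_1$ (the Kullback--Leibler information number). Shiryaev--Roberts procedure: $R_0=0$, $R_{n+1}=(1+R_n)\Lambda_{n+1}$ for $n\ge 0$, and $T_A=\inf\{n\ge 1: R_n\ge A\}$ (with $\inf\varnothing=\infty$), $A>0$. For a stopping time $T$, $$\mathcal{J}(T)=\frac{\sum_{\nu=0}^\infty\mathsf{E}_\nu(T-\nu\mid T>\nu)\,\mathsf{P}_\infty(T>\nu)}{\mathsf{E}_\infty T}.$$ Stationary distribution: $\mathsf{Q}_{\mathrm{st}}(x)=\lim_{n\to\infty}\mathsf{P}_\infty(R_n\le x)$. Quasi-stationary distribution: $\mathsf{Q}_A(x)=\lim_{n\to\infty}\mathsf{P}_\infty(R_n\le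 x\mid T_A>n)$. Both distributions are assumed to exist. Constants: for $a>0$ let $\tau_a=\inf\{n\ge 1: S_n\ge a\}$, $\kappa_a=S_{\tau_a}-a$, $\varkappa=\lim_{a\to\infty}\mathsf{E}_0\kappa_a$. Let $V_\infty=\sum_{j=1}^\infty e^{-S_j}$, $\widetilde{\mathsf{Q}}(y)=\mathsf{P}_0(V_\infty\le y)$, and $$C_\infty=\int_0^\infty\!\!\int_0^\infty\log(1+x+y)\,d\mathsf{Q}_{\mathrm{st}}(x)\,d\widetilde{\mathsf{Q}}(y).$$ *)

theory Defs
  imports "HOL-Probability.Probability"
begin

text \<open>The changepoint model. \<open>P \<nu>\<close> is the law with changepoint \<open>\<nu>\<close>, so that the observations
  \<open>X i\<close> with \<open>1 \<le> i \<le> \<nu>\<close> have density \<open>f\<close> and all later ones have density \<open>g\<close>, both with respect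
  to the dominating measure \<open>\<mu>\<close>. Observations are numbered from 1; \<open>X 0\<close> is never used.\<close>

definition changepoint_model ::
  "'a measure \<Rightarrow> ('a \<Rightarrow> real) \<Rightarrow> ('a \<Rightarrow> real) \<Rightarrow> (enat \<Rightarrow> 'w measure) \<Rightarrow> (nat \<Rightarrow> 'w \<Rightarrow> 'a) \<Rightarrow> bool" where
  "changepoint_model \<mu> f g P X \<longleftrightarrow>
     f \<in> borel_measurable \<mu> \<and> (\<forall>x\<in>space \<mu>. 0 \<le> f x) \<and> (\<integral>\<^sup>+x. ennreal (f x) \<partial>\<mu>) = 1 \<and>
     g \<in> borel_measurable \<mu> \<and> (\<forall>x\<in>space \<mu>. 0 \<le> g x) \<and> (\<integral>\<^sup>+x. ennreal (g x) \<partial>\<mu>) = 1 \<and>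
     (\<forall>\<nu>. prob_space (P \<nu>) \<and>
          prob_space.indep_vars (P \<nu>) (\<lambda>_. \<mu>) X {1..} \<and>
          (\<forall>i\<ge>1. distributed (P \<nu>) \<mu> (X i) (\<lambda>x. ennreal (if enat i \<le> \<nu> then f x else g x))))"

definition lik_ratio :: "('a \<Rightarrow> real) \<Rightarrow> ('a \<Rightarrow> real) \<Rightarrow> (nat \<Rightarrow> 'w \<Rightarrow> 'a) \<Rightarrow> nat \<Rightarrow> 'w \<Rightarrow> real" where
  "lik_ratio f g X i \<omega> = g (X i \<omega>) / f (X i \<omega>)"

definition llr :: "('a \<Rightarrow> real) \<Rightarrow> ('a \<Rightarrow> real) \<Rightarrow> (nat \<Rightarrow> 'w \<Rightarrow> 'a) \<Rightarrow> nat \<Rightarrow> 'w \<Rightarrow> real" where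
  "llr f g X i \<omega> = ln (lik_ratio f g X i \<omega>)"

text \<open>The second moment of \<open>Z\<^sub>1\<close> under \<open>M = P 0\<close>. Where \<open>f = 0 < g\<close> the log-likelihood ratio is
  \<open>+\<infinity>\<close>, whereas \<^term>\<open>llr\<close> is \<open>0\<close> there because of the conventions for real division and \<open>ln\<close>;
  that set must therefore be accounted for explicitly. (The set \<open>g = 0\<close> is null under \<open>P 0\<close>.)
  In particular, finiteness forces \<open>f > 0\<close> almost everywhere with respect to \<open>g d\<mu>\<close>, and then the
  values \<open>g / 0 = 0\<close> and \<open>ln 0 = 0\<close> do not affect any of the expectations below.\<close>

definition llr_second_moment ::
  "('a \<Rightarrow> real) \<Rightarrow> ('a \<Rightarrow> real) \<Rightarrow> 'w measure \<Rightarrow> (nat \<Rightarrow> 'w \<Rightarrow> 'a) \<Rightarrow> ennreal" where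
  "llr_second_moment f g M X =
     (\<integral>\<^sup>+\<omega>. (if f (X 1 \<omega>) = 0 then \<infinity> else ennreal (\<bar>llr f g X 1 \<omega>\<bar>\<^sup>2)) \<partial>M)"

definition non_arithmetic :: "'w measure \<Rightarrow> ('w \<Rightarrow> real) \<Rightarrow> bool" where
  "non_arithmetic M Y \<longleftrightarrow> \<not> (\<exists>d>0. AE \<omega> in M. \<exists>k::int. Y \<omega> = d * of_int k)"

text \<open>In the following, \<open>L\<close> stands for the sequence of likelihood ratios and \<open>Z\<close> for its logarithm.\<close>

primrec SR_stat :: "(nat \<Rightarrow> 'w \<Rightarrow> real) \<Rightarrow> nat \<Rightarrow> 'w \<Rightarrow> real" where
  "SR_stat L 0 \<omega> = 0"
| "SR_stat L (Suc n) \<omega> = (1 + SR_stat L n \<omega>) * L (Suc n) \<omega>"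

definition SR_time :: "(nat \<Rightarrow> 'w \<Rightarrow> real) \<Rightarrow> real \<Rightarrow> 'w \<Rightarrow> enat" where
  "SR_time L A \<omega> = Inf {enat n | n. 1 \<le> n \<and> A \<le> SR_stat L n \<omega>}"

definition cond_delay :: "'w measure \<Rightarrow> nat \<Rightarrow> ('w \<Rightarrow> enat) \<Rightarrow> ennreal" where
  "cond_delay M \<nu> T =
     (\<integral>\<^sup>+\<omega>. ennreal_of_enat (T \<omega> - enat \<nu>) * indicator {\<omega>. enat \<nu> < T \<omega>} \<omega> \<partial>M)
       / emeasure M {\<omega> \<in> space M. enat \<nu> < T \<omega>}"

definition integral_avg_delay :: "(enat \<Rightarrow> 'w measure) \<Rightarrow> ('w \<Rightarrow> enat) \<Rightarrow> ennreal" where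
  "integral_avg_delay P T =
     (\<Sum>\<nu>. cond_delay (P (enat \<nu>)) \<nu> T * emeasure (P \<infinity>) {\<omega> \<in> space (P \<infinity>). enat \<nu> < T \<omega>})
       / (\<integral>\<^sup>+\<omega>. ennreal_of_enat (T \<omega>) \<partial>P \<infinity>)"

definition stationary_distribution ::
  "'w measure \<Rightarrow> (nat \<Rightarrow> 'w \<Rightarrow> real) \<Rightarrow> real measure \<Rightarrow> bool" where
  "stationary_distribution M L Q \<longleftrightarrow> real_distribution Q \<and>
     (\<forall>x. (\<lambda>n. \<P>(\<omega> in M. SR_stat L n \<omega> \<le> x)) \<longlonglongrightarrow> cdf Q x)"

definition quasi_stationary_distribution ::
  "'w measure \<Rightarrow> (nat \<Rightarrow> 'w \<Rightarrow> real) \<Rightarrow> real \<Rightarrow> real measure \<Rightarrow> bool" where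
  "quasi_stationary_distribution M L A Q \<longleftrightarrow> real_distribution Q \<and>
     (\<forall>x. (\<lambda>n. \<P>(\<omega> in M. SR_stat L n \<omega> \<le> x \<bar> enat n < SR_time L A \<omega>)) \<longlonglongrightarrow> cdf Q x)"

definition walk :: "(nat \<Rightarrow> 'w \<Rightarrow> real) \<Rightarrow> nat \<Rightarrow> 'w \<Rightarrow> real" where
  "walk Z n \<omega> = (\<Sum>i=1..n. Z i \<omega>)"

definition passage_time :: "(nat \<Rightarrow> 'w \<Rightarrow> real) \<Rightarrow> real \<Rightarrow> 'w \<Rightarrow> enat" where
  "passage_time Z a \<omega> = Inf {enat n | n. 1 \<le> n \<and> a \<le> walk Z n \<omega>}"

text \<open>The overshoot is only meaningful when the level is reached, which happens almost surely
  when the walk has positive drift; the value \<open>0\<close> otherwise is immaterial.\<close>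

definition overshoot :: "(nat \<Rightarrow> 'w \<Rightarrow> real) \<Rightarrow> real \<Rightarrow> 'w \<Rightarrow> real" where
  "overshoot Z a \<omega> =
     (case passage_time Z a \<omega> of enat n \<Rightarrow> walk Z n \<omega> - a | \<infinity> \<Rightarrow> 0)"

definition limiting_overshoot :: "'w measure \<Rightarrow> (nat \<Rightarrow> 'w \<Rightarrow> real) \<Rightarrow> real" where
  "limiting_overshoot M Z = Lim at_top (\<lambda>a. \<integral>\<omega>. overshoot Z a \<omega> \<partial>M)"

definition V_inf :: "(nat \<Rightarrow> 'w \<Rightarrow> real) \<Rightarrow> 'w \<Rightarrow> real" where
  "V_inf Z \<omega> = (\<Sum>j. exp (- walk Z (Suc j) \<omega>))"

text \<open>The half lines are closed: the stationary distribution has an atom at \<open>0\<close> when the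
  likelihood ratio vanishes with positive probability under \<open>P \<infinity>\<close>.\<close>

definition C_inf :: "'w measure \<Rightarrow> (nat \<Rightarrow> 'w \<Rightarrow> real) \<Rightarrow> real measure \<Rightarrow> real" where
  "C_inf M Z Qst =
     (LINT y:{0..}|distr M borel (V_inf Z). (LINT x:{0..}|Qst. ln (1 + x + y)))"

end

theory Submission imports Defs
begin

text \<open>
  Write \<open>R n\<close> for the Shiryaev--Roberts statistic, \<open>T\<close> for its passage time of the level \<open>A\<close>, and
  \<open>u r\<close> for the mean of that passage time under the post-change law when the statistic starts at \<open>r\<close>.
  Survival beyond \<open>\<nu>\<close> depends on the first \<open>\<nu>\<close> observations only, so the numerator of the average
  delay is the sum over \<open>\<nu>\<close> of the pre-change means of \<open>u (R \<nu>)\<close> on the event \<open>T > \<nu>\<close>, and the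
  denominator is the sum of the probabilities of these events. The average delay is therefore the mean
  of \<open>u\<close> under the normalized occupation measure of the statistic up to a false alarm. Two facts
  give the theorem.

  The first is the expansion \<open>drift * u r = ln A + overshoot_limit - ell r + o(1)\<close>, where \<open>ell r\<close> is the mean of
  \<open>ln (1 + r + V)\<close> and \<open>V\<close> is the perpetuity \<open>V_inf\<close> (\<open>mean_time_expansion\<close>). Under the post-change
  law \<open>R n\<close> has two factors: the exponential of the log-likelihood walk, and the sum of \<open>r\<close>
  and a partial sum of the series for \<open>1 + V\<close>.
  Wald's identity handles the walk, and there remain the mean overshoot and the mean logarithm of the
  second factor. For the overshoot, stop first at \<open>A * exp (- b)\<close>: from there on the second factor
  hardly changes, and the statistic passes \<open>A\<close> like a pure walk at distance about \<open>b\<close>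
  (\<open>two_stage_bounds\<close>). So the mean overshoot has the same limit as for the walk. That the latter
  converges is a renewal theorem (\<open>excess_convergent\<close>): the mean overshoot, as a function of the
  level, is bounded and harmonic for the walk, so by the argument of Choquet and Deny its increments
  over bounded distances vanish at infinity (\<open>lipschitz_harmonic_increment_tendsto_0\<close>); uniform
  integrability of the overshoots turns this into the Cauchy property. The uniform integrability
  (\<open>nn_overshoot_bound\<close>) is what the second moment is for.

  The second is that the occupation measure converges to the stationary law, in the sense needed for
  \<open>ell\<close> (\<open>average_of_ell_pos\<close>). Before the change the statistic forgets its past exponentially fast, and
  it is correlated with the alarm only during a bounded time, which is negligible against the mean
  time to a false alarm.

  All exponential estimates come from one number, the Hellinger affinity \<open>\<rho> < 1\<close> of the two
  densities, which is the mean of the square root of a likelihood ratio before the change and of its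
  reciprocal square root after the change. It bounds the time the walk spends below a level, makes
  \<open>sqrt V\<close> integrable, and makes the square root a Lyapunov function for the statistic before the change.
\<close>


section \<open>Harmonic functions of a non-arithmetic random walk\<close>

text \<open>Either the group has positive elements arbitrarily close to \<open>0\<close>, and then their
  multiples approximate every real number, or its least positive element generates it.\<close>

lemma closed_subgroup_real_cyclic:
  fixes G :: "real set"
  assumes cl: "closed G" and zero: "0 \<in> G"
    and diff: "\<And>x y. x \<in> G \<Longrightarrow> y \<in> G \<Longrightarrow> x - y \<in> G"
    and proper: "G \<noteq> UNIV"
  obtains d where "d > 0" "\<And>x. x \<in> G \<Longrightarrow> \<exists>k::int. x = d * of_int k"
proof -
  have neg: "- x \<in> G" if "x \<in> G" for x using diff[OF zero that] by simp
  have add: "x + y \<in> G" if "x \<in> G" "y \<in> G" for x y using diff[OF that(1) neg[OF that(2)]] by simp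
  have nmul: "of_nat n * x \<in> G" if "x \<in> G" for n :: nat and x
    by (induction n) (auto simp: zero algebra_simps intro: add that)
  have imul: "of_int k * x \<in> G" if "x \<in> G" for k :: int and x
  proof (cases "k \<ge> 0")
    case True then show ?thesis using nmul[OF that, of "nat k"] by simp
  next
    case False then show ?thesis using neg[OF nmul[OF that, of "nat (-k)"]] by simp
  qed
  have "\<exists>\<eta>>0. \<forall>g\<in>G. 0 < g \<longrightarrow> \<eta> \<le> g"
  proof (rule ccontr)
    assume "\<not> ?thesis"
    then have small: "\<exists>g\<in>G. 0 < g \<and> g < \<eta>" if "\<eta> > 0" for \<eta> using that by (force simp: not_le)
    have "x \<in> G" for x
    proof -
      have "x \<in> closure G"
        unfolding closure_approachable
      proof (intro allI impI)
        fix e :: real assume "e > 0"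
        then obtain g where g: "g \<in> G" "0 < g" "g < e" using small by blast
        have "of_int \<lfloor>x / g\<rfloor> * g \<in> G" using g imul by blast
        moreover have "dist (of_int \<lfloor>x / g\<rfloor> * g) x < e"
        proof -
          have "x - of_int \<lfloor>x / g\<rfloor> * g = (x/g - of_int \<lfloor>x / g\<rfloor>) * g" using g by (simp add: field_simps)
          moreover have "0 \<le> x/g - of_int \<lfloor>x / g\<rfloor>" "x/g - of_int \<lfloor>x / g\<rfloor> \<le> 1" by linarith+
          ultimately have "0 \<le> x - of_int \<lfloor>x / g\<rfloor> * g" "x - of_int \<lfloor>x / g\<rfloor> * g \<le> g"
            using g by (auto simp: mult_left_le_one_le)
          then show ?thesis using g by (simp add: dist_real_def)
        qed
        ultimately show "\<exists>y\<in>G. dist y x < e" by blast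
      qed
      then show ?thesis using cl by simp
    qed
    then show False using proper by auto
  qed
  then obtain \<eta> where \<eta>: "\<eta> > 0" "\<And>g. g \<in> G \<Longrightarrow> 0 < g \<Longrightarrow> \<eta> \<le> g" by blast
  show ?thesis
  proof (cases "\<exists>g\<in>G. 0 < g")
    case False
    then have "x = 0" if "x \<in> G" for x using neg[OF that] that by (meson neg_0_less_iff_less not_less_iff_gr_or_eq)
    then show ?thesis using that[of 1] by (metis mult_zero_right of_int_0 zero_less_one)
  next
    case True
    define P where "P = G \<inter> {\<eta>..}"
    have P: "P = {g\<in>G. 0 < g}" using \<eta> by (auto simp: P_def intro: less_le_trans)
    have "closed P" unfolding P_def using cl by auto
    moreover have "P \<noteq> {}" using True P by auto
    moreover have bb: "bdd_below P" unfolding P_def by auto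
    ultimately have dP: "Inf P \<in> P" using closed_contains_Inf by blast
    define d where "d = Inf P"
    have d: "d \<in> G" "d > 0" using dP P d_def by auto
    have min: "d \<le> g" if "g \<in> G" "0 < g" for g
      unfolding d_def using bb that P by (intro cInf_lower) auto
    have "\<exists>k::int. x = d * of_int k" if "x \<in> G" for x
    proof -
      let ?k = "\<lfloor>x / d\<rfloor>"
      have r: "x - of_int ?k * d \<in> G" using diff imul d that by blast
      have "x - of_int ?k * d = (x/d - of_int ?k) * d" using d by (simp add: field_simps)
      moreover have "0 \<le> x/d - of_int ?k" "x/d - of_int ?k < 1" by linarith+
      ultimately have "0 \<le> x - of_int ?k * d" "x - of_int ?k * d < d" using d by auto
      then have "x - of_int ?k * d = 0" using min[OF r] by linarith
      then show ?thesis by (intro exI[of _ ?k]) (simp add: mult.commute)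
    qed
    then show ?thesis using that d by blast
  qed
qed

text \<open>A point outside the support lies in an interval of measure zero with rational end points, and
  there are only countably many of these.\<close>

lemma AE_in_support:
  fixes G :: "real set"
  assumes "prob_space \<nu>" and sets[measurable_cong]: "sets \<nu> = sets borel"
    and G: "\<And>z. (\<And>\<eta>. \<eta> > 0 \<Longrightarrow> measure \<nu> (ball z \<eta>) > 0) \<Longrightarrow> z \<in> G"
  shows "AE z in \<nu>. z \<in> G"
proof -
  interpret prob_space \<nu> by fact
  have "AE z in \<nu>. \<forall>p::rat. \<forall>q::rat. measure \<nu> {of_rat p<..<of_rat q} = 0 \<longrightarrow> z \<notin> {of_rat p<..<of_rat q}"
    unfolding AE_all_countable
  proof (intro allI)
    fix p q :: rat
    show "AE z in \<nu>. measure \<nu> {of_rat p<..<of_rat q} = 0 \<longrightarrow> z \<notin> {of_rat p<..<of_rat q}"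
    proof (cases "measure \<nu> {of_rat p<..<of_rat q :: real} = 0")
      case True
      then have "{of_rat p<..<of_rat q :: real} \<in> null_sets \<nu>"
        by (simp add: null_sets_def emeasure_eq_measure)
      from AE_not_in[OF this] show ?thesis by (rule eventually_mono) simp
    qed auto
  qed
  then show ?thesis
  proof eventually_elim
    case (elim z)
    show ?case
    proof (rule G)
      fix \<eta> :: real assume "\<eta> > 0"
      obtain p where p: "z - \<eta> < of_rat p" "of_rat p < z" using of_rat_dense[of "z-\<eta>" z] \<open>\<eta>>0\<close> by auto
      obtain q where q: "z < of_rat q" "of_rat q < z + \<eta>" using of_rat_dense[of z "z+\<eta>"] \<open>\<eta>>0\<close> by auto
      have "measure \<nu> {of_rat p<..<of_rat q} \<noteq> 0" using elim p q by auto
      then have "0 < measure \<nu> {of_rat p<..<of_rat q}" by (simp add: zero_less_measure_iff)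
      also have "\<dots> \<le> measure \<nu> (ball z \<eta>)"
        using p q by (intro finite_measure_mono) (auto simp: dist_real_def)
      finally show "measure \<nu> (ball z \<eta>) > 0" .
    qed
  qed
qed

text \<open>The upper limit \<open>s\<close> at infinity, together with a sequence that attains it: the next
  argument follows the translates of one such sequence.\<close>

lemma bounded_limsup_sequence:
  fixes f :: "real \<Rightarrow> real"
  assumes bnd: "\<And>x. \<bar>f x\<bar> \<le> B"
  obtains s a where "filterlim a at_top sequentially" "(\<lambda>n. f (a n)) \<longlonglongrightarrow> s"
    "\<And>\<eta>. \<eta> > 0 \<Longrightarrow> \<forall>\<^sub>F x in at_top. f x < s + \<eta>"
proof -
  define Y where "Y = {y. \<forall>\<^sub>F x in at_top. f x \<le> y}"
  have "B \<in> Y" unfolding Y_def using bnd by (auto intro!: always_eventually simp: abs_le_iff)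
  have lb: "- B \<le> y" if "y \<in> Y" for y
  proof -
    from that obtain x where "f x \<le> y" unfolding Y_def
      using eventually_happens trivial_limit_at_top_linorder by blast
    then show ?thesis using bnd[of x] by linarith
  qed
  then have bb: "bdd_below Y" by (auto simp: bdd_below_def)
  define s where "s = Inf Y"
  have up: "\<forall>\<^sub>F x in at_top. f x < s + \<eta>" if "\<eta> > 0" for \<eta>
  proof -
    have "\<exists>y\<in>Y. y < s + \<eta>" using cInf_lessD[of Y "s+\<eta>"] \<open>B \<in> Y\<close> that s_def by auto
    then obtain y where "y \<in> Y" "y < s + \<eta>" by auto
    then show ?thesis unfolding Y_def by (auto elim: eventually_mono)
  qed
  have low: "\<exists>x\<ge>t. f x > s - \<eta>" if "\<eta> > 0" for \<eta> t
  proof (rule ccontr)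
    assume "\<not> ?thesis"
    then have "s - \<eta> \<in> Y" unfolding Y_def eventually_at_top_linorder by (force simp: not_less)
    then have "s \<le> s - \<eta>" unfolding s_def using bb by (intro cInf_lower)
    then show False using that by simp
  qed
  define a where "a n = (SOME x. x \<ge> real n \<and> f x > s - 1 / (real n + 1))" for n
  have a: "a n \<ge> real n \<and> f (a n) > s - 1 / (real n + 1)" for n
    unfolding a_def by (rule someI_ex) (use low[of "1/(real n+1)" "real n"] in auto)
  have at: "filterlim a at_top sequentially"
    by (rule filterlim_at_top_mono[OF filterlim_real_sequentially]) (use a in auto)
  have "(\<lambda>n. f (a n)) \<longlonglongrightarrow> s"
  proof (rule LIMSEQ_I)
    fix \<eta> :: real assume "\<eta> > 0"
    have 1: "\<forall>\<^sub>F n in sequentially. f (a n) < s + \<eta>"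
      using filterlim_cong[THEN iffD1] eventually_compose_filterlim[OF up[OF \<open>\<eta>>0\<close>] at] by simp
    have "(\<lambda>n. 1 / (real n + 1)) \<longlonglongrightarrow> 0" using LIMSEQ_inverse_real_of_nat by (simp add: inverse_eq_divide add.commute)
    from order_tendstoD(2)[OF this \<open>\<eta>>0\<close>] have 2: "\<forall>\<^sub>F n in sequentially. 1 / (real n + 1) < \<eta>" .
    have "\<forall>\<^sub>F n in sequentially. norm (f (a n) - s) < \<eta>"
      using 1 2
    proof eventually_elim
      case (elim n)
      have "f (a n) > s - 1 / (real n + 1)" using a by blast
      with elim have "f (a n) < s + \<eta>" "f (a n) > s - \<eta>" by linarith+
      then show ?case by (auto simp: abs_less_iff)
    qed
    then show "\<exists>no. \<forall>n\<ge>no. norm (f (a n) - s) < \<eta>" by (simp add: eventually_sequentially)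
  qed
  then show ?thesis using that at up by blast
qed

text \<open>The argument of Choquet and Deny, carried out at infinity. Let \<open>s\<close> be the upper limit
  of the increment \<open>v a = w a - w (a - z)\<close>, attained along \<open>a n\<close>. By
  harmonicity \<open>v (a n)\<close> is an average of the values \<open>v (a n - y)\<close>, none
  of which exceeds \<open>s\<close> in the limit; so they tend to \<open>s\<close> in mean, and by
  the Lipschitz property this holds at the point \<open>y = z\<close> of the support. After
  \<open>k\<close> iterations the increments telescope to about \<open>k * s\<close>, whereas
  \<open>w\<close> is bounded. Hence \<open>s \<le> 0\<close>.\<close>

lemma lipschitz_harmonic_limsup_zero:
  fixes w :: "real \<Rightarrow> real"
  assumes "prob_space \<nu>" and sets[measurable_cong]: "sets \<nu> = sets borel"
    and int: "integrable \<nu> (\<lambda>z. z)"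
    and lip: "\<And>x y. \<bar>w x - w y\<bar> \<le> L * \<bar>x - y\<bar>"
    and bnd: "\<And>x. 0 \<le> x \<Longrightarrow> \<bar>w x\<bar> \<le> C"
    and harm: "\<And>a. 0 < a \<Longrightarrow> w a = (\<integral>z. w (a - z) \<partial>\<nu>)"
    and z: "\<And>\<eta>. \<eta> > 0 \<Longrightarrow> measure \<nu> (ball z \<eta>) > 0"
    and \<eta>: "0 < \<eta>"
  shows "\<forall>\<^sub>F a in at_top. w a - w (a - z) < \<eta>"
proof -
  interpret prob_space \<nu> by fact
  have L: "L \<ge> 0" using lip[of 1 0] by simp
  have "continuous_on UNIV w"
    using lip L by (intro lipschitz_on_continuous_on[of L] lipschitz_onI) (auto simp: dist_real_def)
  then have [measurable]: "w \<in> borel_measurable borel" by (rule borel_measurable_continuous_onI)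
  have intw: "integrable \<nu> (\<lambda>y. w (a - y))" for a
  proof (rule Bochner_Integration.integrable_bound)
    show "integrable \<nu> (\<lambda>y. \<bar>w 0\<bar> + L * (\<bar>a\<bar> + \<bar>y\<bar>))" using int by auto
    show "AE y in \<nu>. norm (w (a - y)) \<le> norm (\<bar>w 0\<bar> + L * (\<bar>a\<bar> + \<bar>y\<bar>))"
    proof (rule AE_I2)
      fix y
      have "\<bar>w (a-y)\<bar> \<le> \<bar>w 0\<bar> + L * \<bar>a - y\<bar>" using lip[of "a-y" 0] by auto
      also have "\<dots> \<le> \<bar>w 0\<bar> + L * (\<bar>a\<bar> + \<bar>y\<bar>)" using L by (intro add_left_mono mult_left_mono) auto
      finally show "norm (w (a - y)) \<le> norm (\<bar>w 0\<bar> + L * (\<bar>a\<bar> + \<bar>y\<bar>))" by simp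
    qed
  qed simp
  define v where "v a = w a - w (a - z)" for a
  have vb: "\<bar>v a\<bar> \<le> L * \<bar>z\<bar>" for a unfolding v_def using lip[of a "a - z"] by simp
  have [measurable]: "v \<in> borel_measurable borel" unfolding v_def by measurable
  have vlip: "\<bar>v x - v y\<bar> \<le> 2 * L * \<bar>x - y\<bar>" for x y
    using lip[of x y] lip[of "x-z" "y-z"] unfolding v_def by (auto simp: abs_le_iff algebra_simps)
  have intv: "integrable \<nu> (\<lambda>y. v (a - y))" for a
    by (rule integrable_const_bound[of _ "L * \<bar>z\<bar>"]) (auto simp: vb)
  have vharm: "v a = (\<integral>y. v (a - y) \<partial>\<nu>)" if "a > 0" "a - z > 0" for a
  proof -
    have "(\<integral>y. v (a - y) \<partial>\<nu>) = (\<integral>y. w (a - y) - w (a - z - y) \<partial>\<nu>)"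
      unfolding v_def by (simp add: algebra_simps)
    also have "\<dots> = v a" unfolding v_def using that harm[of a] harm[of "a-z"] intw by simp
    finally show ?thesis by simp
  qed
  obtain s a where a: "filterlim a at_top sequentially" "(\<lambda>n. v (a n)) \<longlonglongrightarrow> s"
    and up: "\<And>\<eta>. \<eta> > 0 \<Longrightarrow> \<forall>\<^sub>F x in at_top. v x < s + \<eta>"
    using bounded_limsup_sequence[of v, OF vb] by blast
  have shift: "filterlim (\<lambda>n. b n - y) at_top sequentially" if "filterlim b at_top sequentially" for b :: "nat \<Rightarrow> real" and y
    using filterlim_tendsto_add_at_top[OF tendsto_const[of "-y"] that] by (simp add: algebra_simps)
  have step: "(\<lambda>n. v (b n - z)) \<longlonglongrightarrow> s"
    if b: "filterlim b at_top sequentially" "(\<lambda>n. v (b n)) \<longlonglongrightarrow> s" for b :: "nat \<Rightarrow> real"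
  proof -
    \<comment> \<open>\<open>v (b n - y)\<close> does not exceed \<open>s\<close> in the limit, by dominated convergence also in the mean; as its mean tends to \<open>s\<close>, so does the function itself in \<open>L\<^sup>1\<close>\<close>
    have P0: "(\<lambda>n. \<integral>y. max 0 (v (b n - y) - s) \<partial>\<nu>) \<longlonglongrightarrow> (\<integral>y. 0 \<partial>\<nu>)"
    proof (rule integral_dominated_convergence[where w="\<lambda>_. L * \<bar>z\<bar> + \<bar>s\<bar>"])
      show "AE y in \<nu>. (\<lambda>n. max 0 (v (b n - y) - s)) \<longlonglongrightarrow> 0"
      proof (rule AE_I2, rule LIMSEQ_I)
        fix y r :: real assume "r > 0"
        have "\<forall>\<^sub>F n in sequentially. v (b n - y) < s + r"
          using eventually_compose_filterlim[OF up[OF \<open>r>0\<close>] shift[OF b(1), of y]] .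
        then have "\<forall>\<^sub>F n in sequentially. norm (max 0 (v (b n - y) - s) - 0) < r"
          by eventually_elim (use \<open>r>0\<close> in auto)
        then show "\<exists>no. \<forall>n\<ge>no. norm (max 0 (v (b n - y) - s) - 0) < r" by (simp add: eventually_sequentially)
      qed
      show "AE y in \<nu>. norm (max 0 (v (b n - y) - s)) \<le> L * \<bar>z\<bar> + \<bar>s\<bar>" for n
        by (rule AE_I2) (use vb L in \<open>auto simp: max_def abs_le_iff\<close>, smt (verit))
    qed auto
    have pos: "\<forall>\<^sub>F n in sequentially. b n > 0 \<and> b n - z > 0"
      using b(1) shift[OF b(1), of z] unfolding filterlim_at_top_dense by (auto simp: eventually_conj_iff)
    have "(\<lambda>n. 2 * (\<integral>y. max 0 (v (b n - y) - s) \<partial>\<nu>) - (v (b n) - s)) \<longlonglongrightarrow> 2 * 0 - (s - s)"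
      using P0 by (intro tendsto_intros b(2)) auto
    moreover have "\<forall>\<^sub>F n in sequentially. 2 * (\<integral>y. max 0 (v (b n - y) - s) \<partial>\<nu>) - (v (b n) - s) = (\<integral>y. \<bar>v (b n - y) - s\<bar> \<partial>\<nu>)"
      using pos
    proof eventually_elim
      case (elim n)
      have i: "integrable \<nu> (\<lambda>y. v (b n - y) - s)" using intv by auto
      have "(\<integral>y. \<bar>v (b n - y) - s\<bar> \<partial>\<nu>) = (\<integral>y. 2 * max 0 (v (b n - y) - s) - (v (b n - y) - s) \<partial>\<nu>)"
        by (intro Bochner_Integration.integral_cong) (auto simp: max_def)
      also have "\<dots> = 2 * (\<integral>y. max 0 (v (b n - y) - s) \<partial>\<nu>) - (\<integral>y. v (b n - y) - s \<partial>\<nu>)"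
        using i by (subst Bochner_Integration.integral_diff) auto
      also have "(\<integral>y. v (b n - y) - s \<partial>\<nu>) = v (b n) - s"
        using vharm elim intv by (simp add: prob_space)
      finally show ?case by simp
    qed
    ultimately have E: "(\<lambda>n. \<integral>y. \<bar>v (b n - y) - s\<bar> \<partial>\<nu>) \<longlonglongrightarrow> 0"
      by (auto elim: Lim_transform_eventually)
    show ?thesis
    proof (rule LIMSEQ_I)
      fix r :: real assume "r > 0"
      define e where "e = r / (4 * L + 1)"
      have e: "e > 0" "2 * L * e < r / 2 + 0 * e" using \<open>r>0\<close> L by (auto simp: e_def field_simps)
      define p where "p = measure \<nu> (ball z e)"
      have p: "p > 0" using z e by (simp add: p_def)
      have key: "p * \<bar>v (b n - z) - s\<bar> \<le> 2 * L * e * p + (\<integral>y. \<bar>v (b n - y) - s\<bar> \<partial>\<nu>)" for n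
      proof -
        have "p * \<bar>v (b n - z) - s\<bar> = (\<integral>y. indicator (ball z e) y * \<bar>v (b n - z) - s\<bar> \<partial>\<nu>)"
          by (simp add: p_def)
        also have "\<dots> \<le> (\<integral>y. indicator (ball z e) y * (2 * L * e) + \<bar>v (b n - y) - s\<bar> \<partial>\<nu>)"
        proof (rule integral_mono)
          show "integrable \<nu> (\<lambda>y. indicat_real (ball z e) y * \<bar>v (b n - z) - s\<bar>)"
            by (intro integrable_mult_left integrable_real_indicator) (auto simp: emeasure_eq_measure)
          show "integrable \<nu> (\<lambda>y. indicator (ball z e) y * (2 * L * e) + \<bar>v (b n - y) - s\<bar>)"
            using intv by (intro Bochner_Integration.integrable_add integrable_mult_left integrable_real_indicator integrable_abs)
              (auto simp: emeasure_eq_measure)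
          fix y
          show "indicat_real (ball z e) y * \<bar>v (b n - z) - s\<bar> \<le> indicator (ball z e) y * (2 * L * e) + \<bar>v (b n - y) - s\<bar>"
          proof (cases "y \<in> ball z e")
            case True
            have "\<bar>v (b n - z) - v (b n - y)\<bar> \<le> 2 * L * \<bar>z - y\<bar>" using vlip[of "b n - z" "b n - y"] by (simp add: abs_minus_commute)
            also have "\<dots> \<le> 2 * L * e" using True L by (intro mult_left_mono) (auto simp: dist_real_def)
            finally show ?thesis using True by auto
          qed auto
        qed
        also have "\<dots> = 2 * L * e * p + (\<integral>y. \<bar>v (b n - y) - s\<bar> \<partial>\<nu>)"
          using intv by (subst Bochner_Integration.integral_add) (auto simp: p_def emeasure_eq_measure intro!: integrable_mult_left integrable_real_indicator)
        finally show ?thesis .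
      qed
      have "\<forall>\<^sub>F n in sequentially. (\<integral>y. \<bar>v (b n - y) - s\<bar> \<partial>\<nu>) < p * (r/2)"
        using order_tendstoD(2)[OF E, of "p * (r/2)"] p \<open>r>0\<close> by simp
      then have "\<forall>\<^sub>F n in sequentially. norm (v (b n - z) - s) < r"
      proof eventually_elim
        case (elim n)
        have "p * \<bar>v (b n - z) - s\<bar> < 2 * L * e * p + p * (r/2)" using key[of n] elim by linarith
        also have "\<dots> = p * (2*L*e + r/2)" by (simp add: algebra_simps)
        also have "\<dots> \<le> p * r" using e p by (intro mult_left_mono) auto
        finally show ?case using p by simp
      qed
      then show "\<exists>no. \<forall>n\<ge>no. norm (v (b n - z) - s) < r" by (simp add: eventually_sequentially)
    qed
  qed
  have iter: "(\<lambda>n. v (a n - real k * z)) \<longlonglongrightarrow> s" for k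
  proof (induction k)
    case (Suc k)
    then show ?case using step[of "\<lambda>n. a n - real k * z"] shift[OF a(1)] by (simp add: algebra_simps)
  qed (use a in simp)
  have sk: "real k * s \<le> 2 * C" for k
  proof -
    have "(\<lambda>n. \<Sum>j<k. v (a n - real j * z)) \<longlonglongrightarrow> (\<Sum>j<k. s)" by (intro tendsto_sum iter)
    then have lim: "(\<lambda>n. \<Sum>j<k. v (a n - real j * z)) \<longlonglongrightarrow> real k * s" by simp
    have tel: "(\<Sum>j<k. v (x - real j * z)) = w x - w (x - real k * z)" for x
      by (induction k) (auto simp: v_def algebra_simps)
    have "\<forall>\<^sub>F n in sequentially. a n > 0 \<and> a n - real k * z > 0"
      using a(1) shift[OF a(1), of "real k * z"] unfolding filterlim_at_top_dense by (auto simp: eventually_conj_iff)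
    then have "\<forall>\<^sub>F n in sequentially. (\<Sum>j<k. v (a n - real j * z)) \<le> 2 * C"
    proof eventually_elim
      case (elim n)
      then show ?case unfolding tel using bnd[of "a n"] bnd[of "a n - real k * z"] by (auto simp: abs_le_iff)
    qed
    from tendsto_upperbound[OF lim this] show ?thesis by simp
  qed
  have "s \<le> 0"
  proof (rule ccontr)
    assume "\<not> s \<le> 0"
    then obtain k where "real k * s > 2 * C" using reals_Archimedean3[of s] by (auto simp: not_le)
    then show False using sk[of k] by linarith
  qed
  then show ?thesis using up[OF \<eta>] unfolding v_def by (auto elim: eventually_mono)
qed

text \<open>The shifts whose increments vanish at infinity form a closed subgroup of the line. The previous
  lemma, applied to \<open>w\<close> and to \<open>- w\<close>, puts the support of
  \<open>\<nu>\<close> into it, so it cannot be cyclic.\<close>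

theorem lipschitz_harmonic_increment_tendsto_0:
  fixes w :: "real \<Rightarrow> real"
  assumes prob: "prob_space \<nu>" and sets[measurable_cong]: "sets \<nu> = sets borel"
    and int: "integrable \<nu> (\<lambda>z. z)"
    and lip: "\<And>x y. \<bar>w x - w y\<bar> \<le> L * \<bar>x - y\<bar>"
    and bnd: "\<And>x. 0 \<le> x \<Longrightarrow> \<bar>w x\<bar> \<le> C"
    and harm: "\<And>a. 0 < a \<Longrightarrow> w a = (\<integral>z. w (a - z) \<partial>\<nu>)"
    and na: "\<not> (\<exists>d>0. AE z in \<nu>. \<exists>k::int. z = d * of_int k)"
  shows "((\<lambda>a. w a - w (a - x)) \<longlongrightarrow> 0) at_top"
proof -
  interpret prob_space \<nu> by fact
  have L: "L \<ge> 0" using lip[of 1 0] by simp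
  define G where "G = {x. ((\<lambda>a. w a - w (a - x)) \<longlongrightarrow> 0) at_top}"
  have supp: "z \<in> G" if z: "\<And>\<eta>. \<eta> > 0 \<Longrightarrow> measure \<nu> (ball z \<eta>) > 0" for z
  proof -
    have "\<forall>\<^sub>F a in at_top. w a - w (a - z) < \<eta>" "\<forall>\<^sub>F a in at_top. - w a - (- w (a - z)) < \<eta>" if "\<eta> > 0" for \<eta>
    proof -
      show "\<forall>\<^sub>F a in at_top. w a - w (a - z) < \<eta>"
        by (rule lipschitz_harmonic_limsup_zero[OF prob sets int lip bnd harm z that])
      show "\<forall>\<^sub>F a in at_top. - w a - (- w (a - z)) < \<eta>"
        by (rule lipschitz_harmonic_limsup_zero[OF prob sets int, where w="\<lambda>x. - w x" and L=L and C=C])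
          (use lip bnd harm z that in \<open>auto simp: abs_minus_commute\<close>)
    qed
    then show ?thesis unfolding G_def tendsto_iff
      by (auto simp: dist_real_def abs_less_iff eventually_conj_iff)
  qed
  have shift: "filterlim (\<lambda>a. a - y) at_top (at_top :: real filter)" for y
    using filterlim_tendsto_add_at_top[OF tendsto_const[of "-y"] filterlim_ident] by (simp add: algebra_simps)
  have diff: "x - y \<in> G" if "x \<in> G" "y \<in> G" for x y
  proof -
    have "((\<lambda>a. w (a + y) - w (a + y - x)) \<longlongrightarrow> 0) at_top" "((\<lambda>a. w (a + y) - w (a + y - y)) \<longlongrightarrow> 0) at_top"
      using filterlim_compose[OF _ shift[of "-y"], of "\<lambda>a. w a - w (a - x)"]
        filterlim_compose[OF _ shift[of "-y"], of "\<lambda>a. w a - w (a - y)"] that unfolding G_def by auto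
    from tendsto_diff[OF this] show ?thesis unfolding G_def by (simp add: algebra_simps)
  qed
  have clo: "closed G"
    unfolding closed_sequential_limits
  proof (intro allI impI, elim conjE)
    fix f l assume f: "\<forall>n. f n \<in> G" "f \<longlonglongrightarrow> l"
    show "l \<in> G" unfolding G_def mem_Collect_eq tendsto_iff
    proof (intro allI impI)
      fix e :: real assume "e > 0"
      define e' where "e' = e / (2 * (L + 1))"
      have e': "e' > 0" "L * e' \<le> e/2" using L \<open>e>0\<close> by (auto simp: e'_def field_simps)
      obtain n where n: "\<bar>f n - l\<bar> < e'" using f(2) e' unfolding LIMSEQ_iff by (metis order_refl real_norm_def)
      have "\<forall>\<^sub>F a in at_top. dist (w a - w (a - f n)) 0 < e/2"
        using f(1)[rule_format, of n] half_gt_zero[OF \<open>e>0\<close>] unfolding G_def tendsto_iff by blast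
      then show "\<forall>\<^sub>F a in at_top. dist (w a - w (a - l)) 0 < e"
      proof eventually_elim
        case (elim a)
        have "\<bar>w (a - l) - w (a - f n)\<bar> \<le> L * \<bar>f n - l\<bar>" using lip[of "a-l" "a - f n"] by (simp add: abs_minus_commute)
        also have "\<dots> \<le> L * e'" using n L by (intro mult_left_mono) auto
        finally have "\<bar>w (a - l) - w (a - f n)\<bar> \<le> e / 2" using e' by linarith
        moreover have "\<bar>w a - w (a - f n)\<bar> < e / 2" using elim by (simp add: dist_real_def)
        ultimately have "\<bar>w a - w (a - l)\<bar> < e" by linarith
        then show ?case by (simp add: dist_real_def)
      qed
    qed
  qed
  have "G = UNIV"
  proof (rule ccontr)
    assume "G \<noteq> UNIV"
    moreover have "0 \<in> G" unfolding G_def by simp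
    ultimately obtain d where d: "d > 0" "\<And>x. x \<in> G \<Longrightarrow> \<exists>k::int. x = d * of_int k"
      using closed_subgroup_real_cyclic[OF clo _ diff] by blast
    have "AE z in \<nu>. z \<in> G" by (rule AE_in_support[OF prob sets supp])
    then have "AE z in \<nu>. \<exists>k::int. z = d * of_int k" using d by (auto elim: eventually_mono)
    then show False using na d by blast
  qed
  then show ?thesis unfolding G_def by auto
qed


section \<open>Shiryaev--Roberts paths on sequence space\<close>

text \<open>The first \<open>n\<close> coordinates are independent of the shifted sequence, which has the same
  law as the whole one. Every Markov property below comes from this.\<close>

lemma (in sequence_space) nn_integral_comb_seq:
  assumes [measurable]: "g \<in> borel_measurable S"
  shows "(\<integral>\<^sup>+x. g x \<partial>S) = (\<integral>\<^sup>+x. \<integral>\<^sup>+y. g (comb_seq n x y) \<partial>S \<partial>S)"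
proof -
  have "(\<integral>\<^sup>+x. g x \<partial>S) = (\<integral>\<^sup>+x. g x \<partial>distr (S \<Otimes>\<^sub>M S) S (\<lambda>(x, y). comb_seq n x y))"
    by (simp add: PiM_comb_seq)
  also have "\<dots> = (\<integral>\<^sup>+z. g (case z of (x, y) \<Rightarrow> comb_seq n x y) \<partial>(S \<Otimes>\<^sub>M S))"
    by (intro nn_integral_distr measurable_comb_seq) simp
  also have "\<dots> = (\<integral>\<^sup>+x. \<integral>\<^sup>+y. g (comb_seq n x y) \<partial>S \<partial>S)"
    by (subst P.nn_integral_fst[symmetric]) auto
  finally show ?thesis .
qed

lemma (in sequence_space) nn_integral_case_nat:
  assumes [measurable]: "g \<in> borel_measurable S"
  shows "(\<integral>\<^sup>+x. g x \<partial>S) = (\<integral>\<^sup>+a. \<integral>\<^sup>+y. g (case_nat a y) \<partial>S \<partial>M)"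
proof -
  have m: "(\<lambda>(a, y). case_nat a y) \<in> measurable (M \<Otimes>\<^sub>M S) S" by measurable
  have "(\<integral>\<^sup>+x. g x \<partial>S) = (\<integral>\<^sup>+x. g x \<partial>distr (M \<Otimes>\<^sub>M S) S (\<lambda>(a, y). case_nat a y))"
    by (simp add: PiM_iter)
  also have "\<dots> = (\<integral>\<^sup>+z. g (case z of (a, y) \<Rightarrow> case_nat a y) \<partial>(M \<Otimes>\<^sub>M S))"
    by (intro nn_integral_distr m) simp
  also have "\<dots> = (\<integral>\<^sup>+a. \<integral>\<^sup>+y. g (case_nat a y) \<partial>S \<partial>M)"
    by (subst P.nn_integral_fst[symmetric]) (auto intro!: measurable_compose[OF m])
  finally show ?thesis .
qed

lemma (in sequence_space) nn_integral_component:
  assumes "g \<in> borel_measurable M"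
  shows "(\<integral>\<^sup>+x. g (x n) \<partial>S) = (\<integral>\<^sup>+a. g a \<partial>M)"
  using nn_integral_distr[of "\<lambda>x. x n" S M g] PiM_component[of n] assms by simp

lemma (in sequence_space) integral_component:
  fixes g :: "_ \<Rightarrow> real"
  assumes "g \<in> borel_measurable M"
  shows "(\<integral>x. g (x n) \<partial>S) = (\<integral>a. g a \<partial>M)"
  using integral_distr[of "\<lambda>x. x n" S M g] PiM_component[of n] assms by simp

text \<open>For \<open>c = 1\<close>, \<open>r = 0\<close> this is the Shiryaev--Roberts statistic, and for
  \<open>c = 0\<close> it is \<open>r\<close> times the exponential of the log-likelihood walk.
  With both parameters free, the statistic, its restarts from an arbitrary value, and the walk to
  which it is compared all obey one recursion.\<close>

primrec sr_path :: "real \<Rightarrow> real \<Rightarrow> (nat \<Rightarrow> real) \<Rightarrow> nat \<Rightarrow> real" where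
  "sr_path c r x 0 = r"
| "sr_path c r x (Suc n) = (c + sr_path c r x n) * x n"

definition lr_prod :: "(nat \<Rightarrow> real) \<Rightarrow> nat \<Rightarrow> real" where "lr_prod x n = (\<Prod>i<n. x i)"

text \<open>Survival is counted from time \<open>0\<close>. For a start \<open>r < A\<close> this makes no
  difference to the stopping time, and a start \<open>r \<ge> A\<close> stops at once, so that
  restarting after an overshoot needs no case distinction.\<close>

definition alive :: "real \<Rightarrow> real \<Rightarrow> real \<Rightarrow> (nat \<Rightarrow> real) \<Rightarrow> nat \<Rightarrow> bool" where
  "alive c r A x n \<longleftrightarrow> (\<forall>j\<le>n. sr_path c r x j < A)"

lemma lr_prod_0[simp]: "lr_prod x 0 = 1" by (simp add: lr_prod_def)
lemma lr_prod_Suc: "lr_prod x (Suc n) = lr_prod x n * x n" by (simp add: lr_prod_def)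
lemma lr_prod_pos: "(\<And>i. x i > 0) \<Longrightarrow> lr_prod x n > 0" by (simp add: lr_prod_def prod_pos)
lemma lr_prod_nonneg: "(\<And>i. x i \<ge> 0) \<Longrightarrow> lr_prod x n \<ge> 0" by (simp add: lr_prod_def prod_nonneg)
lemma lr_prod_case_nat: "lr_prod (case_nat y x) (Suc n) = y * lr_prod x n"
  by (induction n) (auto simp: lr_prod_Suc)

lemma sr_path_case_nat: "sr_path c r (case_nat y x) (Suc n) = sr_path c ((c + r) * y) x n"
  by (induction n) (auto simp: )

lemma sr_path_cong: "(\<And>i. i < n \<Longrightarrow> x i = y i) \<Longrightarrow> sr_path c r x n = sr_path c r y n"
  by (induction n) auto

lemma sr_path_comb_seq_le: "k \<le> n \<Longrightarrow> sr_path c r (comb_seq n x y) k = sr_path c r x k"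
  by (intro sr_path_cong) (simp add: comb_seq_less)

lemma sr_path_comb_seq_add: "sr_path c r (comb_seq n x y) (n + k) = sr_path c (sr_path c r x n) y k"
proof (induction k)
  case 0
  show ?case using sr_path_comb_seq_le[of n n] by simp
qed (auto simp: comb_seq_def)

text \<open>The start enters only through \<open>r * lr_prod x n\<close>, which is exponentially small before
  the change: the statistic forgets where it began.\<close>

lemma sr_path_affine: "sr_path c r x n = sr_path c 0 x n + r * lr_prod x n"
  by (induction n) (auto simp: lr_prod_Suc algebra_simps)

lemma sr_path_0: "sr_path 0 r x n = r * lr_prod x n"
  by (induction n) (auto simp: lr_prod_Suc algebra_simps)

lemma sr_path_nonneg: "(\<And>i. x i \<ge> 0) \<Longrightarrow> 0 \<le> c \<Longrightarrow> 0 \<le> r \<Longrightarrow> 0 \<le> sr_path c r x n"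
  by (induction n) auto

lemma sr_path_pos: "(\<And>i. x i > 0) \<Longrightarrow> 0 \<le> c \<Longrightarrow> 0 \<le> r \<Longrightarrow> 0 < c + r \<Longrightarrow> 0 < c + sr_path c r x n"
  by (induction n) (auto intro: add_nonneg_pos)

lemma sr_path_mono: "(\<And>i. x i \<ge> 0) \<Longrightarrow> r \<le> r' \<Longrightarrow> sr_path c r x n \<le> sr_path c r' x n"
  by (subst (1 2) sr_path_affine) (auto intro!: mult_right_mono lr_prod_nonneg)

text \<open>Adding \<open>c\<close> at each step only helps, so \<open>c + sr_path c r x n\<close> stays above
  the pure walk started at \<open>c + r\<close>, and escape estimates for the walk hold for the
  statistic.\<close>

lemma sr_path_ge_lr_prod:
  assumes "\<And>i. x i \<ge> 0" "0 \<le> c"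
  shows "(c + r) * lr_prod x n \<le> c + sr_path c r x n"
proof (induction n)
  case (Suc n)
  have "(c + r) * lr_prod x n * x n \<le> (c + sr_path c r x n) * x n" using Suc assms by (intro mult_right_mono) auto
  then show ?case using assms by (simp add: lr_prod_Suc algebra_simps)
qed auto

lemma sr_path_eq_lr_prod_sum:
  assumes "\<And>i. x i > 0"
  shows "sr_path c r x n = lr_prod x n * (r + c * (\<Sum>j<n. 1 / lr_prod x j))"
proof (induction n)
  case (Suc n)
  then show ?case using lr_prod_pos[of x n, OF assms]
    by (simp add: lr_prod_Suc field_simps)
qed auto

lemma alive_case_nat: "alive c r A (case_nat y x) (Suc n) \<longleftrightarrow> r < A \<and> alive c ((c + r) * y) A x n"
proof -
  have "j \<le> Suc n \<longleftrightarrow> j = 0 \<or> (\<exists>i\<le>n. j = Suc i)" for j by (cases j) auto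
  then have "alive c r A (case_nat y x) (Suc n) \<longleftrightarrow>
      sr_path c r (case_nat y x) 0 < A \<and> (\<forall>i\<le>n. sr_path c r (case_nat y x) (Suc i) < A)"
    unfolding alive_def by (metis (no_types, lifting))
  then show ?thesis by (simp add: alive_def sr_path_case_nat del: sr_path.simps(2))
qed

lemma alive_comb_seq_le: "k \<le> n \<Longrightarrow> alive c r A (comb_seq n x y) k \<longleftrightarrow> alive c r A x k"
  unfolding alive_def by (auto simp: sr_path_comb_seq_le)

lemma alive_comb_seq_add:
  "alive c r A (comb_seq n x y) (n + k) \<longleftrightarrow> alive c r A x n \<and> alive c (sr_path c r x n) A y k"
proof -
  have "j \<le> n + k \<longleftrightarrow> j \<le> n \<or> (\<exists>i\<le>k. j = n + i)" for j by presburger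
  then show ?thesis unfolding alive_def
    by (metis sr_path_comb_seq_add sr_path_comb_seq_le)
qed

lemma alive_antimono: "alive c r A x n \<Longrightarrow> m \<le> n \<Longrightarrow> alive c r A x m"
  unfolding alive_def by auto

lemma measurable_sr_path[measurable]:
  assumes [measurable_cong]: "sets M = sets borel" and "x \<in> measurable N (\<Pi>\<^sub>M i\<in>UNIV. M)" and [measurable]: "r \<in> borel_measurable N"
  shows "(\<lambda>\<omega>. sr_path c (r \<omega>) (x \<omega>) n) \<in> borel_measurable N"
proof -
  have [measurable]: "(\<lambda>\<omega>. x \<omega> i) \<in> borel_measurable N" for i
    using measurable_compose[OF assms(2) measurable_component_singleton[of i UNIV]] measurable_cong_sets[OF refl assms(1)] by auto
  show ?thesis by (induction n) auto
qed

lemma measurable_lr_prod[measurable]: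
  assumes [measurable_cong]: "sets M = sets borel" and "x \<in> measurable N (\<Pi>\<^sub>M i\<in>UNIV. M)"
  shows "(\<lambda>\<omega>. lr_prod (x \<omega>) n) \<in> borel_measurable N"
  using measurable_sr_path[OF assms, of "\<lambda>_. 1" 0 n] by (simp add: sr_path_0)

lemma measurable_alive[measurable]:
  assumes [measurable_cong]: "sets M = sets borel" and [measurable]: "x \<in> measurable N (\<Pi>\<^sub>M i\<in>UNIV. M)" and [measurable]: "r \<in> borel_measurable N"
  shows "Measurable.pred N (\<lambda>\<omega>. alive c (r \<omega>) A (x \<omega>) n)"
proof -
  note [measurable] = measurable_sr_path[OF assms]
  show ?thesis unfolding alive_def by measurable
qed

section \<open>Likelihood ratios and the Hellinger affinity\<close>

text \<open>\<open>F\<close> and \<open>G\<close> stand for the laws of one likelihood ratio before and after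
  the change; that it is a likelihood ratio means \<open>dG = x dF\<close>. The asymptotics depend
  on the observations only through this pair.\<close>

locale likelihood_walk =
  fixes F G :: "real measure"
  assumes prob_F: "prob_space F" and sets_F[measurable_cong]: "sets F = sets borel"
    and F_nonneg: "AE x in F. 0 \<le> x"
    and G_def: "G = density F (\<lambda>x. ennreal x)" and prob_G: "prob_space G"
    and sq_int: "integrable G (\<lambda>x. (ln x)\<^sup>2)"
    and nonarith: "\<not> (\<exists>d>0. AE x in G. \<exists>k::int. ln x = d * of_int k)"
begin

lemma sets_G[measurable_cong]: "sets G = sets borel" using sets_F by (simp add: G_def)
lemma space_F[simp]: "space F = UNIV" using sets_eq_imp_space_eq[OF sets_F] by simp
lemma space_G[simp]: "space G = UNIV" using sets_eq_imp_space_eq[OF sets_G] by simp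

sublocale F: prob_space F by (rule prob_F)
sublocale G: prob_space G by (rule prob_G)

lemma prob_F_UNIV[simp]: "measure F UNIV = 1" using F.prob_space by simp
lemma prob_G_UNIV[simp]: "measure G UNIV = 1" using G.prob_space by simp
lemma emeasure_F_UNIV[simp]: "emeasure F UNIV = 1" using F.emeasure_space_1 by simp
lemma emeasure_G_UNIV[simp]: "emeasure G UNIV = 1" using G.emeasure_space_1 by simp

sublocale FS: sequence_space F by unfold_locales
sublocale GS: sequence_space G by unfold_locales

abbreviation "FS \<equiv> \<Pi>\<^sub>M i\<in>(UNIV::nat set). F"
abbreviation "GS \<equiv> \<Pi>\<^sub>M i\<in>(UNIV::nat set). G"

lemmas sr_path_F[measurable] = measurable_sr_path[OF sets_F]
lemmas sr_path_G[measurable] = measurable_sr_path[OF sets_G]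
lemmas lr_prod_F[measurable] = measurable_lr_prod[OF sets_F]
lemmas lr_prod_G[measurable] = measurable_lr_prod[OF sets_G]
lemmas alive_F[measurable] = measurable_alive[OF sets_F]
lemmas alive_G[measurable] = measurable_alive[OF sets_G]

lemma nn_integral_G:
  assumes [measurable]: "h \<in> borel_measurable borel"
  shows "(\<integral>\<^sup>+x. h x \<partial>G) = (\<integral>\<^sup>+x. ennreal x * h x \<partial>F)"
  unfolding G_def by (subst nn_integral_density) auto

lemma G_pos: "AE x in G. 0 < x"
  unfolding G_def by (subst AE_density) (auto simp: ennreal_eq_0_iff intro: AE_I2)

lemma FS_nonneg: "AE x in FS. \<forall>i. 0 \<le> x i"
  unfolding AE_all_countable using FS.AE_component[OF _ F_nonneg] by auto

lemma GS_pos: "AE x in GS. \<forall>i. 0 < x i"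
  unfolding AE_all_countable using GS.AE_component[OF _ G_pos] by auto

text \<open>The Hellinger affinity. It is the mean of \<open>sqrt x\<close> under \<open>F\<close> and of
  \<open>1 / sqrt x\<close> under \<open>G\<close>, and multiplicative along independent
  observations. Being less than \<open>1\<close>, it gives exponential bounds on both sides of the
  change in place of a law of large numbers.\<close>

definition \<rho> :: real where "\<rho> = (\<integral>x. sqrt x \<partial>F)"
definition drift :: real where "drift = (\<integral>x. ln x \<partial>G)"

lemma nn_integral_F_id: "(\<integral>\<^sup>+x. ennreal x \<partial>F) = 1"
  using G.emeasure_space_1 nn_integral_G[of "\<lambda>_. 1"] by simp

lemma integrable_F_id: "integrable F (\<lambda>x. x)" and integral_F_id: "(\<integral>x. x \<partial>F) = 1"
proof -
  show "integrable F (\<lambda>x. x)"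
    using nn_integral_F_id F_nonneg by (intro integrableI_nonneg) auto
  show "(\<integral>x. x \<partial>F) = 1"
    using nn_integral_F_id F_nonneg by (subst integral_eq_nn_integral) auto
qed

lemma integrable_F_sqrt: "integrable F (\<lambda>x. sqrt x)"
proof (rule Bochner_Integration.integrable_bound)
  show "integrable F (\<lambda>x. 1 + x)" using integrable_F_id by auto
  show "AE x in F. norm (sqrt x) \<le> norm (1 + x)"
    using F_nonneg
  proof eventually_elim
    case (elim x)
    have "0 \<le> (sqrt x - 1)\<^sup>2" by simp
    also have "\<dots> = x - 2 * sqrt x + 1" using elim by (simp add: power2_eq_square algebra_simps)
    finally show ?case using elim by (auto simp: )
  qed
qed auto

lemma nn_integral_F_sqrt: "(\<integral>\<^sup>+x. ennreal (sqrt x) \<partial>F) = ennreal \<rho>"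
  unfolding \<rho>_def using integrable_F_sqrt F_nonneg by (intro nn_integral_eq_integral) auto

lemma nn_integral_G_inverse_sqrt: "(\<integral>\<^sup>+x. ennreal (1 / sqrt x) \<partial>G) = ennreal \<rho>"
proof -
  have "(\<integral>\<^sup>+x. ennreal (1 / sqrt x) \<partial>G) = (\<integral>\<^sup>+x. ennreal (sqrt x) \<partial>F)"
    using F_nonneg by (subst nn_integral_G)
      (auto intro!: nn_integral_cong_AE simp: ennreal_mult'[symmetric] real_div_sqrt elim!: eventually_mono)
  then show ?thesis using nn_integral_F_sqrt by simp
qed

lemma \<rho>_nonneg: "0 \<le> \<rho>"
  unfolding \<rho>_def using F_nonneg by (intro integral_nonneg_AE) auto

text \<open>The mean of \<open>(1 - sqrt x)\<^sup>2\<close> under \<open>F\<close> is \<open>2 - 2 *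
  \<rho>\<close>. If it vanished, all log-likelihood ratios would be \<open>0\<close>, which is
  arithmetic.\<close>

lemma \<rho>_less_1: "\<rho> < 1"
proof (rule ccontr)
  assume "\<not> \<rho> < 1"
  have e: "AE x in F. (1 - sqrt x)\<^sup>2 = 1 - 2 * sqrt x + x"
    using F_nonneg by eventually_elim (simp add: power2_eq_square algebra_simps)
  have i: "integrable F (\<lambda>x. 1 - 2 * sqrt x + x)" using integrable_F_id integrable_F_sqrt by auto
  then have i2: "integrable F (\<lambda>x. (1 - sqrt x)\<^sup>2)"
    using e by (subst integrable_cong_AE[OF _ _ e]) auto
  have "(\<integral>x. (1 - sqrt x)\<^sup>2 \<partial>F) = (\<integral>x. 1 - 2 * sqrt x + x \<partial>F)"
    using e by (intro integral_cong_AE) auto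
  also have "\<dots> = 2 - 2 * \<rho>"
    using integrable_F_id integrable_F_sqrt by (simp add: integral_F_id \<rho>_def F.prob_space)
  finally have "(\<integral>x. (1 - sqrt x)\<^sup>2 \<partial>F) \<le> 0" using \<open>\<not> \<rho> < 1\<close> by simp
  moreover have "(\<integral>x. (1 - sqrt x)\<^sup>2 \<partial>F) \<ge> 0" by (intro Bochner_Integration.integral_nonneg) auto
  ultimately have "(\<integral>x. (1 - sqrt x)\<^sup>2 \<partial>F) = 0" by simp
  then have "AE x in F. (1 - sqrt x)\<^sup>2 = 0"
    using i2 by (subst (asm) integral_nonneg_eq_0_iff_AE) auto
  then have "AE x in F. x = 1" by eventually_elim simp
  then have "AE x in G. x = 1" unfolding G_def by (subst AE_density) (auto elim: eventually_mono)
  then have "AE x in G. \<exists>k::int. ln x = 1 * of_int k" by eventually_elim (auto intro: exI[of _ 0])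
  then show False using nonarith zero_less_one by blast
qed

lemma integrable_ln: "integrable G (\<lambda>x. ln x)"
  by (rule G.square_integrable_imp_integrable[OF _ sq_int]) auto

text \<open>Integrating \<open>ln x \<ge> 2 * (1 - 1 / sqrt x)\<close> bounds the drift from below by \<open>2
  * (1 - \<rho>)\<close>.\<close>

lemma drift_pos: "0 < drift"
proof -
  have i: "integrable G (\<lambda>x. 1 / sqrt x)"
    using nn_integral_G_inverse_sqrt G_pos by (intro integrableI_nonneg) (auto elim: eventually_mono)
  have e: "(\<integral>x. 1 / sqrt x \<partial>G) = \<rho>"
    using nn_integral_G_inverse_sqrt G_pos \<rho>_nonneg by (subst integral_eq_nn_integral) (auto elim: eventually_mono)
  have "(\<integral>x. 2 * (1 - 1 / sqrt x) \<partial>G) \<le> (\<integral>x. ln x \<partial>G)"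
  proof (rule integral_mono_AE)
    show "AE x in G. 2 * (1 - 1 / sqrt x) \<le> ln x"
      using G_pos
    proof eventually_elim
      case (elim x)
      have "ln (1 / sqrt x) \<le> 1 / sqrt x - 1" using elim by (intro ln_le_minus_one) auto
      then show ?case using elim by (simp add: ln_div ln_sqrt)
    qed
  qed (use i integrable_ln in \<open>auto intro!: integrable_mult_right Bochner_Integration.integrable_diff simp del: right_diff_distrib_numeral\<close>)
  also have "(\<integral>x. 2 * (1 - 1 / sqrt x) \<partial>G) = 2 * (1 - \<rho>)" using i e
    by (subst integral_mult_right_zero, subst Bochner_Integration.integral_diff) auto
  finally show ?thesis using \<rho>_less_1 by (simp add: drift_def)
qed

lemma nn_integral_GS_lr_prod: "(\<integral>\<^sup>+x. ennreal (1 / sqrt (lr_prod x n)) \<partial>GS) = ennreal (\<rho> ^ n)"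
proof (induction n)
  case (Suc n)
  have "(\<integral>\<^sup>+x. ennreal (1 / sqrt (lr_prod x (Suc n))) \<partial>GS)
     = (\<integral>\<^sup>+a. \<integral>\<^sup>+x. ennreal (1 / sqrt a) * ennreal (1 / sqrt (lr_prod x n)) \<partial>GS \<partial>G)"
    using G_pos GS_pos
    by (subst GS.nn_integral_case_nat)
      (auto intro!: nn_integral_cong_AE simp: lr_prod_case_nat real_sqrt_mult ennreal_mult'[symmetric] ennreal_mult lr_prod_pos less_imp_le elim!: eventually_mono)
  also have "\<dots> = ennreal \<rho> * ennreal (\<rho> ^ n)"
    using Suc by (simp add: nn_integral_cmult nn_integral_multc nn_integral_G_inverse_sqrt)
  finally show ?case using \<rho>_nonneg by (simp add: ennreal_mult)
qed (simp add: GS.P.emeasure_space_1)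

lemma nn_integral_FS_lr_prod: "(\<integral>\<^sup>+x. ennreal (sqrt (lr_prod x n)) \<partial>FS) = ennreal (\<rho> ^ n)"
proof (induction n)
  case (Suc n)
  have "(\<integral>\<^sup>+x. ennreal (sqrt (lr_prod x (Suc n))) \<partial>FS)
     = (\<integral>\<^sup>+a. \<integral>\<^sup>+x. ennreal (sqrt a) * ennreal (sqrt (lr_prod x n)) \<partial>FS \<partial>F)"
    using F_nonneg FS_nonneg
    by (subst FS.nn_integral_case_nat)
      (auto intro!: nn_integral_cong_AE simp: lr_prod_case_nat real_sqrt_mult ennreal_mult' elim!: eventually_mono)
  also have "\<dots> = ennreal \<rho> * ennreal (\<rho> ^ n)"
    using Suc by (simp add: nn_integral_cmult nn_integral_multc nn_integral_F_sqrt)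
  finally show ?case using \<rho>_nonneg by (simp add: ennreal_mult)
qed (simp add: FS.P.emeasure_space_1)

lemma suminf_\<rho>: "(\<Sum>k. ennreal (\<rho> ^ k)) = ennreal (1 / (1 - \<rho>))"
  using \<rho>_nonneg \<rho>_less_1 by (subst suminf_ennreal2) (auto simp: suminf_geometric)

definition visits :: real where "visits = sqrt (exp 1) / (1 - \<rho>)"

lemma visits_pos: "visits > 0" using \<rho>_less_1 by (simp add: visits_def)

text \<open>The number of visits to an interval of logarithmic length \<open>1\<close>. Starting outside it,
  one step is taken and the induction hypothesis applies. Starting inside, each visit forces the
  product of the ratios so far below \<open>exp 1\<close>, and the expected number of such times
  is at most a geometric series in \<open>\<rho>\<close>.\<close>

lemma occupation_bound_finite:
  assumes "0 \<le> c" "0 \<le> r" "0 < c + r"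
  shows "(\<integral>\<^sup>+x. (\<Sum>k\<le>m. indicator {y..<exp 1 * y} (c + sr_path c r x k)) \<partial>GS) \<le> ennreal visits"
  using assms
proof (induction m arbitrary: r)
  case 0
  have "1 \<le> visits"
  proof -
    have "1 \<le> sqrt (exp (1::real))" by simp
    moreover have "1 - \<rho> \<le> 1" using \<rho>_nonneg by simp
    ultimately have "1 * (1 - \<rho>) \<le> sqrt (exp (1::real))" by (metis mult_1 order_trans)
    then show ?thesis using \<rho>_less_1 by (simp add: visits_def pos_le_divide_eq)
  qed
  moreover have "(\<integral>\<^sup>+x. (\<Sum>k\<le>(0::nat). indicator {y..<exp 1 * y} (c + sr_path c r x k)) \<partial>GS) \<le> (\<integral>\<^sup>+x. 1 \<partial>GS)"
    by (intro nn_integral_mono) (auto simp: indicator_def)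
  ultimately show ?case by (simp add: GS.P.emeasure_space_1 order_trans[of _ 1] ennreal_ge_1)
next
  case (Suc m)
  show ?case
  proof (cases "c + r \<in> {y..<exp 1 * y}")
    case True
    have "(\<integral>\<^sup>+x. (\<Sum>k\<le>Suc m. indicator {y..<exp 1 * y} (c + sr_path c r x k)) \<partial>GS)
       \<le> (\<integral>\<^sup>+x. (\<Sum>k\<le>Suc m. ennreal (sqrt (exp 1)) * ennreal (1 / sqrt (lr_prod x k))) \<partial>GS)"
      using GS_pos
    proof (intro nn_integral_mono_AE, eventually_elim)
      case (elim x)
      show ?case
      proof (intro sum_mono)
        fix k
        have p: "lr_prod x k > 0" using elim lr_prod_pos by blast
        show "indicator {y..<exp 1 * y} (c + sr_path c r x k) \<le> ennreal (sqrt (exp 1)) * ennreal (1 / sqrt (lr_prod x k))"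
        proof (cases "c + sr_path c r x k \<in> {y..<exp 1 * y}")
          case T: True
          have "(c + r) * lr_prod x k \<le> c + sr_path c r x k" using elim Suc.prems by (intro sr_path_ge_lr_prod) (auto intro: less_imp_le)
          also have "\<dots> < exp 1 * y" using T by auto
          also have "\<dots> \<le> exp 1 * (c + r)" using True by auto
          finally have "lr_prod x k < exp 1" using Suc.prems by (simp add: mult.commute)
          then have "1 \<le> sqrt (exp 1) * (1 / sqrt (lr_prod x k))" using p by (simp add: field_simps)
          then have "1 \<le> ennreal (sqrt (exp 1) * (1 / sqrt (lr_prod x k)))" by (simp only: ennreal_ge_1)
          also have "\<dots> = ennreal (sqrt (exp 1)) * ennreal (1 / sqrt (lr_prod x k))" by (rule ennreal_mult') simp
          finally show ?thesis using T by simp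
        qed auto
      qed
    qed
    also have "\<dots> = (\<Sum>k\<le>Suc m. ennreal (sqrt (exp 1)) * ennreal (\<rho> ^ k))"
      by (subst nn_integral_sum) (auto simp: nn_integral_cmult nn_integral_GS_lr_prod)
    also have "\<dots> = ennreal (sqrt (exp 1)) * (\<Sum>k\<le>Suc m. ennreal (\<rho> ^ k))"
      by (rule sum_distrib_left[symmetric])
    also have "\<dots> \<le> ennreal (sqrt (exp 1)) * (\<Sum>k. ennreal (\<rho> ^ k))"
      by (intro mult_left_mono sum_le_suminf) auto
    also have "\<dots> = ennreal visits" unfolding suminf_\<rho> visits_def using \<rho>_less_1 by (simp add: ennreal_mult'[symmetric])
    finally show ?thesis .
  next
    case False
    have shift: "(\<Sum>k\<le>Suc m. indicator {y..<exp 1 * y} (c + sr_path c r (case_nat a x) k))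
       = (\<Sum>k\<le>m. indicator {y..<exp 1 * y} (c + sr_path c ((c + r) * a) x k) :: ennreal)" for a x
      using False by (subst sum.atMost_Suc_shift) (simp add: sr_path_case_nat del: sr_path.simps(2))
    have "(\<integral>\<^sup>+x. (\<Sum>k\<le>Suc m. indicator {y..<exp 1 * y} (c + sr_path c r x k)) \<partial>GS)
       = (\<integral>\<^sup>+a. \<integral>\<^sup>+x. (\<Sum>k\<le>m. indicator {y..<exp 1 * y} (c + sr_path c ((c + r) * a) x k)) \<partial>GS \<partial>G)"
      by (subst GS.nn_integral_case_nat) (measurable, simp only: shift)
    also have "\<dots> \<le> (\<integral>\<^sup>+a. ennreal visits \<partial>G)"
      using G_pos
    proof (intro nn_integral_mono_AE, eventually_elim)
      case (elim a)
      then have "0 < (c + r) * a" using Suc.prems by simp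
      then show ?case using Suc.prems by (intro Suc.IH) auto
    qed
    finally show ?thesis by (simp add: G.emeasure_space_1)
  qed
qed

lemma occupation_bound:
  assumes "0 \<le> c" "0 \<le> r" "0 < c + r"
  shows "(\<Sum>k. \<integral>\<^sup>+x. indicator {y..<exp 1 * y} (c + sr_path c r x k) \<partial>GS) \<le> ennreal visits"
proof (rule suminf_le_const)
  show "(\<Sum>k<n. \<integral>\<^sup>+x. indicator {y..<exp 1 * y} (c + sr_path c r x k) \<partial>GS) \<le> ennreal visits" for n
  proof -
    have "(\<Sum>k<n. \<integral>\<^sup>+x. indicator {y..<exp 1 * y} (c + sr_path c r x k) \<partial>GS)
       \<le> (\<Sum>k\<le>n. \<integral>\<^sup>+x. indicator {y..<exp 1 * y} (c + sr_path c r x k) \<partial>GS)"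
      by (intro sum_mono2) auto
    also have "\<dots> \<le> ennreal visits"
      using occupation_bound_finite[OF assms, of y n] by (subst (asm) nn_integral_sum) auto
    finally show ?thesis .
  qed
qed auto

end


section \<open>First passage, restarting and Wald's identity\<close>

lemma (in sequence_space) integral_comb_seq:
  fixes g :: "_ \<Rightarrow> real"
  assumes g: "integrable S g"
  shows "(\<integral>x. g x \<partial>S) = (\<integral>x. \<integral>y. g (comb_seq n x y) \<partial>S \<partial>S)"
proof -
  have m[measurable]: "(\<lambda>(x, y). comb_seq n x y) \<in> measurable (S \<Otimes>\<^sub>M S) S" by (rule measurable_comb_seq)
  interpret PP: pair_sigma_finite S S by unfold_locales
  have [measurable]: "g \<in> borel_measurable S" using g by auto
  have "integrable (distr (S \<Otimes>\<^sub>M S) S (\<lambda>(x, y). comb_seq n x y)) g"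
    using g by (simp add: PiM_comb_seq)
  then have i: "integrable (S \<Otimes>\<^sub>M S) (\<lambda>z. g (case z of (x, y) \<Rightarrow> comb_seq n x y))"
    by (subst (asm) integrable_distr_eq) auto
  have "(\<integral>x. g x \<partial>S) = (\<integral>x. g x \<partial>distr (S \<Otimes>\<^sub>M S) S (\<lambda>(x, y). comb_seq n x y))"
    by (simp add: PiM_comb_seq)
  also have "\<dots> = (\<integral>z. g (case z of (x, y) \<Rightarrow> comb_seq n x y) \<partial>(S \<Otimes>\<^sub>M S))"
    by (intro integral_distr) auto
  also have "\<dots> = (\<integral>x. \<integral>y. g (comb_seq n x y) \<partial>S \<partial>S)"
    using PP.integral_fst'[OF i] by simp
  finally show ?thesis .
qed

text \<open>Summing first moments of excesses over unit layers costs a second moment.\<close>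

lemma suminf_pos_part_le:
  fixes s :: real
  shows "(\<Sum>k. ennreal (max 0 (s - real k))) \<le> ennreal (max 0 s * (max 0 s + 1))"
proof -
  let ?m = "nat \<lceil>s\<rceil>"
  have "(\<Sum>k. ennreal (max 0 (s - real k))) = (\<Sum>k<?m. ennreal (max 0 (s - real k)))"
  proof (rule suminf_finite)
    fix k assume "k \<notin> {..<?m}"
    then have "s \<le> real k" by (simp add: not_less)
    then show "ennreal (max 0 (s - real k)) = 0" by simp
  qed simp
  also have "\<dots> \<le> (\<Sum>k<?m. ennreal (max 0 s))"
    by (intro sum_mono ennreal_leI) auto
  also have "\<dots> = ennreal (real ?m * max 0 s)" by (simp add: ennreal_of_nat_eq_real_of_nat ennreal_mult)
  also have "\<dots> \<le> ennreal (max 0 s * (max 0 s + 1))"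
  proof (rule ennreal_leI)
    have "real ?m \<le> max 0 s + 1" by linarith
    then have "real ?m * max 0 s \<le> (max 0 s + 1) * max 0 s" by (intro mult_right_mono) auto
    then show "real ?m * max 0 s \<le> max 0 s * (max 0 s + 1)" by (simp add: mult.commute)
  qed
  finally show ?thesis .
qed

text \<open>The events \<open>first_hit c r A x n\<close> are disjoint and depend on the first
  \<open>n\<close> coordinates, which is what a decomposition over the time of passage needs.
  \<open>hit_time\<close> is the corresponding random time; it is meaningful when the level is
  reached at all.\<close>

definition first_hit :: "real \<Rightarrow> real \<Rightarrow> real \<Rightarrow> (nat \<Rightarrow> real) \<Rightarrow> nat \<Rightarrow> bool" where
  "first_hit c r A x n \<longleftrightarrow> (\<forall>j<n. sr_path c r x j < A) \<and> A \<le> sr_path c r x n"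

definition hit_time :: "real \<Rightarrow> real \<Rightarrow> real \<Rightarrow> (nat \<Rightarrow> real) \<Rightarrow> nat" where
  "hit_time c r A x = (LEAST n. A \<le> sr_path c r x n)"

lemma first_hit_iff:
  assumes "\<exists>n. A \<le> sr_path c r x n"
  shows "first_hit c r A x n \<longleftrightarrow> n = hit_time c r A x"
proof -
  have 1: "A \<le> sr_path c r x (hit_time c r A x)" unfolding hit_time_def using assms by (rule LeastI_ex)
  have 2: "sr_path c r x j < A" if "j < hit_time c r A x" for j
    using not_less_Least[of j "\<lambda>n. A \<le> sr_path c r x n"] that unfolding hit_time_def by simp
  show ?thesis unfolding first_hit_def using 1 2
    by (metis linorder_neqE_nat not_less)
qed

lemma alive_iff_hit_time:
  assumes "\<exists>n. A \<le> sr_path c r x n"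
  shows "alive c r A x n \<longleftrightarrow> n < hit_time c r A x"
proof -
  have "first_hit c r A x (hit_time c r A x)" using first_hit_iff[OF assms] by simp
  then show ?thesis unfolding alive_def first_hit_def
    by (meson le_less_trans not_le not_less)
qed

lemma stopped_as_sum:
  fixes h :: "nat \<Rightarrow> ennreal"
  assumes "\<exists>n. A \<le> sr_path c r x n"
  shows "h (hit_time c r A x) = (\<Sum>n. (if first_hit c r A x n then h n else 0))"
proof -
  have "(\<Sum>n. (if first_hit c r A x n then h n else 0)) = (\<Sum>n\<in>{hit_time c r A x}. (if first_hit c r A x n then h n else 0))"
    by (rule suminf_finite) (auto simp: first_hit_iff[OF assms])
  then show ?thesis by (simp add: first_hit_iff[OF assms])
qed

context likelihood_walk
begin

lemma space_FS[simp]: "space FS = UNIV" by (simp add: space_PiM)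
lemma space_GS[simp]: "space GS = UNIV" by (simp add: space_PiM)
lemma prob_GS_UNIV[simp]: "measure GS UNIV = 1" using GS.P.prob_space by simp
lemma emeasure_GS_UNIV[simp]: "emeasure GS UNIV = 1" using GS.P.emeasure_space_1 by simp
lemma prob_FS_UNIV[simp]: "measure FS UNIV = 1" using FS.P.prob_space by simp
lemma emeasure_FS_UNIV[simp]: "emeasure FS UNIV = 1" using FS.P.emeasure_space_1 by simp

lemma comp_G[measurable]: "(\<lambda>x. x n) \<in> borel_measurable GS"
  using measurable_component_singleton[of n UNIV "\<lambda>_. G"] measurable_cong_sets[OF refl sets_G] by auto
lemma comp_F[measurable]: "(\<lambda>x. x n) \<in> borel_measurable FS"
  using measurable_component_singleton[of n UNIV "\<lambda>_. F"] measurable_cong_sets[OF refl sets_F] by auto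

lemma first_hit_G[measurable]: "Measurable.pred GS (\<lambda>x. first_hit c r A x n)"
  unfolding first_hit_def by measurable

lemma hit_time_G[measurable]: "(\<lambda>x. hit_time c r A x) \<in> measurable GS (count_space UNIV)"
  unfolding hit_time_def by measurable

lemma stopped_G[measurable]: "(\<lambda>x. sr_path c r x (hit_time c' r' A x)) \<in> borel_measurable GS"
  by (rule measurable_compose_countable[where f="\<lambda>n x. sr_path c r x n"]) auto

lemma stopped_lr_prod_G[measurable]: "(\<lambda>x. lr_prod x (hit_time c' r' A x)) \<in> borel_measurable GS"
  by (rule measurable_compose_countable[where f="\<lambda>n x. lr_prod x n"]) auto

lemma alive_sets_G[measurable]: "{x. alive c r A x n} \<in> sets GS"
proof -
  have "{x \<in> space GS. alive c r A x n} \<in> sets GS" by measurable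
  then show ?thesis by simp
qed

lemma alive_sets_F[measurable]: "{x. alive c r A x n} \<in> sets FS"
proof -
  have "{x \<in> space FS. alive c r A x n} \<in> sets FS" by measurable
  then show ?thesis by simp
qed

text \<open>Survival at time \<open>n\<close> forces \<open>(c + r) * lr_prod x n\<close> below \<open>A +
  c\<close>; Markov's inequality for \<open>1 / sqrt (lr_prod x n)\<close> makes this
  exponentially unlikely.\<close>

lemma prob_alive_le:
  assumes "0 \<le> c" "0 \<le> r" "0 < c + r" "0 < A"
  shows "measure GS {x. alive c r A x n} \<le> sqrt ((A + c) / (c + r)) * \<rho> ^ n"
proof -
  have "emeasure GS {x. alive c r A x n} = (\<integral>\<^sup>+x. indicator {x. alive c r A x n} x \<partial>GS)" by simp
  also have "\<dots> \<le> (\<integral>\<^sup>+x. ennreal (sqrt ((A + c) / (c + r))) * ennreal (1 / sqrt (lr_prod x n)) \<partial>GS)"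
    using GS_pos
  proof (intro nn_integral_mono_AE, eventually_elim)
    case (elim x)
    have p: "lr_prod x n > 0" using elim lr_prod_pos by blast
    show ?case
    proof (cases "alive c r A x n")
      case True
      have "(c + r) * lr_prod x n \<le> c + sr_path c r x n" using elim assms by (intro sr_path_ge_lr_prod) (auto intro: less_imp_le)
      also have "\<dots> < A + c" using True by (auto simp: alive_def)
      finally have "lr_prod x n \<le> (A + c) / (c + r)" using assms by (simp add: field_simps)
      then have "sqrt (lr_prod x n) \<le> sqrt ((A + c) / (c + r))" by simp
      then have "1 \<le> sqrt ((A + c) / (c + r)) * (1 / sqrt (lr_prod x n))" using p by (simp add: field_simps del: real_sqrt_le_iff)
      then have "1 \<le> ennreal (sqrt ((A + c) / (c + r)) * (1 / sqrt (lr_prod x n)))" by (simp only: ennreal_ge_1)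
      also have "\<dots> = ennreal (sqrt ((A + c) / (c + r))) * ennreal (1 / sqrt (lr_prod x n))"
        using assms by (intro ennreal_mult') auto
      finally show ?thesis using True by simp
    qed auto
  qed
  also have "\<dots> = ennreal (sqrt ((A + c) / (c + r)) * \<rho> ^ n)"
    using \<rho>_nonneg assms by (simp add: nn_integral_cmult nn_integral_GS_lr_prod ennreal_mult)
  finally show ?thesis using \<rho>_nonneg assms by (simp add: GS.P.emeasure_eq_measure)
qed

lemma summable_\<rho>: "summable (\<lambda>n. C * \<rho> ^ n)"
  using \<rho>_nonneg \<rho>_less_1 by (intro summable_mult summable_geometric) auto

lemma summable_prob_alive:
  assumes "0 \<le> c" "0 \<le> r" "0 < c + r" "0 < A"
  shows "summable (\<lambda>n. measure GS {x. alive c r A x n})"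
  by (rule summable_comparison_test'[OF summable_\<rho>]) (use prob_alive_le[OF assms] in auto)

lemma AE_hits:
  assumes "0 \<le> c" "0 \<le> r" "0 < c + r" "0 < A"
  shows "AE x in GS. \<exists>n. A \<le> sr_path c r x n"
proof -
  have "AE x in GS. \<forall>\<^sub>F n in sequentially. x \<in> space GS - {x. alive c r A x n}"
    using summable_prob_alive[OF assms]
    by (intro borel_cantelli_AE1) (auto simp: GS.P.emeasure_eq_measure)
  then show ?thesis
  proof eventually_elim
    case (elim x)
    then obtain n where "\<not> alive c r A x n" by (auto simp: eventually_sequentially)
    then show ?case unfolding alive_def by (auto simp: not_less)
  qed
qed

definition mean_time_nn :: "real \<Rightarrow> real \<Rightarrow> real \<Rightarrow> ennreal" where
  "mean_time_nn c r A = (\<integral>\<^sup>+x. (\<Sum>n. indicator {x. alive c r A x n} x) \<partial>GS)"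

definition mean_time :: "real \<Rightarrow> real \<Rightarrow> real \<Rightarrow> real" where
  "mean_time c r A = (\<Sum>n. measure GS {x. alive c r A x n})"

lemma mean_time_nn_eq:
  assumes "0 \<le> c" "0 \<le> r" "0 < c + r" "0 < A"
  shows "mean_time_nn c r A = ennreal (mean_time c r A)"
proof -
  have "mean_time_nn c r A = (\<Sum>n. ennreal (measure GS {x. alive c r A x n}))"
    unfolding mean_time_nn_def by (subst nn_integral_suminf) (auto simp: GS.P.emeasure_eq_measure)
  then show ?thesis unfolding mean_time_def using summable_prob_alive[OF assms] by (simp add: suminf_ennreal2)
qed

lemma mean_time_nonneg: 
  assumes "0 \<le> c" "0 \<le> r" "0 < c + r" "0 < A"
  shows "0 \<le> mean_time c r A"
  unfolding mean_time_def using summable_prob_alive[OF assms] by (intro suminf_nonneg) auto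

lemma mean_time_0: "A \<le> r \<Longrightarrow> mean_time c r A = 0"
proof -
  assume "A \<le> r"
  then have "\<not> alive c r A x n" for x n unfolding alive_def by (intro notI) (drule spec[of _ 0], simp)
  then show ?thesis by (simp add: mean_time_def)
qed

lemma measurable_mean_time_nn[measurable]: "(\<lambda>r. mean_time_nn c r A) \<in> borel_measurable borel"
proof -
  have [measurable]: "Measurable.pred (borel \<Otimes>\<^sub>M GS) (\<lambda>z. alive c (fst z) A (snd z) n)" for n by measurable
  have "(\<lambda>z. (\<Sum>n. indicator {x. alive c (fst z) A x n} (snd z)) :: ennreal) = (\<lambda>z. (\<Sum>n. (if alive c (fst z) A (snd z) n then 1 else 0)))"
    by (auto simp: fun_eq_iff indicator_def intro!: suminf_cong)
  then have [measurable]: "(\<lambda>z. (\<Sum>n. indicator {x. alive c (fst z) A x n} (snd z)) :: ennreal) \<in> borel_measurable (borel \<Otimes>\<^sub>M GS)"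
    by simp
  show ?thesis unfolding mean_time_nn_def
    using GS.P.borel_measurable_nn_integral[of "\<lambda>r x. (\<Sum>n. indicator {x. alive c r A x n} x)" borel]
    by (auto simp: split_beta')
qed

lemma sum_alive_eq_hit_time:
  assumes "\<exists>n. A \<le> sr_path c r x n"
  shows "(\<Sum>n. indicator {x. alive c r A x n} x) = ennreal (real (hit_time c r A x))"
proof -
  have "(\<Sum>n. indicator {x. alive c r A x n} x :: ennreal) = (\<Sum>n<hit_time c r A x. indicator {x. alive c r A x n} x)"
    by (rule suminf_finite) (auto simp: alive_iff_hit_time[OF assms])
  also have "\<dots> = (\<Sum>n<hit_time c r A x. 1)" by (rule sum.cong) (auto simp: alive_iff_hit_time[OF assms])
  finally show ?thesis by (simp add: ennreal_of_nat_eq_real_of_nat)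
qed

lemma mean_time_nn_eq_hit_time:
  assumes "0 \<le> c" "0 \<le> r" "0 < c + r" "0 < A"
  shows "mean_time_nn c r A = (\<integral>\<^sup>+x. ennreal (real (hit_time c r A x)) \<partial>GS)"
  unfolding mean_time_nn_def
  by (intro nn_integral_cong_AE eventually_mono[OF AE_hits[OF assms]]) (rule sum_alive_eq_hit_time)

lemma integrable_hit_time:
  assumes "0 \<le> c" "0 \<le> r" "0 < c + r" "0 < A"
  shows "integrable GS (\<lambda>x. real (hit_time c r A x))" "(\<integral>x. real (hit_time c r A x) \<partial>GS) = mean_time c r A"
proof -
  have e: "(\<integral>\<^sup>+x. ennreal (real (hit_time c r A x)) \<partial>GS) = ennreal (mean_time c r A)"
    using mean_time_nn_eq_hit_time[OF assms] mean_time_nn_eq[OF assms] by simp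
  show "integrable GS (\<lambda>x. real (hit_time c r A x))" using e by (intro integrableI_nonneg) auto
  show "(\<integral>x. real (hit_time c r A x) \<partial>GS) = mean_time c r A"
    using e mean_time_nonneg[OF assms] by (subst integral_eq_nn_integral) auto
qed

text \<open>The strong Markov property at the passage of the lower level \<open>A'\<close>. Up to that time
  the path is below \<open>A\<close> as well, and afterwards it starts afresh from its current
  value.\<close>

lemma mean_time_nn_restart:
  assumes c: "0 \<le> c" "0 \<le> r" "0 < c + r" "0 < A'" "A' \<le> A"
  shows "mean_time_nn c r A = mean_time_nn c r A' + (\<integral>\<^sup>+x. mean_time_nn c (sr_path c r x (hit_time c r A' x)) A \<partial>GS)"
proof -
  let ?I = "\<lambda>x. (\<Sum>k. indicator {x. alive c r A x k} x) :: ennreal"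
  have I[measurable]: "?I \<in> borel_measurable GS" by measurable
  have "mean_time_nn c r A = (\<integral>\<^sup>+x. (\<Sum>n. if first_hit c r A' x n then ?I x else 0) \<partial>GS)"
    unfolding mean_time_nn_def using AE_hits[OF c(1-4)]
  proof (intro nn_integral_cong_AE, eventually_elim)
    case (elim x)
    show ?case using stopped_as_sum[OF elim(2), of "\<lambda>_. ?I x"] .
  qed
  also have "\<dots> = (\<Sum>n. \<integral>\<^sup>+x. (if first_hit c r A' x n then ?I x else 0) \<partial>GS)"
    by (intro nn_integral_suminf) measurable
  also have "\<dots> = (\<Sum>n. \<integral>\<^sup>+x. (if first_hit c r A' x n then of_nat n + mean_time_nn c (sr_path c r x n) A else 0) \<partial>GS)"
  proof (intro arg_cong[where f=suminf] ext)
    fix n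
    have fh: "first_hit c r A' (comb_seq n x y) n \<longleftrightarrow> first_hit c r A' x n" for x y
      unfolding first_hit_def by (auto simp: sr_path_comb_seq_le)
    have "?I (comb_seq n x y) = of_nat n + (\<Sum>k. indicator {y. alive c (sr_path c r x n) A y k} y)" if "first_hit c r A' x n" for x y
    proof -
      have "?I (comb_seq n x y) = (\<Sum>k. indicator {x. alive c r A x (k + n)} (comb_seq n x y)) + (\<Sum>k<n. indicator {x. alive c r A x k} (comb_seq n x y))"
        by (rule suminf_offset) auto
      also have "(\<Sum>k<n. indicator {x. alive c r A x k} (comb_seq n x y) :: ennreal) = (\<Sum>k<n. 1)"
      proof (rule sum.cong)
        fix k assume "k \<in> {..<n}"
        then have "sr_path c r x j < A" if "j \<le> k" for j
          using that \<open>first_hit c r A' x n\<close> c(5) unfolding first_hit_def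
          by (meson le_less_trans lessThan_iff less_le_trans)
        then show "indicator {x. alive c r A x k} (comb_seq n x y) = (1::ennreal)"
          using \<open>k \<in> {..<n}\<close> by (auto simp: indicator_def alive_def sr_path_comb_seq_le)
      qed simp
      also have "(\<Sum>k. indicator {x. alive c r A x (k + n)} (comb_seq n x y)) = (\<Sum>k. indicator {y. alive c (sr_path c r x n) A y k} y :: ennreal)"
      proof (intro suminf_cong)
        fix k
        have "alive c r A (comb_seq n x y) (n + k) \<longleftrightarrow> alive c (sr_path c r x n) A y k"
        proof -
          have "alive c r A x n" if "alive c (sr_path c r x n) A y k"
          proof -
            have "sr_path c r x n < A" using that unfolding alive_def by (metis le0 sr_path.simps(1))
            then show ?thesis using \<open>first_hit c r A' x n\<close> c(5) unfolding first_hit_def alive_def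
              by (metis le_neq_implies_less less_le_trans)
          qed
          then show ?thesis by (auto simp: alive_comb_seq_add)
        qed
        then show "indicator {x. alive c r A x (k + n)} (comb_seq n x y) = (indicator {y. alive c (sr_path c r x n) A y k} y :: ennreal)"
          by (simp add: indicator_def add.commute)
      qed
      finally show ?thesis by (simp add: add.commute)
    qed
    then have inner: "(\<integral>\<^sup>+y. (if first_hit c r A' (comb_seq n x y) n then ?I (comb_seq n x y) else 0) \<partial>GS)
      = (if first_hit c r A' x n then of_nat n + mean_time_nn c (sr_path c r x n) A else 0)" for x
      by (auto simp: fh mean_time_nn_def nn_integral_add)
    show "(\<integral>\<^sup>+x. (if first_hit c r A' x n then ?I x else 0) \<partial>GS) = (\<integral>\<^sup>+x. (if first_hit c r A' x n then of_nat n + mean_time_nn c (sr_path c r x n) A else 0) \<partial>GS)"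
      by (subst GS.nn_integral_comb_seq[of _ n]) (measurable, simp only: inner)
  qed
  also have "\<dots> = (\<integral>\<^sup>+x. (\<Sum>n. if first_hit c r A' x n then of_nat n + mean_time_nn c (sr_path c r x n) A else 0) \<partial>GS)"
    by (intro nn_integral_suminf[symmetric]) measurable
  also have "\<dots> = (\<integral>\<^sup>+x. ennreal (real (hit_time c r A' x)) + mean_time_nn c (sr_path c r x (hit_time c r A' x)) A \<partial>GS)"
    using AE_hits[OF c(1-4)]
  proof (intro nn_integral_cong_AE, eventually_elim)
    case (elim x)
    show ?case using stopped_as_sum[OF elim(2), of "\<lambda>n. of_nat n + mean_time_nn c (sr_path c r x n) A"]
      by (simp add: ennreal_of_nat_eq_real_of_nat)
  qed
  also have "\<dots> = (\<integral>\<^sup>+x. ennreal (real (hit_time c r A' x)) \<partial>GS) + (\<integral>\<^sup>+x. mean_time_nn c (sr_path c r x (hit_time c r A' x)) A \<partial>GS)"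
    by (intro nn_integral_add) measurable
  finally show ?thesis using mean_time_nn_eq_hit_time[OF c(1-4)] by simp
qed

lemma integral_indep_component:
  fixes h :: "real \<Rightarrow> real"
  assumes Q[measurable]: "Measurable.pred GS Q" and det: "\<And>x y. Q (comb_seq n x y) \<longleftrightarrow> Q x" and h: "integrable G h"
  shows "integrable GS (\<lambda>x. indicator {x. Q x} x * h (x n))"
    "(\<integral>x. indicator {x. Q x} x * h (x n) \<partial>GS) = measure GS {x. Q x} * (\<integral>a. h a \<partial>G)"
proof -
  have [measurable]: "h \<in> borel_measurable borel"
    using borel_measurable_integrable[OF h] unfolding measurable_cong_sets[OF sets_G refl] .
  have [measurable]: "{x. Q x} \<in> sets GS" using Q unfolding pred_def by simp
  have "integrable (distr GS G (\<lambda>x. x n)) h" using h GS.PiM_component[of n] by simp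
  then have i: "integrable GS (\<lambda>x. h (x n))" by (rule integrable_distr[rotated]) simp
  show int: "integrable GS (\<lambda>x. indicator {x. Q x} x * h (x n))"
    by (rule Bochner_Integration.integrable_bound[OF i]) (auto simp: indicator_def)
  have "(\<integral>x. indicator {x. Q x} x * h (x n) \<partial>GS) = (\<integral>x. \<integral>y. indicator {x. Q x} x * h (y 0) \<partial>GS \<partial>GS)"
    by (subst GS.integral_comb_seq[OF int, of n]) (simp add: det indicator_def comb_seq_def)
  also have "\<dots> = measure GS {x. Q x} * (\<integral>a. h a \<partial>G)"
    using GS.integral_component[OF borel_measurable_integrable[OF h], of 0] by simp
  finally show "(\<integral>x. indicator {x. Q x} x * h (x n) \<partial>GS) = measure GS {x. Q x} * (\<integral>a. h a \<partial>G)" .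
qed

text \<open>The stopped logarithm is the sum of \<open>ln (x n)\<close> over the times \<open>n\<close> of
  survival. Survival at time \<open>n\<close> is determined by the coordinates before
  \<open>n\<close>, hence independent of \<open>x n\<close>, and its probabilities are summable.\<close>

lemma wald:
  assumes c: "0 \<le> c" "0 \<le> r" "0 < c + r" "0 < A"
  shows "integrable GS (\<lambda>x. ln (lr_prod x (hit_time c r A x)))"
    "(\<integral>x. ln (lr_prod x (hit_time c r A x)) \<partial>GS) = drift * mean_time c r A"
proof -
  let ?f = "\<lambda>n x. indicator {x. alive c r A x n} x * ln (x n)"
  let ?g = "\<lambda>n x. indicator {x. alive c r A x n} x * \<bar>ln (x n)\<bar>"
  have det: "alive c r A (comb_seq n x y) n \<longleftrightarrow> alive c r A x n" for n x y by (simp add: alive_comb_seq_le)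
  note f = integral_indep_component[OF _ det integrable_ln, simplified]
  note g = integral_indep_component[OF _ det integrable_abs[OF integrable_ln], simplified]
  have fin: "?f n x = 0" if "\<exists>n. A \<le> sr_path c r x n" "n \<notin> {..<hit_time c r A x}" for n x
    using that alive_iff_hit_time[of A c r x n] by simp
  have sm: "AE x in GS. summable (\<lambda>n. norm (?f n x))"
    using AE_hits[OF c]
  proof eventually_elim
    case (elim x)
    show ?case by (rule summable_finite[of "{..<hit_time c r A x}"]) (use fin[OF elim] in auto)
  qed
  have sm2: "summable (\<lambda>n. \<integral>x. norm (?f n x) \<partial>GS)"
    using summable_mult2[OF summable_prob_alive[OF c], of "\<integral>a. \<bar>ln a\<bar> \<partial>G"] g(2) by (simp add: abs_mult)
  have e: "AE x in GS. (\<Sum>n. ?f n x) = ln (lr_prod x (hit_time c r A x))"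
    using AE_hits[OF c] GS_pos
  proof eventually_elim
    case (elim x)
    have "(\<Sum>n. ?f n x) = (\<Sum>n<hit_time c r A x. ?f n x)"
      by (rule suminf_finite) (use fin[OF elim(1)] in auto)
    also have "\<dots> = (\<Sum>n<hit_time c r A x. ln (x n))"
      by (rule sum.cong) (auto simp: alive_iff_hit_time[OF elim(1)])
    also have "\<dots> = ln (lr_prod x (hit_time c r A x))"
      unfolding lr_prod_def using elim(2) by (subst ln_prod) (simp, metis less_irrefl, simp)
    finally show ?case .
  qed
  have i: "integrable GS (\<lambda>x. \<Sum>n. ?f n x)" and v: "(\<integral>x. (\<Sum>n. ?f n x) \<partial>GS) = (\<Sum>n. \<integral>x. ?f n x \<partial>GS)"
    using f(1) sm sm2 by (auto intro!: integrable_suminf integral_suminf)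
  show "integrable GS (\<lambda>x. ln (lr_prod x (hit_time c r A x)))"
    using i e by (subst (asm) integrable_cong_AE[OF _ _ e]) auto
  have "(\<integral>x. ln (lr_prod x (hit_time c r A x)) \<partial>GS) = (\<integral>x. (\<Sum>n. ?f n x) \<partial>GS)"
    using e by (intro integral_cong_AE) (auto elim: eventually_mono)
  also have "\<dots> = (\<Sum>n. measure GS {x. alive c r A x n} * drift)" unfolding v f(2) drift_def by simp
  also have "\<dots> = drift * mean_time c r A"
    unfolding mean_time_def using suminf_mult2[OF summable_prob_alive[OF c]] by (simp add: mult.commute)
  finally show "(\<integral>x. ln (lr_prod x (hit_time c r A x)) \<partial>GS) = drift * mean_time c r A" .
qed

end


section \<open>Tails of the overshoot\<close>

lemma le_suminf_ennreal: "f k \<le> (\<Sum>k. f k)" for f :: "nat \<Rightarrow> ennreal"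
  using sum_le_suminf[OF summableI, of "{k}" f] by simp

lemma suminf_swap_ennreal: "(\<Sum>i. \<Sum>j. f i j) = (\<Sum>j. \<Sum>i. f i j)" for f :: "nat \<Rightarrow> nat \<Rightarrow> ennreal"
  using nn_integral_suminf[of f "count_space UNIV"] by (simp add: nn_integral_count_space_nat)

context likelihood_walk
begin

lemma borel_measurable_G: "h \<in> borel_measurable borel \<Longrightarrow> h \<in> borel_measurable G"
  using measurable_cong_sets[OF sets_G refl] by blast

text \<open>A bound for the mean part of the overshoot beyond \<open>b\<close>: the expected number of visits
  to a layer, times the excess of one step summed over all layers.\<close>

definition overshoot_tail :: "real \<Rightarrow> real" where
  "overshoot_tail b = visits * (\<integral>x. max 0 (ln x + 1 - b) * (max 0 (ln x + 1 - b) + 1) \<partial>G)"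

lemma integrable_overshoot_tail:
  "integrable G (\<lambda>x. max 0 (ln x + 1 - b) * (max 0 (ln x + 1 - b) + 1))"
proof (rule Bochner_Integration.integrable_bound)
  show "integrable G (\<lambda>x. 2 * (ln x)\<^sup>2 + (2 * (1 + \<bar>b\<bar>)\<^sup>2 + 1) + \<bar>ln x\<bar> + 1 + \<bar>b\<bar>)"
    using sq_int integrable_ln by auto
  show "AE x in G. norm (max 0 (ln x + 1 - b) * (max 0 (ln x + 1 - b) + 1)) \<le> norm (2 * (ln x)\<^sup>2 + (2 * (1 + \<bar>b\<bar>)\<^sup>2 + 1) + \<bar>ln x\<bar> + 1 + \<bar>b\<bar>)"
  proof (rule AE_I2)
    fix x :: real
    let ?m = "max 0 (ln x + 1 - b)" and ?t = "\<bar>ln x\<bar> + (1 + \<bar>b\<bar>)"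
    have "0 \<le> ?m" "?m \<le> ?t" by linarith+
    then have "?m * (?m + 1) \<le> ?t * (?t + 1)" by (intro mult_mono) auto
    also have "\<dots> = ?t\<^sup>2 + ?t" by (simp add: power2_eq_square algebra_simps)
    also have "?t\<^sup>2 \<le> 2 * (ln x)\<^sup>2 + 2 * (1 + \<bar>b\<bar>)\<^sup>2"
    proof -
      have "0 \<le> (\<bar>ln x\<bar> - (1 + \<bar>b\<bar>))\<^sup>2" by simp
      also have "\<dots> = 2 * (ln x)\<^sup>2 + 2 * (1 + \<bar>b\<bar>)\<^sup>2 - ?t\<^sup>2" by (simp add: power2_eq_square algebra_simps)
      finally show ?thesis by simp
    qed
    finally have "?m * (?m + 1) \<le> 2 * (ln x)\<^sup>2 + (2 * (1 + \<bar>b\<bar>)\<^sup>2 + 1) + \<bar>ln x\<bar> + 1 + \<bar>b\<bar>" by linarith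
    moreover have "0 \<le> ?m * (?m + 1)" by (intro mult_nonneg_nonneg) auto
    ultimately show "norm (?m * (?m + 1)) \<le> norm (2 * (ln x)\<^sup>2 + (2 * (1 + \<bar>b\<bar>)\<^sup>2 + 1) + \<bar>ln x\<bar> + 1 + \<bar>b\<bar>)"
      unfolding real_norm_def by (metis abs_of_nonneg order_trans)
  qed
qed (rule borel_measurable_G, measurable)

lemma overshoot_tail_nonneg: "0 \<le> overshoot_tail b"
  unfolding overshoot_tail_def using visits_pos
  by (intro mult_nonneg_nonneg Bochner_Integration.integral_nonneg) auto

lemma overshoot_tail_tendsto_0: "(overshoot_tail \<longlongrightarrow> 0) at_top"
proof -
  have "((\<lambda>b. \<integral>x. max 0 (ln x + 1 - b) * (max 0 (ln x + 1 - b) + 1) \<partial>G) \<longlongrightarrow> (\<integral>x. 0 \<partial>G)) at_top"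
  proof (rule integral_dominated_convergence_at_top[where w="\<lambda>x. max 0 (ln x + 1 - 0) * (max 0 (ln x + 1 - 0) + 1)"])
    show "\<forall>\<^sub>F b in at_top. AE x in G. norm (max 0 (ln x + 1 - b) * (max 0 (ln x + 1 - b) + 1)) \<le> max 0 (ln x + 1 - 0) * (max 0 (ln x + 1 - 0) + 1)"
      using eventually_ge_at_top[of 0]
    proof eventually_elim
      case (elim b)
      show ?case
      proof (rule AE_I2)
        fix x :: real
        let ?m = "max 0 (ln x + 1 - b)" and ?t = "max 0 (ln x + 1 - 0)"
        have "0 \<le> ?m" "?m \<le> ?t" using elim by linarith+
        then have "?m * (?m + 1) \<le> ?t * (?t + 1)" by (intro mult_mono) auto
        moreover have "0 \<le> ?m * (?m + 1)" by (intro mult_nonneg_nonneg) auto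
        ultimately show "norm (?m * (?m + 1)) \<le> ?t * (?t + 1)" unfolding real_norm_def by (metis abs_of_nonneg)
      qed
    qed
    show "AE x in G. ((\<lambda>b. max 0 (ln x + 1 - b) * (max 0 (ln x + 1 - b) + 1)) \<longlongrightarrow> 0) at_top"
    proof (rule AE_I2, rule tendsto_eventually)
      fix x :: real
      show "\<forall>\<^sub>F b in at_top. max 0 (ln x + 1 - b) * (max 0 (ln x + 1 - b) + 1) = 0"
        using eventually_ge_at_top[of "ln x + 1"] by eventually_elim simp
    qed
  qed (use integrable_overshoot_tail[of 0] in \<open>auto intro!: borel_measurable_G\<close>)
  from tendsto_mult_left[OF this, of visits] show ?thesis unfolding overshoot_tail_def by simp
qed

text \<open>Divide the region below the level into layers of logarithmic length \<open>1\<close>. To overshoot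
  by more than \<open>b\<close> from the layer \<open>k\<close>, a step must exceed about \<open>b
  + k\<close>. Each layer is visited a bounded number of times in the mean, uniformly in
  \<open>c\<close>, \<open>r\<close> and \<open>A\<close>, so the sum over the layers is a tail of
  the second moment of one step.\<close>

lemma nn_overshoot_bound:
  assumes c: "0 \<le> c" "c \<le> A" "0 \<le> r" "r < A" "0 < c + r"
  shows "(\<integral>\<^sup>+x. ennreal (max 0 (ln (sr_path c r x (hit_time c r A x) / A) - b)) \<partial>GS) \<le> ennreal (overshoot_tail b)"
proof -
  have A: "0 < A" using c by linarith
  define J where "J k = {A * exp (- real k)..<exp 1 * (A * exp (- real k))}" for k :: nat
  define \<phi> where "\<phi> k z = ennreal (max 0 (ln z + 1 - b - real k))" for k :: nat and z :: real
  have [measurable]: "\<phi> k \<in> borel_measurable borel" for k unfolding \<phi>_def by measurable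
  have [measurable]: "J k \<in> sets borel" for k unfolding J_def by measurable
  have "(\<integral>\<^sup>+x. ennreal (max 0 (ln (sr_path c r x (hit_time c r A x) / A) - b)) \<partial>GS)
     \<le> (\<integral>\<^sup>+x. (\<Sum>n. \<Sum>k. indicator (J k) (c + sr_path c r x n) * \<phi> k (x n)) \<partial>GS)"
    using GS_pos AE_hits[OF c(1,3,5) A]
  proof (intro nn_integral_mono_AE, eventually_elim)
    case (elim x)
    let ?N = "hit_time c r A x"
    have fh: "first_hit c r A x ?N" using first_hit_iff[OF elim(4)] by simp
    have "?N \<noteq> 0" using fh c unfolding first_hit_def by (metis sr_path.simps(1) not_le)
    then obtain n where n: "?N = Suc n" by (cases ?N) auto
    define q where "q = c + sr_path c r x n"
    have q: "0 < q" unfolding q_def using elim c by (intro sr_path_pos) auto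
    have "sr_path c r x n < A" using fh n by (auto simp: first_hit_def)
    then have q2: "q < 2 * A" unfolding q_def using c by linarith
    define t where "t = - ln (q / A)"
    \<comment> \<open>\<open>c \<le> A\<close> gives \<open>q < 2 * A\<close>, and \<open>2 < exp 1\<close>: no layer above the one with index \<open>0\<close> occurs\<close>
    have "ln (q / A) < ln (exp 1)"
    proof -
      have "q / A < 2" using q2 A by (simp add: field_simps)
      moreover have "(2::real) \<le> exp 1" using exp_ge_add_one_self[of "1::real"] by simp
      ultimately show ?thesis using q A by (subst ln_less_cancel_iff) auto
    qed
    then have t: "t > -1" by (simp add: t_def)
    define k where "k = nat \<lceil>t\<rceil>"
    have k: "t \<le> real k" "real k < t + 1" unfolding k_def using t by linarith+
    have qt: "q = A * exp (- t)" using q A by (simp add: t_def)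
    have "q \<in> J k"
    proof -
      have "A * exp (- real k) \<le> q" unfolding qt using k A by simp
      moreover have "q < A * exp (1 - real k)" unfolding qt using k A by simp
      ultimately show ?thesis unfolding J_def by (simp add: exp_diff exp_minus field_simps)
    qed
    have "x n > 0" using elim(3) by blast
    have "sr_path c r x ?N = q * x n" unfolding n by (simp add: q_def)
    then have "ln (sr_path c r x ?N / A) = - t + ln (x n)" using q A \<open>x n > 0\<close>
      by (simp add: t_def ln_mult ln_div)
    then have "ennreal (max 0 (ln (sr_path c r x ?N / A) - b)) \<le> \<phi> k (x n)"
      unfolding \<phi>_def using k by (intro ennreal_leI) linarith
    also have "\<dots> = indicator (J k) (c + sr_path c r x n) * \<phi> k (x n)" using \<open>q \<in> J k\<close> by (simp add: q_def)
    also have "\<dots> \<le> (\<Sum>k. indicator (J k) (c + sr_path c r x n) * \<phi> k (x n))"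
      by (rule le_suminf_ennreal)
    also have "\<dots> \<le> (\<Sum>n. \<Sum>k. indicator (J k) (c + sr_path c r x n) * \<phi> k (x n))"
      by (rule le_suminf_ennreal)
    finally show ?case .
  qed
  also have "\<dots> = (\<Sum>n. \<Sum>k. \<integral>\<^sup>+x. indicator (J k) (c + sr_path c r x n) * \<phi> k (x n) \<partial>GS)"
    by (simp add: nn_integral_suminf)
  also have "\<dots> = (\<Sum>n. \<Sum>k. (\<integral>\<^sup>+x. indicator (J k) (c + sr_path c r x n) \<partial>GS) * (\<integral>\<^sup>+z. \<phi> k z \<partial>G))"
  proof (intro suminf_cong)
    fix n k
    have "(\<integral>\<^sup>+x. indicator (J k) (c + sr_path c r x n) * \<phi> k (x n) \<partial>GS)
       = (\<integral>\<^sup>+x. \<integral>\<^sup>+y. indicator (J k) (c + sr_path c r x n) * \<phi> k (y 0) \<partial>GS \<partial>GS)"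
      by (subst GS.nn_integral_comb_seq[of _ n]) (auto simp: sr_path_comb_seq_le comb_seq_def)
    also have "\<dots> = (\<integral>\<^sup>+x. indicator (J k) (c + sr_path c r x n) \<partial>GS) * (\<integral>\<^sup>+z. \<phi> k z \<partial>G)"
      using GS.nn_integral_component[OF borel_measurable_G, of "\<phi> k" 0]
      by (subst nn_integral_cmult) (auto simp: nn_integral_multc)
    finally show "(\<integral>\<^sup>+x. indicator (J k) (c + sr_path c r x n) * \<phi> k (x n) \<partial>GS) = \<dots>" .
  qed
  also have "\<dots> = (\<Sum>k. \<Sum>n. (\<integral>\<^sup>+x. indicator (J k) (c + sr_path c r x n) \<partial>GS) * (\<integral>\<^sup>+z. \<phi> k z \<partial>G))"
    by (rule suminf_swap_ennreal)
  also have "\<dots> = (\<Sum>k. (\<Sum>n. (\<integral>\<^sup>+x. indicator (J k) (c + sr_path c r x n) \<partial>GS)) * (\<integral>\<^sup>+z. \<phi> k z \<partial>G))"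
    by simp
  also have "\<dots> \<le> (\<Sum>k. ennreal visits * (\<integral>\<^sup>+z. \<phi> k z \<partial>G))"
    unfolding J_def by (intro suminf_le mult_right_mono occupation_bound c) auto
  also have "\<dots> = ennreal visits * (\<integral>\<^sup>+z. (\<Sum>k. \<phi> k z) \<partial>G)"
    by (simp add: nn_integral_suminf borel_measurable_G)
  also have "\<dots> \<le> ennreal visits * (\<integral>\<^sup>+z. ennreal (max 0 (ln z + 1 - b) * (max 0 (ln z + 1 - b) + 1)) \<partial>G)"
    unfolding \<phi>_def by (intro mult_left_mono nn_integral_mono suminf_pos_part_le) auto
  also have "\<dots> = ennreal visits * ennreal (\<integral>z. max 0 (ln z + 1 - b) * (max 0 (ln z + 1 - b) + 1) \<partial>G)"
    by (subst nn_integral_eq_integral[OF integrable_overshoot_tail]) (auto intro!: AE_I2 mult_nonneg_nonneg)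
  also have "\<dots> = ennreal (overshoot_tail b)"
    unfolding overshoot_tail_def using visits_pos by (subst ennreal_mult') auto
  finally show ?thesis .
qed

definition log_overshoot :: "real \<Rightarrow> real \<Rightarrow> real \<Rightarrow> (nat \<Rightarrow> real) \<Rightarrow> real" where
  "log_overshoot c r A x = ln (sr_path c r x (hit_time c r A x) / A)"

lemma measurable_log_overshoot[measurable]: "log_overshoot c r A \<in> borel_measurable GS"
  unfolding log_overshoot_def by measurable

lemma AE_log_overshoot_nonneg:
  assumes "0 \<le> c" "0 \<le> r" "0 < c + r" "0 < A"
  shows "AE x in GS. 0 \<le> log_overshoot c r A x \<and> A \<le> sr_path c r x (hit_time c r A x)"
  using AE_hits[OF assms]
proof eventually_elim
  case (elim x)
  have "A \<le> sr_path c r x (hit_time c r A x)" using first_hit_iff[OF elim] by (auto simp: first_hit_def)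
  then show ?case using assms by (auto simp: log_overshoot_def intro!: ln_ge_zero)
qed

lemma integrable_log_overshoot_tail:
  assumes c: "0 \<le> c" "c \<le> A" "0 \<le> r" "r < A" "0 < c + r"
  shows "integrable GS (\<lambda>x. max 0 (log_overshoot c r A x - b))" "(\<integral>x. max 0 (log_overshoot c r A x - b) \<partial>GS) \<le> overshoot_tail b"
proof -
  have *: "(\<integral>\<^sup>+x. ennreal (max 0 (log_overshoot c r A x - b)) \<partial>GS) \<le> ennreal (overshoot_tail b)"
    unfolding log_overshoot_def by (rule nn_overshoot_bound[OF c])
  then show i: "integrable GS (\<lambda>x. max 0 (log_overshoot c r A x - b))"
    by (intro integrableI_nonneg) (auto simp: top_unique less_top[symmetric])
  show "(\<integral>x. max 0 (log_overshoot c r A x - b) \<partial>GS) \<le> overshoot_tail b"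
    using * overshoot_tail_nonneg by (subst (asm) nn_integral_eq_integral[OF i]) auto
qed

lemma integrable_log_overshoot:
  assumes c: "0 \<le> c" "c \<le> A" "0 \<le> r" "r < A" "0 < c + r"
  shows "integrable GS (log_overshoot c r A)" "0 \<le> (\<integral>x. log_overshoot c r A x \<partial>GS)" "(\<integral>x. log_overshoot c r A x \<partial>GS) \<le> overshoot_tail 0"
proof -
  have A: "0 < A" using c by linarith
  have e: "AE x in GS. max 0 (log_overshoot c r A x - 0) = log_overshoot c r A x"
    using AE_log_overshoot_nonneg[OF c(1,3,5) A] by eventually_elim auto
  show "integrable GS (log_overshoot c r A)"
    using integrable_log_overshoot_tail(1)[OF c, of 0] by (subst (asm) integrable_cong_AE[OF _ _ e]) auto
  show "0 \<le> (\<integral>x. log_overshoot c r A x \<partial>GS)"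
    using AE_log_overshoot_nonneg[OF c(1,3,5) A] by (intro integral_nonneg_AE) auto
  have "(\<integral>x. log_overshoot c r A x \<partial>GS) = (\<integral>x. max 0 (log_overshoot c r A x - 0) \<partial>GS)"
    using e by (intro integral_cong_AE) (auto elim: eventually_mono)
  then show "(\<integral>x. log_overshoot c r A x \<partial>GS) \<le> overshoot_tail 0" using integrable_log_overshoot_tail(2)[OF c, of 0] by simp
qed

lemma AE_stopped_pos:
  assumes "0 \<le> c" "0 \<le> r" "0 < c + r" "0 < A"
  shows "AE x in GS. 0 < sr_path c r x (hit_time c r A x)"
  using AE_log_overshoot_nonneg[OF assms] by eventually_elim (use assms in auto)

lemma measurable_mean_time[measurable]: "(\<lambda>r. mean_time c r A) \<in> borel_measurable borel"
proof -
  have [measurable]: "(\<lambda>r. measure GS {x. alive c r A x n}) \<in> borel_measurable borel" for n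
  proof -
    have [measurable]: "Measurable.pred (borel \<Otimes>\<^sub>M GS) (\<lambda>z. alive c (fst z) A (snd z) n)" by measurable
    have "(\<lambda>z. indicator {x. alive c (fst z) A x n} (snd z) :: ennreal) = (\<lambda>z. (if alive c (fst z) A (snd z) n then 1 else 0))"
      by (auto simp: fun_eq_iff indicator_def)
    then have [measurable]: "(\<lambda>z. indicator {x. alive c (fst z) A x n} (snd z) :: ennreal) \<in> borel_measurable (borel \<Otimes>\<^sub>M GS)"
      by simp
    have "(\<lambda>r. \<integral>\<^sup>+x. indicator {x. alive c r A x n} x \<partial>GS) \<in> borel_measurable borel"
      using GS.P.borel_measurable_nn_integral[of "\<lambda>r x. indicator {x. alive c r A x n} x" borel]
      by (auto simp: split_beta')
    then have "(\<lambda>r. enn2real (emeasure GS {x. alive c r A x n})) \<in> borel_measurable borel" by simp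
    then show ?thesis by (simp only: measure_def)
  qed
  show ?thesis unfolding mean_time_def by measurable
qed

lemma mean_time_restart:
  assumes c: "0 \<le> c" "0 \<le> r" "0 < c + r" "0 < A'" "A' \<le> A"
  shows "integrable GS (\<lambda>x. mean_time c (sr_path c r x (hit_time c r A' x)) A)"
    "mean_time c r A = mean_time c r A' + (\<integral>x. mean_time c (sr_path c r x (hit_time c r A' x)) A \<partial>GS)"
proof -
  let ?R = "\<lambda>x. sr_path c r x (hit_time c r A' x)"
  have A: "0 < A" using c by linarith
  have p: "AE x in GS. mean_time_nn c (?R x) A = ennreal (mean_time c (?R x) A) \<and> 0 \<le> mean_time c (?R x) A"
    using AE_stopped_pos[OF c(1-4)]
  proof eventually_elim
    case (elim x)
    then show ?case using c A by (intro conjI mean_time_nn_eq mean_time_nonneg) auto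
  qed
  have nn: "(\<integral>\<^sup>+x. mean_time_nn c (?R x) A \<partial>GS) < \<top>"
    using mean_time_nn_restart[OF c] mean_time_nn_eq[OF c(1-3) A] by (simp add: less_top[symmetric]) (metis ennreal_add_eq_top ennreal_neq_top)
  have e: "AE x in GS. enn2real (mean_time_nn c (?R x) A) = mean_time c (?R x) A"
    using p by eventually_elim auto
  have i0: "integrable GS (\<lambda>x. enn2real (mean_time_nn c (?R x) A))"
  proof (intro integrableI_nonneg)
    have "(\<integral>\<^sup>+x. ennreal (enn2real (mean_time_nn c (?R x) A)) \<partial>GS) = (\<integral>\<^sup>+x. mean_time_nn c (?R x) A \<partial>GS)"
      using p by (intro nn_integral_cong_AE) (auto elim: eventually_mono)
    then show "(\<integral>\<^sup>+x. ennreal (enn2real (mean_time_nn c (?R x) A)) \<partial>GS) < \<infinity>" using nn by simp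
  qed auto
  have m: "(\<lambda>x. mean_time c (?R x) A) \<in> borel_measurable GS"
    by measurable
  show i: "integrable GS (\<lambda>x. mean_time c (?R x) A)"
    using i0 by (subst (asm) integrable_cong_AE[OF _ m e]) auto
  have "(\<integral>\<^sup>+x. mean_time_nn c (?R x) A \<partial>GS) = (\<integral>\<^sup>+x. ennreal (mean_time c (?R x) A) \<partial>GS)"
    using p by (intro nn_integral_cong_AE) (auto elim: eventually_mono)
  also have "\<dots> = ennreal (\<integral>x. mean_time c (?R x) A \<partial>GS)"
    using p by (intro nn_integral_eq_integral i) (auto elim: eventually_mono)
  finally have "ennreal (mean_time c r A) = ennreal (mean_time c r A') + ennreal (\<integral>x. mean_time c (?R x) A \<partial>GS)"
    using mean_time_nn_restart[OF c] mean_time_nn_eq[OF c(1-3) A] mean_time_nn_eq[OF c(1-4)] by simp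
  also have "\<dots> = ennreal (mean_time c r A' + (\<integral>x. mean_time c (?R x) A \<partial>GS))"
    using p mean_time_nonneg[OF c(1-4)] by (intro ennreal_plus[symmetric] integral_nonneg_AE) (auto elim: eventually_mono)
  finally show "mean_time c r A = mean_time c r A' + (\<integral>x. mean_time c (?R x) A \<partial>GS)"
    using mean_time_nonneg[OF c(1-3) A] mean_time_nonneg[OF c(1-4)] p
    by (subst (asm) ennreal_inj) (auto intro!: add_nonneg_nonneg integral_nonneg_AE elim: eventually_mono)
qed

end


section \<open>The limiting mean overshoot of the walk\<close>

text \<open>A Lipschitz function varies little between the points of a fine finite net, so pointwise
  convergence of the increments is uniform on bounded sets.\<close>

lemma lipschitz_increment_uniform:
  fixes w :: "real \<Rightarrow> real"
  assumes lip: "\<And>x y. \<bar>w x - w y\<bar> \<le> L * \<bar>x - y\<bar>"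
    and lim: "\<And>x. ((\<lambda>a. w a - w (a - x)) \<longlongrightarrow> 0) at_top" and "0 < e"
  shows "\<forall>\<^sub>F a in at_top. \<forall>x\<in>{0..K}. \<bar>w a - w (a - x)\<bar> < e"
proof -
  have L: "L \<ge> 0" using lip[of 1 0] by simp
  define h where "h = e / (2 * (L + 1))"
  have h: "h > 0" "L * h \<le> e/2" using L \<open>e>0\<close> by (auto simp: h_def field_simps)
  define n where "n = nat \<lceil>K / h\<rceil>"
  have "\<forall>\<^sub>F a in at_top. \<forall>i\<in>{..n}. dist (w a - w (a - real i * h)) 0 < e/2"
    by (intro eventually_ball_finite ballI tendstoD[OF lim half_gt_zero[OF \<open>e>0\<close>]]) simp
  then show ?thesis
  proof eventually_elim
    case (elim a)
    show ?case
    proof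
      fix x assume x: "x \<in> {0..K}"
      define i where "i = nat \<lfloor>x / h\<rfloor>"
      have xh: "0 \<le> x / h" using x h by simp
      have "x / h \<le> K / h" using x h by (simp add: divide_right_mono)
      then have "i \<le> n" unfolding i_def n_def by linarith
      have "real i \<le> x / h" "x / h \<le> real i + 1" using xh unfolding i_def by linarith+
      then have "\<bar>x - real i * h\<bar> \<le> h" using h by (simp add: field_simps abs_le_iff)
      then have "L * \<bar>x - real i * h\<bar> \<le> L * h" using L by (rule mult_left_mono)
      then have "\<bar>w (a - real i * h) - w (a - x)\<bar> \<le> L * h"
        using lip[of "a - real i * h" "a - x"] by (simp add: abs_minus_commute)
      moreover have "\<bar>w a - w (a - real i * h)\<bar> < e / 2" using elim \<open>i \<le> n\<close> by (auto simp: dist_real_def)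
      ultimately show "\<bar>w a - w (a - x)\<bar> < e" using h by linarith
    qed
  qed
qed

lemma tendsto_if_eventually_almost_constant:
  fixes f :: "real \<Rightarrow> real"
  assumes "\<And>e. e > 0 \<Longrightarrow> \<exists>v. \<forall>\<^sub>F a in at_top. \<bar>f a - v\<bar> \<le> e"
  shows "\<exists>l. (f \<longlongrightarrow> l) at_top"
proof -
  have "Cauchy (\<lambda>n. f (real n))"
  proof (rule CauchyI)
    fix e :: real assume "e > 0"
    then obtain v where "\<forall>\<^sub>F a in at_top. \<bar>f a - v\<bar> \<le> e/3" using assms[of "e/3"] by auto
    then have "\<forall>\<^sub>F n in sequentially. \<bar>f (real n) - v\<bar> \<le> e/3"
      by (rule eventually_compose_filterlim[OF _ filterlim_real_sequentially])
    then obtain N where N: "\<And>n. n \<ge> N \<Longrightarrow> \<bar>f (real n) - v\<bar> \<le> e/3" by (auto simp: eventually_sequentially)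
    have "norm (f (real m) - f (real n)) < e" if "m \<ge> N" "n \<ge> N" for m n
      using N[OF that(1)] N[OF that(2)] \<open>e>0\<close> unfolding real_norm_def by linarith
    then show "\<exists>M. \<forall>m\<ge>M. \<forall>n\<ge>M. norm (f (real m) - f (real n)) < e" by blast
  qed
  then obtain l where l: "(\<lambda>n. f (real n)) \<longlonglongrightarrow> l" using Cauchy_convergent convergent_def by blast
  have "(f \<longlongrightarrow> l) at_top"
  proof (rule tendstoI)
    fix e :: real assume "e > 0"
    then obtain v where v: "\<forall>\<^sub>F a in at_top. \<bar>f a - v\<bar> \<le> e/3" using assms[of "e/3"] by auto
    then have "\<forall>\<^sub>F n in sequentially. \<bar>f (real n) - v\<bar> \<le> e/3"
      by (rule eventually_compose_filterlim[OF _ filterlim_real_sequentially])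
    moreover have "(\<lambda>n. \<bar>f (real n) - v\<bar>) \<longlonglongrightarrow> \<bar>l - v\<bar>"
      by (rule tendsto_rabs[OF tendsto_diff[OF l tendsto_const]])
    ultimately have "\<bar>l - v\<bar> \<le> e/3" using tendsto_upperbound[OF _ _ trivial_limit_sequentially] by blast
    from v show "\<forall>\<^sub>F a in at_top. dist (f a) l < e"
      by eventually_elim (use \<open>\<bar>l - v\<bar> \<le> e/3\<close> \<open>e>0\<close> in \<open>unfold dist_real_def, linarith\<close>)
  qed
  then show ?thesis by blast
qed

text \<open>Turns a bound that is good up to \<open>K\<close> and grows linearly beyond into one whose second
  term has small mean for an overshoot \<open>k\<close>.\<close>

lemma split_at_level:
  fixes h :: "real \<Rightarrow> real"
  assumes "0 < K" "0 \<le> D" "0 \<le> \<eta>" "0 \<le> k"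
    and "k \<le> K \<Longrightarrow> \<bar>h k\<bar> \<le> \<eta>" and "\<bar>h k\<bar> \<le> D + k"
  shows "\<bar>h k\<bar> \<le> \<eta> + (2 + 2 * D / K) * max 0 (k - K / 2)"
proof (cases "k \<le> K")
  case True
  have "0 \<le> (2 + 2 * D / K) * max 0 (k - K / 2)" using assms by (intro mult_nonneg_nonneg add_nonneg_nonneg) auto
  moreover have "\<bar>h k\<bar> \<le> \<eta>" using assms True by simp
  ultimately show ?thesis by linarith
next
  case False
  define q where "q = 2 + 2 * D / K"
  have q: "q * (K/2) = K + D" "2 \<le> q" using assms by (auto simp: q_def field_simps)
  have "q * (k - K) \<ge> 2 * (k - K)" using False q by (intro mult_right_mono) auto
  moreover have "q * (k - K / 2) = q * (k - K) + q * (K/2)" by (simp add: algebra_simps)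
  ultimately have "q * (k - K / 2) \<ge> K + D + 2 * (k - K)" using q(1) by linarith
  then show ?thesis using False assms unfolding q_def[symmetric] by (simp add: max_def)
qed

context likelihood_walk
begin

text \<open>The mean time at which the walk started at \<open>0\<close> passes the level \<open>a\<close>.\<close>

definition renewal :: "real \<Rightarrow> real" where "renewal a = mean_time 0 1 (exp a)"

text \<open>By Wald's identity this is the mean overshoot when \<open>a > 0\<close>. For \<open>a \<le>
  0\<close> it is \<open>- a\<close>, the distance by which a walk already beyond the level
  exceeds it; with these boundary values it is harmonic for the walk on the positive half line.\<close>

definition excess :: "real \<Rightarrow> real" where "excess a = drift * renewal a - a"

lemma mean_time_scale:
  assumes "0 < r" "0 < A"
  shows "mean_time 0 r A = renewal (ln (A / r))"
proof -
  have "alive 0 r A x n \<longleftrightarrow> alive 0 1 (exp (ln (A / r))) x n" for x n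
    using assms unfolding alive_def by (simp add: sr_path_0 field_simps)
  then show ?thesis unfolding renewal_def mean_time_def by simp
qed

lemma renewal_mono: "a \<le> b \<Longrightarrow> renewal a \<le> renewal b"
  unfolding renewal_def mean_time_def
proof (intro suminf_le summable_prob_alive GS.P.finite_measure_mono)
  fix n assume "a \<le> b"
  then have "exp a \<le> exp b" by simp
  then show "{x. alive 0 1 (exp a) x n} \<subseteq> {x. alive 0 1 (exp b) x n}"
    unfolding alive_def by (auto intro: less_le_trans)
qed auto

lemma renewal_nonneg: "0 \<le> renewal a" unfolding renewal_def by (intro mean_time_nonneg) auto

lemma renewal_0: "a \<le> 0 \<Longrightarrow> renewal a = 0" unfolding renewal_def by (intro mean_time_0) auto

lemma excess_nonpos: "a \<le> 0 \<Longrightarrow> excess a = - a" by (simp add: excess_def renewal_0)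

lemma excess_ge: "a \<le> b \<Longrightarrow> excess a - (b - a) \<le> excess b"
  unfolding excess_def using mult_left_mono[OF renewal_mono[of a b], of drift] drift_pos by simp

lemma excess_eq_mean_overshoot:
  assumes "0 < a"
  shows "excess a = (\<integral>x. log_overshoot 0 1 (exp a) x \<partial>GS)"
proof -
  have e: "AE x in GS. log_overshoot 0 1 (exp a) x = ln (lr_prod x (hit_time 0 1 (exp a) x)) - a"
    using GS_pos
  proof eventually_elim
    case (elim x)
    then have "0 < lr_prod x (hit_time 0 1 (exp a) x)" using lr_prod_pos by blast
    then show ?case by (simp add: log_overshoot_def sr_path_0 ln_div)
  qed
  have "(\<integral>x. log_overshoot 0 1 (exp a) x \<partial>GS) = (\<integral>x. ln (lr_prod x (hit_time 0 1 (exp a) x)) - a \<partial>GS)"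
    using e by (intro integral_cong_AE) auto
  also have "\<dots> = excess a" unfolding excess_def renewal_def using wald[of 0 1 "exp a"] by simp
  finally show ?thesis by simp
qed

lemma excess_bounds:
  assumes "0 \<le> a" shows "0 \<le> excess a" "excess a \<le> overshoot_tail 0"
proof -
  have "0 \<le> excess a \<and> excess a \<le> overshoot_tail 0"
  proof (cases "a = 0")
    case True then show ?thesis using overshoot_tail_nonneg by (simp add: excess_nonpos)
  next
    case False
    then show ?thesis using assms integrable_log_overshoot(2,3)[of 0 "exp a" 1] by (simp add: excess_eq_mean_overshoot)
  qed
  then show "0 \<le> excess a" "excess a \<le> overshoot_tail 0" by auto
qed

lemma excess_nonneg: "0 \<le> excess a"
  using excess_bounds(1)[of a] excess_nonpos[of a] by linarith

lemma excess_le: "excess a \<le> overshoot_tail 0 + max 0 (- a)"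
  using excess_bounds(2)[of a] excess_nonpos[of a] overshoot_tail_nonneg[of 0] by linarith

lemma measurable_renewal[measurable]: "renewal \<in> borel_measurable borel"
  by (rule borel_measurable_mono) (simp add: mono_def renewal_mono)

lemma measurable_excess[measurable]: "excess \<in> borel_measurable borel"
  unfolding excess_def by measurable

lemma integrable_excess_shift: "integrable G (\<lambda>x. excess (a - ln x))"
proof (rule Bochner_Integration.integrable_bound)
  show "integrable G (\<lambda>x. overshoot_tail 0 + \<bar>a\<bar> + \<bar>ln x\<bar>)" using integrable_ln by auto
  show "(\<lambda>x. excess (a - ln x)) \<in> borel_measurable G" by (rule borel_measurable_G) measurable
  show "AE x in G. norm (excess (a - ln x)) \<le> norm (overshoot_tail 0 + \<bar>a\<bar> + \<bar>ln x\<bar>)"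
  proof (rule AE_I2)
    fix x :: real
    show "norm (excess (a - ln x)) \<le> norm (overshoot_tail 0 + \<bar>a\<bar> + \<bar>ln x\<bar>)"
      using excess_nonneg[of "a - ln x"] excess_le[of "a - ln x"] overshoot_tail_nonneg[of 0]
      unfolding real_norm_def by linarith
  qed
qed

text \<open>One step of the walk takes time \<open>1\<close> and moves the level from \<open>a\<close> to
  \<open>a - ln x\<close>; in terms of the excess the unit of time cancels against the mean
  \<open>drift\<close> of the step.\<close>

lemma excess_harmonic:
  assumes "0 < a"
  shows "excess a = (\<integral>x. excess (a - ln x) \<partial>G)"
proof -
  define A where "A = exp a"
  have A: "1 < A" "0 < A" using assms by (auto simp: A_def)
  have split: "(\<Sum>n. indicator {x. alive 0 1 A x n} (case_nat y z)) = 1 + (\<Sum>n. indicator {x. alive 0 y A x n} z :: ennreal)" for y z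
  proof -
    have "(\<Sum>n. indicator {x. alive 0 1 A x n} (case_nat y z) :: ennreal)
       = (\<Sum>n. indicator {x. alive 0 1 A x (n + 1)} (case_nat y z)) + (\<Sum>n<1. indicator {x. alive 0 1 A x n} (case_nat y z))"
      by (rule suminf_offset) auto
    also have "\<dots> = (\<Sum>n. indicator {x. alive 0 y A x n} z) + 1"
      using A by (simp add: alive_case_nat indicator_def) (simp add: alive_def)
    finally show ?thesis by (simp add: add.commute)
  qed
  have m: "(\<lambda>x. (\<Sum>n. indicator {x. alive 0 1 A x n} x) :: ennreal) \<in> borel_measurable GS" by measurable
  have "mean_time_nn 0 1 A = (\<integral>\<^sup>+y. \<integral>\<^sup>+z. 1 + (\<Sum>n. indicator {x. alive 0 y A x n} z) \<partial>GS \<partial>G)"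
    unfolding mean_time_nn_def using GS.nn_integral_case_nat[OF m] by (simp only: split)
  also have "\<dots> = (\<integral>\<^sup>+y. 1 + mean_time_nn 0 y A \<partial>G)"
    unfolding mean_time_nn_def by (subst nn_integral_add) auto
  also have "\<dots> = (\<integral>\<^sup>+y. ennreal (1 + renewal (a - ln y)) \<partial>G)"
    using G_pos
  proof (intro nn_integral_cong_AE, eventually_elim)
    case (elim y)
    have "mean_time_nn 0 y A = ennreal (renewal (ln (A / y)))"
      using elim A by (simp add: mean_time_nn_eq mean_time_scale)
    then show ?case using elim renewal_nonneg by (simp add: A_def ln_div ennreal_plus)
  qed
  finally have e: "ennreal (renewal a) = (\<integral>\<^sup>+y. ennreal (1 + renewal (a - ln y)) \<partial>G)"
    using A by (simp add: mean_time_nn_eq renewal_def A_def)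
  have r: "renewal t = (excess t + t) / drift" for t using drift_pos by (simp add: excess_def)
  have i: "integrable G (\<lambda>y. renewal (a - ln y))"
    unfolding r using integrable_excess_shift integrable_ln by auto
  have "ennreal (renewal a) = ennreal (\<integral>y. 1 + renewal (a - ln y) \<partial>G)"
    unfolding e using i renewal_nonneg by (intro nn_integral_eq_integral) (auto simp: add_nonneg_nonneg)
  then have "renewal a = (\<integral>y. 1 + renewal (a - ln y) \<partial>G)"
    using renewal_nonneg by (subst (asm) ennreal_inj) (auto intro!: Bochner_Integration.integral_nonneg simp: add_nonneg_nonneg)
  also have "\<dots> = 1 + (\<integral>y. renewal (a - ln y) \<partial>G)" using i by simp
  finally have "drift * renewal a = drift + (\<integral>y. drift * renewal (a - ln y) \<partial>G)"
    by (simp add: algebra_simps)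
  also have "(\<integral>y. drift * renewal (a - ln y) \<partial>G) = (\<integral>y. excess (a - ln y) + (a - ln y) \<partial>G)"
    by (simp add: excess_def)
  also have "\<dots> = (\<integral>y. excess (a - ln y) \<partial>G) + (a - drift)"
    using integrable_excess_shift integrable_ln by (simp add: drift_def)
  finally show ?thesis by (simp add: excess_def)
qed

text \<open>On its way to \<open>a + s\<close> the walk passes \<open>s\<close> with some overshoot, and the
  rest of the climb is \<open>a\<close> minus that overshoot.\<close>

lemma excess_restart:
  assumes "0 < s" "0 \<le> a"
  shows "integrable GS (\<lambda>x. excess (a - log_overshoot 0 1 (exp s) x))"
    "excess (a + s) = (\<integral>x. excess (a - log_overshoot 0 1 (exp s) x) \<partial>GS)"
proof -
  let ?\<kappa> = "log_overshoot 0 1 (exp s)"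
  have io: "integrable GS ?\<kappa>" using assms by (intro integrable_log_overshoot) auto
  have e: "AE x in GS. mean_time 0 (sr_path 0 1 x (hit_time 0 1 (exp s) x)) (exp (a + s)) = renewal (a - ?\<kappa> x)"
    using AE_stopped_pos[of 0 1 "exp s", simplified]
  proof eventually_elim
    case (elim x)
    then show ?case by (simp add: mean_time_scale log_overshoot_def ln_div algebra_simps)
  qed
  note R = mean_time_restart[of 0 1 "exp s" "exp (a + s)"]
  have i: "integrable GS (\<lambda>x. renewal (a - ?\<kappa> x))"
    using R(1) assms by (subst integrable_cong_AE[OF _ _ e, symmetric]) auto
  have v: "renewal (a + s) = renewal s + (\<integral>x. renewal (a - ?\<kappa> x) \<partial>GS)"
    using R(2) assms unfolding renewal_def[symmetric] by (subst integral_cong_AE[OF _ _ e, symmetric]) auto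
  show "integrable GS (\<lambda>x. excess (a - ?\<kappa> x))" unfolding excess_def using i io by auto
  have "(\<integral>x. excess (a - ?\<kappa> x) \<partial>GS) = drift * (\<integral>x. renewal (a - ?\<kappa> x) \<partial>GS) - (a - (\<integral>x. ?\<kappa> x \<partial>GS))"
    unfolding excess_def using i io by simp
  also have "\<dots> = excess (a + s)"
    using excess_eq_mean_overshoot[OF assms(1)] unfolding v excess_def by (simp add: v algebra_simps)
  finally show "excess (a + s) = (\<integral>x. excess (a - ?\<kappa> x) \<partial>GS)" by simp
qed

text \<open>The excess may jump. Averaged over a short interval of levels it is Lipschitz, and it stays
  harmonic.\<close>

definition smooth :: "real \<Rightarrow> real \<Rightarrow> real" where
  "smooth d a = (\<integral>t. excess (a + t) \<partial>restrict_space lborel {0..d}) / d"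

lemma set_integrable_excess: "set_integrable lborel {p..q} (\<lambda>t. excess (a + t))"
  unfolding set_integrable_def
proof (rule integrableI_bounded_set_indicator[where B="overshoot_tail 0 + \<bar>a\<bar> + \<bar>p\<bar>"])
  show "AE t in lborel. t \<in> {p..q} \<longrightarrow> norm (excess (a + t)) \<le> overshoot_tail 0 + \<bar>a\<bar> + \<bar>p\<bar>"
  proof (rule AE_I2, rule impI)
    fix t assume "t \<in> {p..q}"
    then show "norm (excess (a + t)) \<le> overshoot_tail 0 + \<bar>a\<bar> + \<bar>p\<bar>"
      using excess_nonneg[of "a + t"] excess_le[of "a + t"] overshoot_tail_nonneg[of 0]
      unfolding real_norm_def atLeastAtMost_iff by linarith
  qed
  show "emeasure lborel {p..q} < \<infinity>" by (cases "p \<le> q") auto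
qed auto

lemma integrable_smooth: "integrable (restrict_space lborel {0..d}) (\<lambda>t. excess (a + t))"
  using set_integrable_excess[of 0 d a] by (simp add: integrable_restrict_space set_integrable_def)

lemma excess_integrable_on: "excess integrable_on {p..q}"
  using set_borel_integral_eq_integral(1)[OF set_integrable_excess[of p q 0]] by simp

lemma smooth_eq: "smooth d a = integral {a..a + d} excess / d"
proof -
  have "(\<integral>t. excess (a + t) \<partial>restrict_space lborel {0..d}) = (LINT t:{0..d}|lborel. excess (a + t))"
    by (simp add: integral_restrict_space set_lebesgue_integral_def)
  also have "\<dots> = integral {0..d} (excess \<circ> (+) a)"
    using set_borel_integral_eq_integral(2)[OF set_integrable_excess] by (simp add: o_def)
  finally show ?thesis unfolding smooth_def integral_shift_Icc_real by (simp add: add.commute)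
qed

lemma smooth_lipschitz:
  assumes "0 < d"
  shows "\<bar>smooth d x - smooth d y\<bar> \<le> (overshoot_tail 0 + d) / d * \<bar>x - y\<bar>"
proof -
  let ?D = "overshoot_tail 0 + d"
  have D: "\<bar>excess (t + d) - excess t\<bar> \<le> ?D" for t
    using assms excess_bounds[of t] excess_bounds[of "t + d"] excess_nonpos[of t] excess_nonpos[of "t + d"] overshoot_tail_nonneg[of 0]
    by linarith
  have main: "\<bar>smooth d b - smooth d a\<bar> \<le> ?D / d * (b - a)" if "a \<le> b" for a b
  proof -
    have "integral {a..a + d} excess + integral {a + d..b + d} excess = integral {a..b + d} excess"
      "integral {a..b} excess + integral {b..b + d} excess = integral {a..b + d} excess"
      using that assms by (auto intro!: Henstock_Kurzweil_Integration.integral_combine excess_integrable_on)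
    moreover have "integral {a + d..b + d} excess = integral {a..b} (excess \<circ> (+) d)"
      by (rule integral_shift_Icc_real[symmetric])
    moreover have io: "(excess \<circ> (+) d) integrable_on {a..b}"
      using set_borel_integral_eq_integral(1)[OF set_integrable_excess] by (simp add: o_def)
    ultimately have e: "integral {b..b + d} excess - integral {a..a + d} excess = integral {a..b} (\<lambda>t. (excess \<circ> (+) d) t - excess t)"
      by (subst Henstock_Kurzweil_Integration.integral_diff[OF io excess_integrable_on]) linarith
    have "norm (integral {a..b} (\<lambda>t. (excess \<circ> (+) d) t - excess t)) \<le> ?D * measure lborel {a..b}"
      using D overshoot_tail_nonneg[of 0] assms
      by (intro has_integral_bound_real[where S="{}", OF _ _ integrable_integral] Henstock_Kurzweil_Integration.integrable_diff io excess_integrable_on)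
         (auto simp: add.commute)
    then have "\<bar>integral {b..b + d} excess - integral {a..a + d} excess\<bar> \<le> ?D * (b - a)"
      unfolding e using that by simp
    then have "\<bar>integral {b..b + d} excess - integral {a..a + d} excess\<bar> / d \<le> ?D * (b - a) / d"
      using assms by (intro divide_right_mono) auto
    moreover have "\<bar>smooth d b - smooth d a\<bar> = \<bar>integral {b..b + d} excess - integral {a..a + d} excess\<bar> / d"
      unfolding smooth_eq using assms by (simp flip: diff_divide_distrib)
    ultimately show ?thesis by simp
  qed
  show ?thesis using main[of x y] main[of y x] by (cases "x \<le> y") (auto simp: abs_minus_commute)
qed

text \<open>\<open>excess a + a\<close> is nondecreasing, so averaging to the right, and after a shift by
  \<open>d\<close> to the left, changes the excess by at most \<open>d\<close> in the respective
  direction.\<close>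

lemma smooth_sandwich:
  assumes "0 < d"
  shows "excess a \<le> smooth d a + d" "smooth d (a - d) \<le> excess a + d"
proof -
  interpret U: finite_measure "restrict_space lborel {0..d}"
    using assms by (intro finite_measureI) (simp add: emeasure_restrict_space space_restrict_space)
  have ms: "measure (restrict_space lborel {0..d}) (space (restrict_space lborel {0..d})) = d"
    using assms by (simp add: measure_restrict_space space_restrict_space)
  then have ms2: "measure (restrict_space lborel {0..d}) {0..d} = d" by (simp add: space_restrict_space)
  have "d * (excess a - d) = (\<integral>t. excess a - d \<partial>restrict_space lborel {0..d})" by (simp add: ms2 space_restrict_space)
  also have "\<dots> \<le> (\<integral>t. excess (a + t) \<partial>restrict_space lborel {0..d})"
  proof (rule integral_mono)
    fix t assume "t \<in> space (restrict_space lborel {0..d})"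
    then have "0 \<le> t" "t \<le> d" by (auto simp: space_restrict_space)
    then show "excess a - d \<le> excess (a + t)" using excess_ge[of a "a + t"] by simp
  qed (auto simp: integrable_smooth)
  finally show "excess a \<le> smooth d a + d" unfolding smooth_def using assms by (simp add: field_simps)
  have "(\<integral>t. excess (a - d + t) \<partial>restrict_space lborel {0..d}) \<le> (\<integral>t. excess a + d \<partial>restrict_space lborel {0..d})"
  proof (rule integral_mono)
    fix t assume "t \<in> space (restrict_space lborel {0..d})"
    then have "0 \<le> t" "t \<le> d" by (auto simp: space_restrict_space)
    then show "excess (a - d + t) \<le> excess a + d" using excess_ge[of "a - d + t" a] by simp
  qed (auto simp: integrable_smooth)
  also have "\<dots> = d * (excess a + d)" by (simp add: ms2 space_restrict_space)
  finally show "smooth d (a - d) \<le> excess a + d" unfolding smooth_def using assms by (simp add: field_simps)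
qed

lemma smooth_bound:
  assumes "0 < d" "0 \<le> a"
  shows "\<bar>smooth d a\<bar> \<le> overshoot_tail 0"
proof -
  have "norm (integral {a..a + d} excess) \<le> overshoot_tail 0 * measure lborel {a..a + d}"
    using excess_bounds overshoot_tail_nonneg[of 0] assms
    by (intro has_integral_bound_real[where S="{}", OF _ _ integrable_integral] excess_integrable_on) auto
  then show ?thesis unfolding smooth_eq using assms by (simp add: field_simps)
qed

lemma smooth_harmonic:
  assumes "0 < d" "0 < a"
  shows "smooth d a = (\<integral>x. smooth d (a - ln x) \<partial>G)"
proof -
  let ?U = "restrict_space lborel {0..d}"
  interpret U: finite_measure ?U
    using assms by (intro finite_measureI) (simp add: emeasure_restrict_space space_restrict_space)
  interpret P: pair_sigma_finite ?U G by unfold_locales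
  have [measurable]: "(\<lambda>z. excess (a + fst z - ln (snd z))) \<in> borel_measurable (?U \<Otimes>\<^sub>M G)"
  proof -
    have "fst \<in> borel_measurable (?U \<Otimes>\<^sub>M G)"
      by (rule measurable_compose[OF measurable_fst]) (simp add: measurable_restrict_space1)
    moreover have "snd \<in> borel_measurable (?U \<Otimes>\<^sub>M G)"
      by (rule measurable_compose[OF measurable_snd]) (rule borel_measurable_G, simp)
    ultimately show ?thesis by measurable
  qed
  have ii: "integrable (?U \<Otimes>\<^sub>M G) (\<lambda>z. overshoot_tail 0 + \<bar>a\<bar> + d + \<bar>ln (snd z)\<bar>)"
  proof -
    have "integrable (?U \<Otimes>\<^sub>M G) (\<lambda>(t, x). \<bar>ln x\<bar>)"
    proof (rule P.Fubini_integrable)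
      have "(\<lambda>x. \<bar>ln x\<bar>) \<in> borel_measurable G" by (rule borel_measurable_G) measurable
      then show "(\<lambda>(t, x). \<bar>ln x\<bar>) \<in> borel_measurable (?U \<Otimes>\<^sub>M G)"
        unfolding split_beta' by (rule measurable_compose[OF measurable_snd])
      show "integrable ?U (\<lambda>t. \<integral>x. norm (case (t, x) of (t, x) \<Rightarrow> \<bar>ln x\<bar>) \<partial>G)" by simp
      show "AE t in ?U. integrable G (\<lambda>x. case (t, x) of (t, x) \<Rightarrow> \<bar>ln x\<bar>)"
        using integrable_ln by simp
    qed
    moreover have "finite_measure (?U \<Otimes>\<^sub>M G)"
    proof (rule finite_measureI)
      have "emeasure (?U \<Otimes>\<^sub>M G) (space ?U \<times> space G) = emeasure ?U (space ?U) * emeasure G (space G)"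
        by (rule G.emeasure_pair_measure_Times) (rule sets.top)+
      also have "\<dots> \<noteq> \<infinity>" using U.emeasure_finite[of "space ?U"] by (simp add: ennreal_mult_eq_top_iff)
      finally show "emeasure (?U \<Otimes>\<^sub>M G) (space (?U \<Otimes>\<^sub>M G)) \<noteq> \<infinity>" unfolding space_pair_measure .
    qed
    ultimately show ?thesis
      unfolding split_beta' by (intro Bochner_Integration.integrable_add finite_measure.integrable_const)
  qed
  have i: "integrable (?U \<Otimes>\<^sub>M G) (\<lambda>(t, x). excess (a + t - ln x))"
  proof (rule Bochner_Integration.integrable_bound[OF ii])
    show "AE z in ?U \<Otimes>\<^sub>M G. norm (case z of (t, x) \<Rightarrow> excess (a + t - ln x)) \<le> norm (overshoot_tail 0 + \<bar>a\<bar> + d + \<bar>ln (snd z)\<bar>)"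
    proof (rule AE_I2)
      fix z assume "z \<in> space (?U \<Otimes>\<^sub>M G)"
      then have "0 \<le> fst z" "fst z \<le> d" by (auto simp: space_pair_measure space_restrict_space)
      then show "norm (case z of (t, x) \<Rightarrow> excess (a + t - ln x)) \<le> norm (overshoot_tail 0 + \<bar>a\<bar> + d + \<bar>ln (snd z)\<bar>)"
        using excess_nonneg[of "a + fst z - ln (snd z)"] excess_le[of "a + fst z - ln (snd z)"] overshoot_tail_nonneg[of 0]
        unfolding real_norm_def split_beta' by linarith
    qed
  qed (simp add: split_beta')
  have "(\<integral>t. excess (a + t) \<partial>?U) = (\<integral>t. (\<integral>x. excess (a + t - ln x) \<partial>G) \<partial>?U)"
    using assms by (intro Bochner_Integration.integral_cong excess_harmonic) (auto simp: space_restrict_space)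
  also have "\<dots> = (\<integral>x. (\<integral>t. excess (a + t - ln x) \<partial>?U) \<partial>G)"
    using P.Fubini_integral[OF i] by simp
  finally show ?thesis unfolding smooth_def by (simp add: algebra_simps)
qed

lemma smooth_increment_tendsto_0:
  assumes "0 < d"
  shows "((\<lambda>a. smooth d a - smooth d (a - x)) \<longlongrightarrow> 0) at_top"
proof (rule lipschitz_harmonic_increment_tendsto_0)
  have [measurable]: "ln \<in> borel_measurable G" by (rule borel_measurable_G) measurable
  have cont: "continuous_on UNIV (smooth d)"
    using smooth_lipschitz[OF assms] overshoot_tail_nonneg[of 0] assms
    by (intro lipschitz_on_continuous_on[of "(overshoot_tail 0 + d) / d"] lipschitz_onI) (auto simp: dist_real_def)
  then have [measurable]: "smooth d \<in> borel_measurable borel" by (rule borel_measurable_continuous_onI)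
  show "prob_space (distr G borel ln)" by (rule G.prob_space_distr) simp
  show "integrable (distr G borel ln) (\<lambda>z. z)" using integrable_ln by (subst integrable_distr_eq) auto
  show "\<bar>smooth d x - smooth d y\<bar> \<le> (overshoot_tail 0 + d) / d * \<bar>x - y\<bar>" for x y by (rule smooth_lipschitz[OF assms])
  show "\<bar>smooth d x\<bar> \<le> overshoot_tail 0" if "0 \<le> x" for x by (rule smooth_bound[OF assms that])
  show "smooth d a = (\<integral>z. smooth d (a - z) \<partial>distr G borel ln)" if "0 < a" for a
    using smooth_harmonic[OF assms that] by (subst integral_distr) auto
  show "\<not> (\<exists>e>0. AE z in distr G borel ln. \<exists>k::int. z = e * of_int k)"
  proof
    assume "\<exists>e>0. AE z in distr G borel ln. \<exists>k::int. z = e * of_int k"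
    then obtain e where e: "e > 0" "AE z in distr G borel ln. \<exists>k::int. z = e * of_int k" by (elim exE conjE)
    have "AE x in G. \<exists>k::int. ln x = e * of_int k" by (rule AE_distrD[OF _ e(2)]) simp
    with e(1) have "\<exists>d>0. AE x in G. \<exists>k::int. ln x = d * of_int k" by (intro exI[of _ e] conjI)
    then show False using nonarith by (rule notE[rotated])
  qed
qed simp

text \<open>The renewal theorem for the overshoot. The value at \<open>a + s\<close> is the mean of the excess
  at \<open>a\<close> minus the overshoot over \<open>s\<close>. The overshoots are uniformly
  integrable in \<open>s\<close>, and over bounded distances the smoothed excess is nearly
  constant at high levels. So the excess is close to \<open>smooth d a\<close> at all levels above
  \<open>a\<close>, which is the Cauchy criterion.\<close>

theorem excess_convergent: "\<exists>l. (excess \<longlongrightarrow> l) at_top"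
proof (rule tendsto_if_eventually_almost_constant)
  fix e :: real assume "e > 0"
  let ?C = "overshoot_tail 0"
  define d where "d = e / 6"
  have d: "d > 0" using \<open>e > 0\<close> by (simp add: d_def)
  \<comment> \<open>beyond \<open>K\<close> the overshoots contribute little, uniformly in the level they belong to\<close>
  have "((\<lambda>K. (2 + 2 * (2 * ?C) / K) * overshoot_tail (K / 2)) \<longlongrightarrow> (2 + 0) * 0) at_top"
  proof (intro tendsto_mult tendsto_add tendsto_const)
    show "((\<lambda>K. 2 * (2 * ?C) / K) \<longlongrightarrow> 0) at_top"
      by (intro tendsto_divide_0[OF tendsto_const] filterlim_at_top_imp_at_infinity filterlim_ident)
    show "((\<lambda>K. overshoot_tail (K / 2)) \<longlongrightarrow> 0) at_top"
      by (rule filterlim_compose[OF overshoot_tail_tendsto_0])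
        (use filterlim_at_top_mult_tendsto_pos[OF tendsto_const _ filterlim_ident, of "1/2"] in simp)
  qed
  then have "\<forall>\<^sub>F K in at_top. (2 + 2 * (2 * ?C) / K) * overshoot_tail (K / 2) < e / 2"
    using order_tendstoD(2)[of _ 0 at_top "e/2"] \<open>e > 0\<close> by simp
  from eventually_happens'[OF _ eventually_conj[OF this eventually_gt_at_top[of 0]]]
  obtain K where K: "K > 0" "(2 + 2 * (2 * ?C) / K) * overshoot_tail (K / 2) < e / 2" by auto
  have "\<forall>\<^sub>F a in at_top. \<forall>x\<in>{0..K + d}. \<bar>smooth d a - smooth d (a - x)\<bar> < d"
    by (rule lipschitz_increment_uniform[OF smooth_lipschitz[OF d] smooth_increment_tendsto_0[OF d] d])
  from eventually_happens'[OF _ eventually_conj[OF this eventually_ge_at_top[of 0]]]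
  obtain a where a0: "\<forall>x\<in>{0..K + d}. \<bar>smooth d a - smooth d (a - x)\<bar> < d" and "a \<ge> 0" by auto
  then have a: "\<And>x. 0 \<le> x \<Longrightarrow> x \<le> K + d \<Longrightarrow> \<bar>smooth d a - smooth d (a - x)\<bar> < d" "a \<ge> 0" by auto
  have near: "\<bar>excess (a - x) - smooth d a\<bar> \<le> 2 * d" if "0 \<le> x" "x \<le> K" for x
  proof -
    have "\<bar>smooth d a - smooth d (a - x)\<bar> < d" using that d by (intro a) auto
    moreover have "\<bar>smooth d a - smooth d (a - x - d)\<bar> < d"
      unfolding diff_diff_eq using that d by (intro a) auto
    ultimately show ?thesis using smooth_sandwich[OF d, of "a - x"] by linarith
  qed
  have far: "\<bar>excess (a - x) - smooth d a\<bar> \<le> 2 * ?C + x" if "0 \<le> x" for x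
    using excess_nonneg[of "a - x"] excess_le[of "a - x"] smooth_bound[OF d a(2)] that a(2) overshoot_tail_nonneg[of 0] by linarith
  have "\<bar>excess (a + s) - smooth d a\<bar> \<le> e" if "s > 0" for s
  proof -
    let ?\<kappa> = "log_overshoot 0 1 (exp s)"
    have i: "integrable GS (\<lambda>x. excess (a - ?\<kappa> x))" by (rule excess_restart[OF that a(2)])
    have t: "integrable GS (\<lambda>x. max 0 (?\<kappa> x - K/2))" "(\<integral>x. max 0 (?\<kappa> x - K/2) \<partial>GS) \<le> overshoot_tail (K/2)"
      using that integrable_log_overshoot_tail[of 0 "exp s" 1 "K/2"] by auto
    have on: "AE x in GS. 0 \<le> ?\<kappa> x \<and> exp s \<le> sr_path 0 1 x (hit_time 0 1 (exp s) x)" by (rule AE_log_overshoot_nonneg) auto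
    have "\<bar>excess (a + s) - smooth d a\<bar> = \<bar>\<integral>x. excess (a - ?\<kappa> x) - smooth d a \<partial>GS\<bar>"
      using i excess_restart(2)[OF that a(2)] by simp
    also have "\<dots> \<le> (\<integral>x. \<bar>excess (a - ?\<kappa> x) - smooth d a\<bar> \<partial>GS)" by (rule integral_abs_bound)
    also have "\<dots> \<le> (\<integral>x. 2 * d + (2 + 2 * (2 * ?C) / K) * max 0 (?\<kappa> x - K/2) \<partial>GS)"
    proof (rule integral_mono_AE)
      show "AE x in GS. \<bar>excess (a - ?\<kappa> x) - smooth d a\<bar> \<le> 2 * d + (2 + 2 * (2 * ?C) / K) * max 0 (?\<kappa> x - K/2)"
        using on
      proof eventually_elim
        case (elim x)
        show ?case using split_at_level[of K "2 * ?C" "2 * d" "?\<kappa> x" "\<lambda>k. excess (a - k) - smooth d a"]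
          K d near far elim overshoot_tail_nonneg[of 0] by auto
      qed
    qed (use i t in auto)
    also have "\<dots> = 2 * d + (2 + 2 * (2 * ?C) / K) * (\<integral>x. max 0 (?\<kappa> x - K/2) \<partial>GS)" using t by simp
    also have "\<dots> \<le> 2 * d + (2 + 2 * (2 * ?C) / K) * overshoot_tail (K/2)"
      using t K overshoot_tail_nonneg[of 0] by (intro add_left_mono mult_left_mono) auto
    also have "\<dots> \<le> e"
    proof -
      have "2 * d = e / 3" by (simp add: d_def)
      then show ?thesis using K(2) \<open>e > 0\<close> by linarith
    qed
    finally show ?thesis .
  qed
  from this[of "b - a" for b] have "\<bar>excess b - smooth d a\<bar> \<le> e" if "b > a" for b using that by simp
  then show "\<exists>v. \<forall>\<^sub>F a in at_top. \<bar>excess a - v\<bar> \<le> e"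
    by (intro exI[of _ "smooth d a"] eventually_mono[OF eventually_gt_at_top[of a]]) auto
qed

end


section \<open>The Shiryaev--Roberts statistic as a perturbed walk\<close>

lemma ln_one_plus_le_sqrt: "0 \<le> x \<Longrightarrow> ln (1 + x) \<le> 2 * sqrt x" for x :: real
proof -
  assume x: "0 \<le> x"
  have "1 + x \<le> (1 + sqrt x)\<^sup>2" using x by (simp add: power2_eq_square algebra_simps)
  then have "ln (1 + x) \<le> ln ((1 + sqrt x)\<^sup>2)" using x by (intro ln_mono) auto
  also have "\<dots> = 2 * ln (1 + sqrt x)" using x by (subst ln_realpow) (auto intro: add_pos_nonneg)
  also have "\<dots> \<le> 2 * sqrt x" using x ln_add_one_self_le_self[of "sqrt x"] by simp
  finally show ?thesis .
qed

lemma sqrt_sum_le: "(\<And>i. i \<in> I \<Longrightarrow> 0 \<le> f i) \<Longrightarrow> sqrt (\<Sum>i\<in>I. f i) \<le> (\<Sum>i\<in>I. sqrt (f i))"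
proof (induction I rule: infinite_finite_induct)
  case (insert i I)
  have "sqrt (f i + sum f I) \<le> sqrt (f i) + sqrt (sum f I)"
    using insert by (intro sqrt_add_le_add_sqrt) (auto intro: sum_nonneg)
  then show ?case using insert by simp
qed auto

definition perpetuity_sum :: "(nat \<Rightarrow> real) \<Rightarrow> nat \<Rightarrow> real" where "perpetuity_sum x n = (\<Sum>j<n. 1 / lr_prod x j)"
text \<open>This is \<open>1 + V_inf\<close>: the term \<open>j = 0\<close> equals \<open>1\<close>.\<close>

definition perpetuity :: "(nat \<Rightarrow> real) \<Rightarrow> real" where "perpetuity x = (\<Sum>j. 1 / lr_prod x j)"

lemma hit_time_mono:
  assumes "\<exists>n. A \<le> sr_path c r x n" "\<exists>n. A' \<le> sr_path c' r' x n" "\<And>n. alive c r A x n \<Longrightarrow> alive c' r' A' x n"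
  shows "hit_time c r A x \<le> hit_time c' r' A' x"
  using assms alive_iff_hit_time[OF assms(1)] alive_iff_hit_time[OF assms(2)]
  by (metis linorder_le_less_linear order_less_irrefl)

lemma hit_time_pos: 
  assumes "\<exists>n. A \<le> sr_path c r x n" "r < A"
  shows "0 < hit_time c r A x"
  using assms alive_iff_hit_time[OF assms(1), of 0] by (simp add: alive_def)

context likelihood_walk
begin

definition regular :: "(nat \<Rightarrow> real) \<Rightarrow> bool" where
  "regular x \<longleftrightarrow> (\<forall>i. 0 < x i) \<and> summable (\<lambda>j. 1 / lr_prod x j)"

lemma measurable_perpetuity[measurable]: "perpetuity \<in> borel_measurable GS"
  unfolding perpetuity_def by measurable

lemma measurable_perpetuity_sum_stopped[measurable]: "(\<lambda>x. perpetuity_sum x (hit_time c r A x)) \<in> borel_measurable GS"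
proof (rule measurable_compose_countable[where f="\<lambda>n x. perpetuity_sum x n"])
  show "(\<lambda>x. perpetuity_sum x n) \<in> borel_measurable GS" for n unfolding perpetuity_sum_def by measurable
qed measurable

lemma nn_integral_sum_inverse_sqrt: "(\<integral>\<^sup>+x. (\<Sum>j. ennreal (1 / sqrt (lr_prod x j))) \<partial>GS) = ennreal (1 / (1 - \<rho>))"
  by (subst nn_integral_suminf) (auto simp: nn_integral_GS_lr_prod suminf_\<rho>)

text \<open>The square root is subadditive, so the square root of the perpetuity is at most the sum of
  \<open>1 / sqrt (lr_prod x j)\<close>, whose mean is a geometric series. In particular the
  logarithm of the perpetuity is integrable.\<close>

lemma AE_regular_sqrt: "AE x in GS. regular x \<and> ennreal (sqrt (perpetuity x)) \<le> (\<Sum>j. ennreal (1 / sqrt (lr_prod x j)))"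
proof -
  have "AE x in GS. (\<Sum>j. ennreal (1 / sqrt (lr_prod x j))) \<noteq> \<infinity>"
    using nn_integral_sum_inverse_sqrt by (intro nn_integral_noteq_infinite) auto
  then show ?thesis using GS_pos
  proof eventually_elim
    case (elim x)
    have p: "0 < lr_prod x j" for j using elim(2) lr_prod_pos by blast
    obtain y where y: "(\<Sum>j. ennreal (1 / sqrt (lr_prod x j))) = ennreal y" "0 \<le> y"
      using elim(1) by (cases "\<Sum>j. ennreal (1 / sqrt (lr_prod x j))") auto
    have b: "(\<Sum>j<n. 1 / lr_prod x j) \<le> y\<^sup>2" for n
    proof -
      have "ennreal (\<Sum>j<n. 1 / sqrt (lr_prod x j)) \<le> ennreal y"
        unfolding y(1)[symmetric] using p by (subst sum_ennreal[symmetric]) (simp add: less_imp_le, rule sum_le_suminf, auto)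
      then have "(\<Sum>j<n. 1 / sqrt (lr_prod x j)) \<le> y" using y(2) by (simp add: ennreal_le_iff)
      moreover have "sqrt (\<Sum>j<n. 1 / lr_prod x j) \<le> (\<Sum>j<n. sqrt (1 / lr_prod x j))"
        using p by (intro sqrt_sum_le) (auto intro: less_imp_le)
      ultimately have "sqrt (\<Sum>j<n. 1 / lr_prod x j) \<le> y" by (simp add: real_sqrt_divide)
      then show ?thesis using real_sqrt_le_iff[of _ "y\<^sup>2"] y(2) by simp
    qed
    have s: "summable (\<lambda>j. 1 / lr_prod x j)"
      using b p by (intro summableI_nonneg_bounded[of _ "y\<^sup>2"]) (auto intro: less_imp_le)
    have "perpetuity x \<le> y\<^sup>2" unfolding perpetuity_def by (rule suminf_le_const[OF s b])
    then have "sqrt (perpetuity x) \<le> y" using y(2) real_sqrt_le_iff[of "perpetuity x" "y\<^sup>2"] by simp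
    then show ?case using s elim(2) unfolding y(1) regular_def by (auto intro: ennreal_leI)
  qed
qed

lemma AE_regular: "AE x in GS. regular x" using AE_regular_sqrt by eventually_elim auto

lemma regular_perpetuity_sum:
  assumes "regular x"
  shows "perpetuity_sum x n \<le> perpetuity x" "0 < n \<Longrightarrow> 1 \<le> perpetuity_sum x n" "1 \<le> perpetuity x" "(\<lambda>n. perpetuity_sum x n) \<longlonglongrightarrow> perpetuity x" "0 < lr_prod x n" "0 \<le> perpetuity_sum x n"
    "sr_path 1 r x n = lr_prod x n * (r + perpetuity_sum x n)"
proof -
  have x: "\<And>i. 0 < x i" and s: "summable (\<lambda>j. 1 / lr_prod x j)" using assms by (auto simp: regular_def)
  have p: "0 < lr_prod x j" for j using x lr_prod_pos by blast
  show a: "perpetuity_sum x n \<le> perpetuity x" for n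
    unfolding perpetuity_sum_def perpetuity_def using p s by (intro sum_le_suminf) (auto intro: less_imp_le)
  show b: "0 < n \<Longrightarrow> 1 \<le> perpetuity_sum x n" for n
  proof -
    assume "0 < n"
    then have "(\<Sum>j\<in>{0}. 1 / lr_prod x j) \<le> perpetuity_sum x n"
      unfolding perpetuity_sum_def using p by (intro sum_mono2) (auto intro: less_imp_le)
    then show ?thesis by simp
  qed
  show "1 \<le> perpetuity x" using a[of 1] b[of 1] by simp
  show "(\<lambda>n. perpetuity_sum x n) \<longlonglongrightarrow> perpetuity x" unfolding perpetuity_sum_def perpetuity_def using s by (rule summable_LIMSEQ)
  show "0 < lr_prod x n" by (rule p)
  show "0 \<le> perpetuity_sum x n" unfolding perpetuity_sum_def using p by (intro sum_nonneg) (auto intro: less_imp_le)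
  show "sr_path 1 r x n = lr_prod x n * (r + perpetuity_sum x n)" using sr_path_eq_lr_prod_sum[of x 1 r n, OF x] by (simp add: perpetuity_sum_def)
qed

lemma integrable_ln_perpetuity: "integrable GS (\<lambda>x. ln (1 + perpetuity x))"
proof (rule integrableI_bounded)
  have "(\<integral>\<^sup>+x. ennreal (norm (ln (1 + perpetuity x))) \<partial>GS) \<le> (\<integral>\<^sup>+x. 2 * (\<Sum>j. ennreal (1 / sqrt (lr_prod x j))) \<partial>GS)"
    using AE_regular_sqrt
  proof (intro nn_integral_mono_AE, eventually_elim)
    case (elim x)
    then have r: "regular x" and le: "ennreal (sqrt (perpetuity x)) \<le> (\<Sum>j. ennreal (1 / sqrt (lr_prod x j)))" by auto
    have "1 \<le> perpetuity x" using regular_perpetuity_sum[OF r] by auto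
    then have "ennreal (norm (ln (1 + perpetuity x))) \<le> ennreal (2 * sqrt (perpetuity x))"
      using ln_one_plus_le_sqrt[of "perpetuity x"] by (intro ennreal_leI) auto
    also have "\<dots> = 2 * ennreal (sqrt (perpetuity x))" by (simp add: ennreal_mult')
    also have "\<dots> \<le> 2 * (\<Sum>j. ennreal (1 / sqrt (lr_prod x j)))" by (rule mult_left_mono[OF le]) simp
    finally show ?case .
  qed
  also have "\<dots> < \<infinity>" by (subst nn_integral_cmult) (auto simp: nn_integral_sum_inverse_sqrt ennreal_mult_less_top)
  finally show "(\<integral>\<^sup>+x. ennreal (norm (ln (1 + perpetuity x))) \<partial>GS) < \<infinity>" .
qed measurable

lemma ln_add_perpetuity_bounds:
  assumes "regular x" "0 \<le> r"
  shows "0 \<le> ln (r + perpetuity x)" "ln (r + perpetuity x) \<le> ln (1 + r) + ln (1 + perpetuity x)"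
proof -
  have w: "1 \<le> perpetuity x" using regular_perpetuity_sum[OF assms(1)] by auto
  show "0 \<le> ln (r + perpetuity x)" using w assms(2) by (intro ln_ge_zero) auto
  have "0 \<le> r * perpetuity x" using w assms(2) by simp
  then have "r + perpetuity x \<le> (1 + r) * (1 + perpetuity x)" by (simp add: algebra_simps)
  then have "ln (r + perpetuity x) \<le> ln ((1 + r) * (1 + perpetuity x))" using w assms(2) by (intro ln_mono) auto
  then show "ln (r + perpetuity x) \<le> ln (1 + r) + ln (1 + perpetuity x)" using w assms(2) by (simp add: ln_mult)
qed

lemma integrable_ln_add_perpetuity: "0 \<le> r \<Longrightarrow> integrable GS (\<lambda>x. ln (r + perpetuity x))"
proof (rule Bochner_Integration.integrable_bound)
  assume r: "0 \<le> r"
  show "integrable GS (\<lambda>x. ln (1 + r) + ln (1 + perpetuity x))" using integrable_ln_perpetuity by auto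
  show "AE x in GS. norm (ln (r + perpetuity x)) \<le> norm (ln (1 + r) + ln (1 + perpetuity x))"
    using AE_regular by eventually_elim (use ln_add_perpetuity_bounds r in force)
qed measurable

text \<open>The mean logarithmic distance, after a long time, between the statistic started at
  \<open>r\<close> and the pure walk.\<close>

definition ell :: "real \<Rightarrow> real" where "ell r = (\<integral>x. ln (r + perpetuity x) \<partial>GS)"

lemma ell_increment:
  assumes "0 \<le> r" "0 \<le> s"
  shows "ell r \<le> ell (r + s)" "ell (r + s) \<le> ell r + ln (1 + s)"
proof -
  have i: "integrable GS (\<lambda>x. ln (r + perpetuity x))" "integrable GS (\<lambda>x. ln (r + s + perpetuity x))"
    using assms by (auto intro!: integrable_ln_add_perpetuity)
  show "ell r \<le> ell (r + s)" unfolding ell_def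
  proof (rule integral_mono_AE[OF i])
    show "AE x in GS. ln (r + perpetuity x) \<le> ln (r + s + perpetuity x)"
      using AE_regular
    proof eventually_elim
      case (elim x)
      show ?case using regular_perpetuity_sum(3)[OF elim] assms by (intro ln_mono) auto
    qed
  qed
  have "ell (r + s) \<le> (\<integral>x. ln (r + perpetuity x) + ln (1 + s) \<partial>GS)" unfolding ell_def
  proof (rule integral_mono_AE)
    show "AE x in GS. ln (r + s + perpetuity x) \<le> ln (r + perpetuity x) + ln (1 + s)"
      using AE_regular
    proof eventually_elim
      case (elim x)
      have w: "1 \<le> perpetuity x" using regular_perpetuity_sum(3)[OF elim] .
      have "s * 1 \<le> s * (r + perpetuity x)" using w assms by (intro mult_left_mono) auto
      then have "r + s + perpetuity x \<le> (r + perpetuity x) * (1 + s)" by (simp add: algebra_simps)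
      then have "ln (r + s + perpetuity x) \<le> ln ((r + perpetuity x) * (1 + s))" using w assms by (intro ln_mono) auto
      then show ?case using w assms by (simp add: ln_mult)
    qed
  qed (use i in auto)
  then show "ell (r + s) \<le> ell r + ln (1 + s)" using i by (simp add: ell_def)
qed

lemma ell_nonneg: "0 \<le> r \<Longrightarrow> 0 \<le> ell r"
  unfolding ell_def using AE_regular ln_add_perpetuity_bounds(1)
  by (intro integral_nonneg_AE) (auto elim!: eventually_mono)

lemma stopped_decomposition:
  assumes "0 \<le> r" "r < A"
  shows "AE x in GS. regular x \<and> 0 < hit_time 1 r A x \<and>
      ln (lr_prod x (hit_time 1 r A x)) = ln A + log_overshoot 1 r A x - ln (r + perpetuity_sum x (hit_time 1 r A x))"
proof -
  have c: "0 \<le> (1::real)" "0 < 1 + r" "0 < A" using assms by auto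
  show ?thesis using AE_regular AE_hits[OF c(1) assms(1) c(2,3)]
  proof eventually_elim
    case (elim x)
    let ?N = "hit_time 1 r A x"
    have N: "0 < ?N" using hit_time_pos[OF elim(2) assms(2)] .
    note R = regular_perpetuity_sum[OF elim(1)]
    have "log_overshoot 1 r A x = ln (lr_prod x ?N * (r + perpetuity_sum x ?N) / A)" unfolding log_overshoot_def R(7) ..
    also have "\<dots> = ln (lr_prod x ?N) + ln (r + perpetuity_sum x ?N) - ln A"
      using R(5)[of ?N] R(2)[OF N] assms c by (simp add: ln_div ln_mult)
    finally show ?case using elim N by simp
  qed
qed

lemma integrable_ln_add_perpetuity_sum:
  assumes "0 \<le> r" "r < A"
  shows "integrable GS (\<lambda>x. ln (r + perpetuity_sum x (hit_time 1 r A x)))"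
proof (rule Bochner_Integration.integrable_bound[OF integrable_ln_add_perpetuity[OF assms(1)]])
  show "AE x in GS. norm (ln (r + perpetuity_sum x (hit_time 1 r A x))) \<le> norm (ln (r + perpetuity x))"
    using stopped_decomposition[OF assms]
  proof eventually_elim
    case (elim x)
    then have "regular x" and N: "0 < hit_time 1 r A x" by auto
    note R = regular_perpetuity_sum[OF this(1)]
    have "0 \<le> ln (r + perpetuity_sum x (hit_time 1 r A x))" using R(2)[OF N] assms by (intro ln_ge_zero) auto
    moreover have "ln (r + perpetuity_sum x (hit_time 1 r A x)) \<le> ln (r + perpetuity x)"
      using R(1)[of "hit_time 1 r A x"] R(2)[OF N] assms by (intro ln_mono) auto
    ultimately show ?case by simp
  qed
qed measurable

text \<open>Wald's identity for the logarithm of the stopped statistic, which is the product of the ratios,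
  times the sum of \<open>r\<close> and a partial sum of the perpetuity.\<close>

lemma mean_time_decomposition:
  assumes "0 \<le> r" "r < A" "1 \<le> A"
  shows "drift * mean_time 1 r A = ln A + (\<integral>x. log_overshoot 1 r A x \<partial>GS) - (\<integral>x. ln (r + perpetuity_sum x (hit_time 1 r A x)) \<partial>GS)"
proof -
  have o: "integrable GS (log_overshoot 1 r A)" using assms by (intro integrable_log_overshoot) auto
  have "drift * mean_time 1 r A = (\<integral>x. ln (lr_prod x (hit_time 1 r A x)) \<partial>GS)"
    using wald(2)[of 1 r A] assms by simp
  also have "\<dots> = (\<integral>x. ln A + log_overshoot 1 r A x - ln (r + perpetuity_sum x (hit_time 1 r A x)) \<partial>GS)"
    using stopped_decomposition[OF assms(1,2)] by (intro integral_cong_AE) (auto elim: eventually_mono)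
  finally show ?thesis using o integrable_ln_add_perpetuity_sum[OF assms(1,2)] by simp
qed

definition overshoot_limit :: real where "overshoot_limit = Lim at_top excess"

lemma excess_tendsto: "(excess \<longlongrightarrow> overshoot_limit) at_top"
  using excess_convergent unfolding overshoot_limit_def by (metis tendsto_Lim trivial_limit_at_top_linorder)

lemma overshoot_limit_bounds: "0 \<le> overshoot_limit" "overshoot_limit \<le> overshoot_tail 0"
proof -
  show "0 \<le> overshoot_limit" by (rule tendsto_lowerbound[OF excess_tendsto]) (auto intro!: always_eventually excess_nonneg)
  show "overshoot_limit \<le> overshoot_tail 0"
    by (rule tendsto_upperbound[OF excess_tendsto]) (auto intro: eventually_mono[OF eventually_ge_at_top[of 0]] excess_bounds)
qed

text \<open>Correct only up to a bounded error, but uniformly in the start and the level. It will be used for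
  large starting values.\<close>

lemma mean_time_global_bound:
  assumes "0 \<le> r" "r < A" "1 \<le> A"
  shows "\<bar>drift * mean_time 1 r A - (ln A + overshoot_limit - ell r)\<bar> \<le> overshoot_tail 0 + (\<integral>x. ln (1 + perpetuity x) \<partial>GS)"
proof -
  let ?w = "\<lambda>x. perpetuity_sum x (hit_time 1 r A x)"
  have i: "integrable GS (\<lambda>x. ln (r + perpetuity x) - ln (r + ?w x))"
    using integrable_ln_add_perpetuity_sum[OF assms(1,2)] integrable_ln_add_perpetuity[OF assms(1)] by auto
  have e: "ell r - (\<integral>x. ln (r + ?w x) \<partial>GS) = (\<integral>x. ln (r + perpetuity x) - ln (r + ?w x) \<partial>GS)"
    unfolding ell_def using integrable_ln_add_perpetuity_sum[OF assms(1,2)] integrable_ln_add_perpetuity[OF assms(1)] by simp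
  have b: "AE x in GS. 0 \<le> ln (r + perpetuity x) - ln (r + ?w x) \<and> ln (r + perpetuity x) - ln (r + ?w x) \<le> ln (1 + perpetuity x)"
    using stopped_decomposition[OF assms(1,2)]
  proof eventually_elim
    case (elim x)
    then have "regular x" and N: "0 < hit_time 1 r A x" by auto
    note R = regular_perpetuity_sum[OF this(1)]
    have w: "1 \<le> ?w x" "?w x \<le> perpetuity x" using R(1) R(2)[OF N] by auto
    have "perpetuity x * 1 \<le> perpetuity x * (r + ?w x)" using w assms by (intro mult_left_mono) auto
    then have "r + perpetuity x \<le> (r + ?w x) * (1 + perpetuity x)" using w by (simp add: algebra_simps)
    then have "ln (r + perpetuity x) \<le> ln ((r + ?w x) * (1 + perpetuity x))" using w assms by (intro ln_mono) auto
    then have "ln (r + perpetuity x) \<le> ln (r + ?w x) + ln (1 + perpetuity x)" using w assms by (simp add: ln_mult)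
    moreover have "ln (r + ?w x) \<le> ln (r + perpetuity x)" using w assms by (intro ln_mono) auto
    ultimately show ?case by simp
  qed
  have "0 \<le> (\<integral>x. ln (r + perpetuity x) - ln (r + ?w x) \<partial>GS)"
    using b by (intro integral_nonneg_AE) (auto elim: eventually_mono)
  moreover have "(\<integral>x. ln (r + perpetuity x) - ln (r + ?w x) \<partial>GS) \<le> (\<integral>x. ln (1 + perpetuity x) \<partial>GS)"
    using b by (intro integral_mono_AE i integrable_ln_perpetuity) (auto elim: eventually_mono)
  moreover have "0 \<le> (\<integral>x. log_overshoot 1 r A x \<partial>GS)" "(\<integral>x. log_overshoot 1 r A x \<partial>GS) \<le> overshoot_tail 0"
    using assms by (auto intro!: integrable_log_overshoot)
  ultimately show ?thesis using mean_time_decomposition[OF assms] e overshoot_limit_bounds by linarith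
qed

text \<open>The added \<open>1\<close> in the recursion can only make the statistic larger than
  \<open>r\<close> times the walk.\<close>

lemma mean_time_le_renewal:
  assumes "0 < r" "0 < A"
  shows "mean_time 1 r A \<le> renewal (ln (A / r))"
proof -
  have "mean_time 1 r A \<le> mean_time 0 r A"
    unfolding mean_time_def
  proof (intro suminf_le summable_prob_alive)
    fix n
    show "measure GS {x. alive 1 r A x n} \<le> measure GS {x. alive 0 r A x n}"
    proof (rule GS.P.finite_measure_mono_AE)
      show "AE x in GS. x \<in> {x. alive 1 r A x n} \<longrightarrow> x \<in> {x. alive 0 r A x n}"
        using AE_regular
      proof eventually_elim
        case (elim x)
        have "sr_path 0 r x j \<le> sr_path 1 r x j" for j
          unfolding sr_path_0 regular_perpetuity_sum(7)[OF elim] using regular_perpetuity_sum(5,6)[OF elim, of j] by (simp add: algebra_simps)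
        then show ?case unfolding alive_def by (auto intro: le_less_trans)
      qed
    qed simp
  qed (use assms in auto)
  then show ?thesis using mean_time_scale[OF assms] by simp
qed

text \<open>The time that the walk needs for the level \<open>b\<close>, restricted to the event that the
  perpetuity is not small in comparison with \<open>A\<close>.\<close>

definition comparison_defect :: "real \<Rightarrow> real \<Rightarrow> real \<Rightarrow> real" where
  "comparison_defect b e A = (\<integral>x. real (hit_time 0 1 (exp b) x) * indicator {x. (exp e - 1) * exp (- b) * A < perpetuity x} x \<partial>GS)"

lemma integrable_comparison_defect:
  "integrable GS (\<lambda>x. real (hit_time 0 1 (exp b) x) * indicator {x. d < perpetuity x} x)"
proof (rule integrable_real_mult_indicator)
  have "{x \<in> space GS. d < perpetuity x} \<in> sets GS" by measurable
  then show "{x. d < perpetuity x} \<in> sets GS" by simp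
qed (use integrable_hit_time(1)[of 0 1 "exp b"] in simp)

text \<open>If the perpetuity is at most \<open>(exp e - 1) * r\<close>, the statistic stays within the factor
  \<open>exp e\<close> of \<open>r\<close> times the walk, which costs \<open>e\<close> in the
  level. On the complementary event the left-hand time is at most the time for the level
  \<open>b\<close>, because \<open>r\<close> is at most \<open>b\<close> below \<open>A\<close> on
  the logarithmic scale.\<close>

lemma renewal_le_mean_time:
  assumes "0 < A" "0 < e" "A * exp (- b) \<le> r"
  shows "renewal (ln (A / r) - e) \<le> mean_time 1 r A + comparison_defect b e A"
proof -
  have r: "0 < r" using assms by (meson exp_gt_zero less_le_trans mult_pos_pos)
  let ?A = "exp (ln (A / r) - e)"
  have "renewal (ln (A / r) - e) = (\<integral>x. real (hit_time 0 1 ?A x) \<partial>GS)"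
    unfolding renewal_def by (rule integrable_hit_time(2)[symmetric]) auto
  also have "\<dots> \<le> (\<integral>x. real (hit_time 1 r A x) + real (hit_time 0 1 (exp b) x) * indicator {x. (exp e - 1) * exp (- b) * A < perpetuity x} x \<partial>GS)"
  proof (rule integral_mono_AE)
    show "integrable GS (\<lambda>x. real (hit_time 0 1 ?A x))" by (rule integrable_hit_time(1)) auto
    show "integrable GS (\<lambda>x. real (hit_time 1 r A x) + real (hit_time 0 1 (exp b) x) * indicator {x. (exp e - 1) * exp (- b) * A < perpetuity x} x)"
      using r assms by (intro Bochner_Integration.integrable_add integrable_hit_time(1) integrable_comparison_defect) auto
    have h: "AE x in GS. \<exists>n. ?A \<le> sr_path 0 1 x n" "AE x in GS. \<exists>n. exp b \<le> sr_path 0 1 x n" "AE x in GS. \<exists>n. A \<le> sr_path 1 r x n"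
      using r assms by (auto intro!: AE_hits)
    show "AE x in GS. real (hit_time 0 1 ?A x) \<le> real (hit_time 1 r A x) + real (hit_time 0 1 (exp b) x) * indicator {x. (exp e - 1) * exp (- b) * A < perpetuity x} x"
      using h AE_regular
    proof eventually_elim
      case (elim x)
      note R = regular_perpetuity_sum[OF elim(4)]
      have Ae: "?A = A / (r * exp e)" using r assms by (simp add: exp_diff)
      show ?case
      proof (cases "(exp e - 1) * exp (- b) * A < perpetuity x")
        case True
        have "?A \<le> exp b"
        proof -
          have "A / r \<le> exp b" using assms r by (simp add: exp_minus field_simps)
          moreover have "A / (r * exp e) \<le> A / r" using assms r by (intro divide_left_mono) auto
          ultimately show ?thesis unfolding Ae by simp
        qed
        then have "hit_time 0 1 ?A x \<le> hit_time 0 1 (exp b) x"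
          by (intro hit_time_mono elim) (auto simp: alive_def intro: less_le_trans)
        then show ?thesis using True by simp
      next
        case False
        have "(exp e - 1) * (A * exp (- b)) \<le> (exp e - 1) * r" using assms by (intro mult_left_mono) auto
        then have w: "perpetuity x \<le> (exp e - 1) * r" using False by (simp add: mult.assoc mult.commute[of A])
        have "hit_time 0 1 ?A x \<le> hit_time 1 r A x"
        proof (intro hit_time_mono elim)
          fix n assume al: "alive 0 1 ?A x n"
          show "alive 1 r A x n" unfolding alive_def
          proof (intro allI impI)
            fix j assume "j \<le> n"
            then have "lr_prod x j < A / (r * exp e)" using al by (simp add: alive_def sr_path_0 Ae)
            then have "lr_prod x j * (r * exp e) < A" using r by (simp add: field_simps)
            moreover have "lr_prod x j * (r + perpetuity_sum x j) \<le> lr_prod x j * (r * exp e)"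
              using R(1)[of j] R(5)[of j] w by (intro mult_left_mono) (auto simp: algebra_simps)
            ultimately show "sr_path 1 r x j < A" unfolding R(7) by simp
          qed
        qed
        then show ?thesis using False by simp
      qed
    qed
  qed
  also have "\<dots> = mean_time 1 r A + comparison_defect b e A"
    unfolding comparison_defect_def using r assms integrable_hit_time[of 1 r A] integrable_comparison_defect
    by (subst Bochner_Integration.integral_add) auto
  finally show ?thesis .
qed

lemma comparison_defect_tendsto_0:
  assumes "0 < e"
  shows "(comparison_defect b e \<longlongrightarrow> 0) at_top"
proof -
  have "((\<lambda>A. comparison_defect b e A) \<longlongrightarrow> (\<integral>x. 0 \<partial>GS)) at_top" unfolding comparison_defect_def
  proof (rule integral_dominated_convergence_at_top[where w="\<lambda>x. real (hit_time 0 1 (exp b) x)"])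
    show "AE x in GS. ((\<lambda>A. real (hit_time 0 1 (exp b) x) * indicator {x. (exp e - 1) * exp (- b) * A < perpetuity x} x) \<longlongrightarrow> 0) at_top"
    proof (rule AE_I2, rule tendsto_eventually)
      fix x
      have "filterlim (\<lambda>A. (exp e - 1) * exp (- b) * A) at_top at_top"
        using assms by (intro filterlim_tendsto_pos_mult_at_top[OF tendsto_const _ filterlim_ident]) auto
      then have "\<forall>\<^sub>F A in at_top. perpetuity x \<le> (exp e - 1) * exp (- b) * A" by (simp add: filterlim_at_top)
      then show "\<forall>\<^sub>F A in at_top. real (hit_time 0 1 (exp b) x) * indicator {x. (exp e - 1) * exp (- b) * A < perpetuity x} x = 0"
        by eventually_elim (simp add: indicator_def)
    qed
    show "integrable GS (\<lambda>x. real (hit_time 0 1 (exp b) x))" by (rule integrable_hit_time) auto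
  qed (auto simp: indicator_def)
  then show ?thesis by simp
qed

text \<open>With the level, the passage time tends to infinity, so the partial sum of the perpetuity at that
  time exhausts it.\<close>

lemma tail_sum_tendsto_0:
  assumes "0 \<le> K"
  shows "((\<lambda>A. \<integral>x. ln (perpetuity x / perpetuity_sum x (hit_time 1 K A x)) \<partial>GS) \<longlongrightarrow> 0) at_top"
    "K < A \<Longrightarrow> integrable GS (\<lambda>x. ln (perpetuity x / perpetuity_sum x (hit_time 1 K A x)))"
proof -
  have bnd: "AE x in GS. norm (ln (perpetuity x / perpetuity_sum x (hit_time 1 K A x))) \<le> ln (1 + perpetuity x)" if "K < A" for A
    using stopped_decomposition[OF assms that]
  proof eventually_elim
    case (elim x)
    then have "regular x" and N: "0 < hit_time 1 K A x" by auto
    note R = regular_perpetuity_sum[OF this(1)]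
    let ?w = "perpetuity_sum x (hit_time 1 K A x)"
    have w: "1 \<le> ?w" "?w \<le> perpetuity x" using R(1) R(2)[OF N] by auto
    have "0 \<le> ln (perpetuity x / ?w)" using w by (intro ln_ge_zero) auto
    moreover have "ln (perpetuity x / ?w) \<le> ln (1 + perpetuity x)"
    proof (intro ln_mono)
      have "perpetuity x / ?w \<le> perpetuity x / 1" using w by (intro divide_left_mono) auto
      then show "perpetuity x / ?w \<le> 1 + perpetuity x" by simp
    qed (use w in auto)
    ultimately show ?case by simp
  qed
  show "integrable GS (\<lambda>x. ln (perpetuity x / perpetuity_sum x (hit_time 1 K A x)))" if "K < A"
    by (rule Bochner_Integration.integrable_bound[OF integrable_ln_perpetuity])
      (use bnd[OF that] in \<open>auto elim!: eventually_mono\<close>)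
  have "((\<lambda>A. \<integral>x. ln (perpetuity x / perpetuity_sum x (hit_time 1 K A x)) \<partial>GS) \<longlongrightarrow> (\<integral>x. 0 \<partial>GS)) at_top"
  proof (rule integral_dominated_convergence_at_top[OF _ _ integrable_ln_perpetuity])
    show "\<forall>\<^sub>F A in at_top. AE x in GS. norm (ln (perpetuity x / perpetuity_sum x (hit_time 1 K A x))) \<le> ln (1 + perpetuity x)"
      using eventually_gt_at_top[of K] by eventually_elim (rule bnd)
    have "AE x in GS. \<forall>n::nat. \<exists>k. real n + 1 \<le> sr_path 1 K x k"
      unfolding AE_all_countable using assms by (intro allI AE_hits) auto
    then show "AE x in GS. ((\<lambda>A. ln (perpetuity x / perpetuity_sum x (hit_time 1 K A x))) \<longlongrightarrow> 0) at_top"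
      using AE_regular
    proof eventually_elim
      case (elim x)
      note R = regular_perpetuity_sum[OF elim(2)]
      have hit: "\<exists>k. A \<le> sr_path 1 K x k" for A
      proof -
        obtain k where "real (nat \<lceil>A\<rceil>) + 1 \<le> sr_path 1 K x k" using elim(1) by blast
        moreover have "A \<le> real (nat \<lceil>A\<rceil>) + 1" by linarith
        ultimately show ?thesis by (intro exI[of _ k]) linarith
      qed
      have "filterlim (\<lambda>A. hit_time 1 K A x) at_top at_top"
        unfolding filterlim_at_top
      proof
        fix n :: nat
        have "\<forall>\<^sub>F A in at_top. \<forall>j\<in>{..n}. sr_path 1 K x j < A"
          by (intro eventually_ball_finite ballI eventually_gt_at_top) simp
        then have "\<forall>\<^sub>F A in at_top. n < hit_time 1 K A x"
          by eventually_elim (simp add: alive_iff_hit_time[OF hit, symmetric] alive_def)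
        then show "\<forall>\<^sub>F A in at_top. n \<le> hit_time 1 K A x" by eventually_elim simp
      qed
      then have "((\<lambda>A. perpetuity_sum x (hit_time 1 K A x)) \<longlongrightarrow> perpetuity x) at_top"
        by (rule filterlim_compose[OF R(4)])
      then have "((\<lambda>A. ln (perpetuity x / perpetuity_sum x (hit_time 1 K A x))) \<longlongrightarrow> ln (perpetuity x / perpetuity x)) at_top"
        using R(3) by (intro tendsto_intros) auto
      then show ?case using R(3) by simp
    qed
  qed measurable
  then show "((\<lambda>A. \<integral>x. ln (perpetuity x / perpetuity_sum x (hit_time 1 K A x)) \<partial>GS) \<longlongrightarrow> 0) at_top" by simp
qed


section \<open>Expansion of the mean passage time\<close>

lemma overshoot_split_expectation:
  assumes r: "0 \<le> r" "r < A" "1 \<le> A"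
    and h: "integrable GS (\<lambda>x. h (log_overshoot 1 r A x))"
    and K: "0 < K" "0 \<le> D" "0 \<le> \<eta>"
    and near: "\<And>k. 0 \<le> k \<Longrightarrow> k \<le> K \<Longrightarrow> \<bar>h k\<bar> \<le> \<eta>" and far: "\<And>k. 0 \<le> k \<Longrightarrow> \<bar>h k\<bar> \<le> D + k"
  shows "\<bar>\<integral>x. h (log_overshoot 1 r A x) \<partial>GS\<bar> \<le> \<eta> + (2 + 2 * D / K) * overshoot_tail (K / 2)"
proof -
  let ?\<chi> = "log_overshoot 1 r A"
  have t: "integrable GS (\<lambda>x. max 0 (?\<chi> x - K/2))" "(\<integral>x. max 0 (?\<chi> x - K/2) \<partial>GS) \<le> overshoot_tail (K/2)"
    using r by (auto intro!: integrable_log_overshoot_tail)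
  have on: "AE x in GS. 0 \<le> ?\<chi> x \<and> A \<le> sr_path 1 r x (hit_time 1 r A x)" using r by (intro AE_log_overshoot_nonneg) auto
  have "\<bar>\<integral>x. h (?\<chi> x) \<partial>GS\<bar> \<le> (\<integral>x. \<bar>h (?\<chi> x)\<bar> \<partial>GS)" by (rule integral_abs_bound)
  also have "\<dots> \<le> (\<integral>x. \<eta> + (2 + 2 * D / K) * max 0 (?\<chi> x - K/2) \<partial>GS)"
  proof (rule integral_mono_AE)
    show "AE x in GS. \<bar>h (?\<chi> x)\<bar> \<le> \<eta> + (2 + 2 * D / K) * max 0 (?\<chi> x - K/2)"
      using on
    proof eventually_elim
      case (elim x)
      then show ?case by (intro split_at_level K near far) auto
    qed
  qed (use h t in auto)
  also have "\<dots> = \<eta> + (2 + 2 * D / K) * (\<integral>x. max 0 (?\<chi> x - K/2) \<partial>GS)" using t by simp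
  also have "\<dots> \<le> \<eta> + (2 + 2 * D / K) * overshoot_tail (K/2)"
    using t K by (intro add_left_mono mult_left_mono) auto
  finally show ?thesis .
qed

lemma integrable_excess_overshoot:
  assumes "0 \<le> r" "r < A" "1 \<le> A"
  shows "integrable GS (\<lambda>x. excess (b - log_overshoot 1 r A x))"
proof (rule Bochner_Integration.integrable_bound)
  show "integrable GS (\<lambda>x. overshoot_tail 0 + \<bar>b\<bar> + \<bar>log_overshoot 1 r A x\<bar>)"
    using assms integrable_log_overshoot(1)[of 1 A r] by auto
  show "AE x in GS. norm (excess (b - log_overshoot 1 r A x)) \<le> norm (overshoot_tail 0 + \<bar>b\<bar> + \<bar>log_overshoot 1 r A x\<bar>)"
  proof (rule AE_I2)
    fix x :: "nat \<Rightarrow> real"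
    show "norm (excess (b - log_overshoot 1 r A x)) \<le> norm (overshoot_tail 0 + \<bar>b\<bar> + \<bar>log_overshoot 1 r A x\<bar>)"
      using excess_nonneg[of "b - log_overshoot 1 r A x"] excess_le[of "b - log_overshoot 1 r A x"] overshoot_tail_nonneg[of 0]
      unfolding real_norm_def by linarith
  qed
qed measurable

text \<open>The nonlinear renewal argument. The statistic is first stopped at the level \<open>A * exp (-
  b)\<close>. For this stage Wald's identity is exact. At its end the statistic is so large that
  from there on it behaves like a pure walk, whose mean passage time for the remaining distance,
  \<open>b\<close> minus the overshoot, is expressed by the excess.\<close>

lemma two_stage_bounds:
  assumes r: "0 \<le> r" "r < A * exp (- b)" "1 \<le> A * exp (- b)" and b: "0 < b" and e: "0 < e"
  defines "A' \<equiv> A * exp (- b)"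
  defines "V \<equiv> (\<integral>x. ln (r + perpetuity_sum x (hit_time 1 r A' x)) \<partial>GS)"
  shows "drift * mean_time 1 r A \<le> ln A - V + (\<integral>x. excess (b - log_overshoot 1 r A' x) \<partial>GS)"
    "ln A - V + (\<integral>x. excess (b - e - log_overshoot 1 r A' x) \<partial>GS) - e - drift * comparison_defect b e A \<le> drift * mean_time 1 r A"
proof -
  have A': "0 < A'" "1 \<le> A'" "r < A'" using r by (auto simp: A'_def)
  have "0 < A * exp (- b)" using r(3) by linarith
  then have A: "0 < A" by (simp add: zero_less_mult_iff)
  have AA: "A' \<le> A" unfolding A'_def using A b by simp
  let ?R = "\<lambda>x. sr_path 1 r x (hit_time 1 r A' x)"
  let ?P = "\<lambda>x. ln (lr_prod x (hit_time 1 r A' x))"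
  let ?\<chi> = "log_overshoot 1 r A'"
  have io: "integrable GS ?\<chi>" using A' r by (intro integrable_log_overshoot) auto
  have iw: "integrable GS (\<lambda>x. ln (r + perpetuity_sum x (hit_time 1 r A' x)))" using r A' by (intro integrable_ln_add_perpetuity_sum) auto
  have im: "integrable GS (\<lambda>x. mean_time 1 (?R x) A)"
    and em: "mean_time 1 r A = mean_time 1 r A' + (\<integral>x. mean_time 1 (?R x) A \<partial>GS)"
    using mean_time_restart[of 1 r A' A] r A' AA by auto
  have ip: "integrable GS ?P" and ep: "(\<integral>x. ?P x \<partial>GS) = drift * mean_time 1 r A'"
    using wald[of 1 r A'] r A' by auto
  have tot: "drift * mean_time 1 r A = (\<integral>x. ?P x + drift * mean_time 1 (?R x) A \<partial>GS)"
    using im ip ep em by (simp add: algebra_simps)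
  have dec: "AE x in GS. ?P x = ln A' + ?\<chi> x - ln (r + perpetuity_sum x (hit_time 1 r A' x)) \<and> 0 < ?R x \<and> A' \<le> ?R x \<and> ln (A / ?R x) = b - ?\<chi> x"
  proof -
    have "AE x in GS. 0 \<le> ?\<chi> x \<and> A' \<le> ?R x" using r A' by (intro AE_log_overshoot_nonneg) auto
    then show ?thesis using stopped_decomposition[OF r(1) A'(3)]
    proof eventually_elim
      case (elim x)
      then have R: "0 < ?R x" "A' \<le> ?R x" using A' by auto
      have "ln (A / ?R x) = b - ?\<chi> x" unfolding log_overshoot_def using R A A' by (simp add: ln_div A'_def ln_mult)
      then show ?case using elim R by simp
    qed
  qed
  have lnA: "ln A' = ln A - b" unfolding A'_def using A by (simp add: ln_mult)
  have ie: "integrable GS (\<lambda>x. excess (c - ?\<chi> x))" for c using r A' by (intro integrable_excess_overshoot) auto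
  have "drift * mean_time 1 r A \<le> (\<integral>x. ln A - ln (r + perpetuity_sum x (hit_time 1 r A' x)) + excess (b - ?\<chi> x) \<partial>GS)"
    unfolding tot
  proof (rule integral_mono_AE)
    show "AE x in GS. ?P x + drift * mean_time 1 (?R x) A \<le> ln A - ln (r + perpetuity_sum x (hit_time 1 r A' x)) + excess (b - ?\<chi> x)"
      using dec
    proof eventually_elim
      case (elim x)
      have "mean_time 1 (?R x) A \<le> renewal (b - ?\<chi> x)" using mean_time_le_renewal[of "?R x" A] elim A by simp
      then have "drift * mean_time 1 (?R x) A \<le> drift * renewal (b - ?\<chi> x)" using drift_pos by simp
      then have "drift * mean_time 1 (?R x) A \<le> excess (b - ?\<chi> x) + (b - ?\<chi> x)" by (simp add: excess_def)
      then show ?case using elim lnA by linarith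
    qed
  qed (use ip im iw ie in auto)
  also have "\<dots> = ln A - V + (\<integral>x. excess (b - ?\<chi> x) \<partial>GS)" using iw ie by (simp add: V_def)
  finally show "drift * mean_time 1 r A \<le> ln A - V + (\<integral>x. excess (b - log_overshoot 1 r A' x) \<partial>GS)" .
  have "ln A - V + (\<integral>x. excess (b - e - ?\<chi> x) \<partial>GS) - e - drift * comparison_defect b e A
     = (\<integral>x. ln A - ln (r + perpetuity_sum x (hit_time 1 r A' x)) + excess (b - e - ?\<chi> x) - e - drift * comparison_defect b e A \<partial>GS)"
    using iw ie by (simp add: V_def)
  also have "\<dots> \<le> drift * mean_time 1 r A"
    unfolding tot
  proof (rule integral_mono_AE)
    show "AE x in GS. ln A - ln (r + perpetuity_sum x (hit_time 1 r A' x)) + excess (b - e - ?\<chi> x) - e - drift * comparison_defect b e A \<le> ?P x + drift * mean_time 1 (?R x) A"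
      using dec
    proof eventually_elim
      case (elim x)
      have "renewal (b - ?\<chi> x - e) \<le> mean_time 1 (?R x) A + comparison_defect b e A"
        using renewal_le_mean_time[OF A e, of b "?R x"] elim by (simp add: A'_def)
      then have "drift * renewal (b - ?\<chi> x - e) \<le> drift * (mean_time 1 (?R x) A + comparison_defect b e A)"
        using drift_pos by simp
      then have "excess (b - e - ?\<chi> x) + (b - e - ?\<chi> x) \<le> drift * mean_time 1 (?R x) A + drift * comparison_defect b e A"
        by (simp add: excess_def algebra_simps)
      then show ?case using elim lnA by linarith
    qed
  qed (use ip im iw ie in auto)
  finally show "ln A - V + (\<integral>x. excess (b - e - log_overshoot 1 r A' x) \<partial>GS) - e - drift * comparison_defect b e A \<le> drift * mean_time 1 r A" .
qed

text \<open>The logarithm of \<open>r\<close> plus the perpetuity is compared with its value at the passage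
  time. A larger start stops sooner, so the start \<open>K\<close> is the worst among those in
  \<open>{0..K}\<close>.\<close>

lemma ell_approx:
  assumes "0 \<le> r" "r \<le> K" "K < A"
  shows "\<bar>ell r - (\<integral>x. ln (r + perpetuity_sum x (hit_time 1 r A x)) \<partial>GS)\<bar> \<le> (\<integral>x. ln (perpetuity x / perpetuity_sum x (hit_time 1 K A x)) \<partial>GS)"
proof -
  have A: "r < A" "0 < A" "0 \<le> K" using assms by auto
  have i1: "integrable GS (\<lambda>x. ln (r + perpetuity_sum x (hit_time 1 r A x)))" by (rule integrable_ln_add_perpetuity_sum[OF assms(1) A(1)])
  have i2: "integrable GS (\<lambda>x. ln (r + perpetuity x))" by (rule integrable_ln_add_perpetuity[OF assms(1)])
  have i3: "integrable GS (\<lambda>x. ln (perpetuity x / perpetuity_sum x (hit_time 1 K A x)))" by (rule tail_sum_tendsto_0(2)[OF A(3) assms(3)])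
  have "\<bar>ell r - (\<integral>x. ln (r + perpetuity_sum x (hit_time 1 r A x)) \<partial>GS)\<bar> = \<bar>\<integral>x. ln (r + perpetuity x) - ln (r + perpetuity_sum x (hit_time 1 r A x)) \<partial>GS\<bar>"
    unfolding ell_def using i1 i2 by simp
  also have "\<dots> \<le> (\<integral>x. \<bar>ln (r + perpetuity x) - ln (r + perpetuity_sum x (hit_time 1 r A x))\<bar> \<partial>GS)" by (rule integral_abs_bound)
  also have "\<dots> \<le> (\<integral>x. ln (perpetuity x / perpetuity_sum x (hit_time 1 K A x)) \<partial>GS)"
  proof (rule integral_mono_AE)
    have h: "AE x in GS. \<exists>n. A \<le> sr_path 1 r x n" using assms A by (intro AE_hits) auto
    show "AE x in GS. \<bar>ln (r + perpetuity x) - ln (r + perpetuity_sum x (hit_time 1 r A x))\<bar> \<le> ln (perpetuity x / perpetuity_sum x (hit_time 1 K A x))"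
      using stopped_decomposition[OF A(3) assms(3)] h
    proof (eventually_elim)
      case (elim x)
      then have reg: "regular x" and N: "0 < hit_time 1 K A x" by auto
      note R = regular_perpetuity_sum[OF reg]
      have x: "\<And>i. 0 \<le> x i" using reg by (auto simp: regular_def less_imp_le)
      have hK: "\<exists>n. A \<le> sr_path 1 K x n"
      proof -
        obtain n where "A \<le> sr_path 1 r x n" using elim(2) by blast
        also have "\<dots> \<le> sr_path 1 K x n" by (rule sr_path_mono[OF x assms(2)])
        finally show ?thesis by blast
      qed
      have "hit_time 1 K A x \<le> hit_time 1 r A x"
        by (rule hit_time_mono[OF hK elim(2)]) (auto simp: alive_def intro: le_less_trans[OF sr_path_mono[OF x assms(2)]])
      then have m: "perpetuity_sum x (hit_time 1 K A x) \<le> perpetuity_sum x (hit_time 1 r A x)"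
        unfolding perpetuity_sum_def using R(5) by (intro sum_mono2) (auto intro: less_imp_le)
      let ?w = "perpetuity_sum x (hit_time 1 r A x)" and ?v = "perpetuity_sum x (hit_time 1 K A x)"
      have w: "1 \<le> ?v" "?w \<le> perpetuity x" "1 \<le> ?w" using R(1) R(2)[OF N] m by auto
      have "ln (r + ?w) \<le> ln (r + perpetuity x)" using w assms by (intro ln_mono) auto
      moreover have "ln (r + perpetuity x) - ln (r + ?w) \<le> ln (perpetuity x / ?v)"
      proof -
        have "r * ?v \<le> r * perpetuity x" using w m assms by (intro mult_left_mono) auto
        moreover have "perpetuity x * ?v \<le> perpetuity x * ?w" using w m by (intro mult_left_mono) auto
        ultimately have "(r + perpetuity x) * ?v \<le> perpetuity x * (r + ?w)" by (simp add: algebra_simps)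
        then have "(r + perpetuity x) / (r + ?w) \<le> perpetuity x / ?v" using w assms by (simp add: field_simps)
        then have "ln ((r + perpetuity x) / (r + ?w)) \<le> ln (perpetuity x / ?v)" using w assms by (intro ln_mono) auto
        then show ?thesis using w assms by (subst (asm) ln_div) auto
      qed
      ultimately show ?case by simp
    qed
  qed (use i1 i2 i3 in auto)
  finally show ?thesis .
qed

text \<open>First \<open>b\<close> is taken so large that the excess is near its limit at the distance
  \<open>b\<close> minus a typical overshoot; then \<open>A\<close> is sent to infinity with
  \<open>b\<close> fixed.\<close>

lemma mean_time_uniform_on_compact:
  assumes K: "0 \<le> K" and \<eta>: "0 < \<eta>"
  shows "\<forall>\<^sub>F A in at_top. \<forall>r\<in>{0..K}. \<bar>drift * mean_time 1 r A - (ln A + overshoot_limit - ell r)\<bar> \<le> \<eta>"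
proof -
  let ?C = "overshoot_tail 0"
  define e where "e = min 1 (\<eta> / 6)"
  have e: "0 < e" "e \<le> 1" "e \<le> \<eta> / 6" using \<eta> by (auto simp: e_def)
  define D where "D = ?C + 1"
  have D: "0 \<le> D" using overshoot_tail_nonneg[of 0] by (simp add: D_def)
  have "((\<lambda>b. (2 + 2 * D / (b * (1/2))) * overshoot_tail (b * (1/2) / 2)) \<longlongrightarrow> (2 + 0) * 0) at_top"
  proof (intro tendsto_mult tendsto_add tendsto_const)
    have f: "filterlim (\<lambda>b::real. b * (1/2)) at_top at_top"
      using filterlim_at_top_mult_tendsto_pos[OF tendsto_const _ filterlim_ident, of "1/2"] by simp
    then show "((\<lambda>b. 2 * D / (b * (1/2))) \<longlongrightarrow> 0) at_top"
      by (intro tendsto_divide_0[OF tendsto_const] filterlim_at_top_imp_at_infinity)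
    have "filterlim (\<lambda>b::real. b * (1/2) / 2) at_top at_top"
      using filterlim_at_top_mult_tendsto_pos[OF tendsto_const _ filterlim_ident, of "1/4"] by simp
    then show "((\<lambda>b. overshoot_tail (b * (1/2) / 2)) \<longlongrightarrow> 0) at_top"
      by (rule filterlim_compose[OF overshoot_tail_tendsto_0])
  qed
  then have "\<forall>\<^sub>F b in at_top. (2 + 2 * D / (b * (1/2))) * overshoot_tail (b * (1/2) / 2) < \<eta> / 6"
    using order_tendstoD(2)[of _ 0 at_top "\<eta>/6"] \<eta> by simp
  moreover obtain b1 where b1: "\<And>a. b1 \<le> a \<Longrightarrow> \<bar>excess a - overshoot_limit\<bar> \<le> \<eta> / 6"
  proof -
    have "\<forall>\<^sub>F a in at_top. dist (excess a) overshoot_limit < \<eta> / 6" using tendstoD[OF excess_tendsto, of "\<eta> / 6"] \<eta> by simp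
    then show ?thesis using that by (auto simp: eventually_at_top_linorder dist_real_def intro: less_imp_le)
  qed
  \<comment> \<open>the second condition keeps the remaining distance above \<open>b1\<close> for overshoots up to \<open>b / 2\<close>, also after the loss \<open>c \<le> 1\<close>\<close>
  ultimately have "\<forall>\<^sub>F b in at_top. (2 + 2 * D / (b * (1/2))) * overshoot_tail (b * (1/2) / 2) < \<eta> / 6 \<and> 2 * (\<bar>b1\<bar> + 1) \<le> b"
    by (intro eventually_conj eventually_ge_at_top)
  from eventually_happens'[OF _ this]
  obtain b where tail: "(2 + 2 * D / (b * (1/2))) * overshoot_tail (b * (1/2) / 2) < \<eta> / 6" and bb: "2 * (\<bar>b1\<bar> + 1) \<le> b" by auto
  have b: "0 < b" "1 \<le> b" using bb by auto
  have close: "\<bar>(\<integral>x. excess (b - c - log_overshoot 1 r A x) \<partial>GS) - overshoot_limit\<bar> \<le> \<eta> / 3"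
    if r: "0 \<le> r" "r < A" "1 \<le> A" and c: "0 \<le> c" "c \<le> 1" for r A c
  proof -
    have i: "integrable GS (\<lambda>x. excess (b - c - log_overshoot 1 r A x))" by (rule integrable_excess_overshoot[OF r])
    have "\<bar>\<integral>x. excess (b - c - log_overshoot 1 r A x) - overshoot_limit \<partial>GS\<bar> \<le> \<eta> / 6 + (2 + 2 * D / (b * (1/2))) * overshoot_tail (b * (1/2) / 2)"
    proof (rule overshoot_split_expectation[OF r, where h="\<lambda>k. excess (b - c - k) - overshoot_limit"])
      fix k assume "0 \<le> k" "k \<le> b * (1/2)"
      moreover have "\<bar>b1\<bar> + 1 \<le> b * (1/2)" using bb by simp
      moreover have "b1 \<le> \<bar>b1\<bar>" by simp
      ultimately show "\<bar>excess (b - c - k) - overshoot_limit\<bar> \<le> \<eta> / 6" using c by (intro b1) linarith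
    next
      fix k :: real assume k: "0 \<le> k"
      show "\<bar>excess (b - c - k) - overshoot_limit\<bar> \<le> D + k"
        using excess_nonneg[of "b - c - k"] excess_le[of "b - c - k"] overshoot_limit_bounds k c b unfolding D_def by linarith
    qed (use i b D \<eta> in auto)
    also have "\<dots> \<le> \<eta> / 3" using tail by linarith
    finally show ?thesis using i by simp
  qed
  have F: "filterlim (\<lambda>A. A * exp (- b)) at_top at_top"
    by (rule filterlim_at_top_mult_tendsto_pos[OF tendsto_const _ filterlim_ident]) simp
  have ev1: "\<forall>\<^sub>F A in at_top. K + 1 < A * exp (- b)" using F unfolding filterlim_at_top_dense by blast
  have "((\<lambda>A. drift * comparison_defect b e A) \<longlongrightarrow> drift * 0) at_top" by (intro tendsto_intros comparison_defect_tendsto_0 e)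
  then have ev2: "\<forall>\<^sub>F A in at_top. drift * comparison_defect b e A < \<eta> / 6"
    using order_tendstoD(2)[of _ "drift * 0" at_top "\<eta>/6"] \<eta> by simp
  have ev3: "\<forall>\<^sub>F A in at_top. (\<integral>x. ln (perpetuity x / perpetuity_sum x (hit_time 1 K (A * exp (- b)) x)) \<partial>GS) < \<eta> / 6"
    using order_tendstoD(2)[OF filterlim_compose[OF tail_sum_tendsto_0(1)[OF K] F], of "\<eta>/6"] \<eta> by simp
  show ?thesis using ev1 ev2 ev3
  proof eventually_elim
    case (elim A)
    show ?case
    proof
      fix r assume "r \<in> {0..K}"
      then have r: "0 \<le> r" "r \<le> K" by auto
      let ?A = "A * exp (- b)"
      have rA: "r < ?A" "1 \<le> ?A" "K < ?A" using r elim(1) K by auto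
      have z: "\<bar>(\<integral>x. excess (b - log_overshoot 1 r ?A x) \<partial>GS) - overshoot_limit\<bar> \<le> \<eta> / 3"
        using close[OF r(1) rA(1,2), of 0] by simp
      have z': "\<bar>(\<integral>x. excess (b - e - log_overshoot 1 r ?A x) \<partial>GS) - overshoot_limit\<bar> \<le> \<eta> / 3"
        using close[OF r(1) rA(1,2), of e] e by simp
      show "\<bar>drift * mean_time 1 r A - (ln A + overshoot_limit - ell r)\<bar> \<le> \<eta>"
        using two_stage_bounds[OF r(1) rA(1,2) b(1) e(1)] z z' e elim(2,3) ell_approx[OF r rA(3)] by linarith
    qed
  qed
qed

text \<open>The weight \<open>1 + sqrt r\<close> has a bounded mean along the statistic before the change,
  uniformly in the level. It lets the bounded error of the global estimate be absorbed for starts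
  beyond \<open>K\<close>.\<close>

theorem mean_time_expansion:
  assumes "0 < \<eta>"
  shows "\<forall>\<^sub>F A in at_top. \<forall>r. 0 \<le> r \<and> r < A \<longrightarrow> \<bar>drift * mean_time 1 r A - (ln A + overshoot_limit - ell r)\<bar> \<le> \<eta> * (1 + sqrt r)"
proof -
  define B where "B = overshoot_tail 0 + (\<integral>x. ln (1 + perpetuity x) \<partial>GS)"
  have "0 \<le> B"
    using mean_time_global_bound[of 0 1] unfolding B_def by linarith
  \<comment> \<open>beyond \<open>K\<close> the global bound \<open>B\<close> is at most \<open>\<eta> * sqrt r\<close>\<close>
  define K where "K = (B / \<eta>)\<^sup>2"
  have K: "0 \<le> K" by (simp add: K_def)
  show ?thesis using mean_time_uniform_on_compact[OF K assms] eventually_ge_at_top[of 1]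
  proof eventually_elim
    case (elim A)
    show ?case
    proof (intro allI impI, elim conjE)
      fix r assume r: "0 \<le> r" "r < A"
      show "\<bar>drift * mean_time 1 r A - (ln A + overshoot_limit - ell r)\<bar> \<le> \<eta> * (1 + sqrt r)"
      proof (cases "r \<le> K")
        case True
        then have "\<bar>drift * mean_time 1 r A - (ln A + overshoot_limit - ell r)\<bar> \<le> \<eta> * 1" using elim r by auto
        also have "\<dots> \<le> \<eta> * (1 + sqrt r)" using assms r by (intro mult_left_mono) auto
        finally show ?thesis .
      next
        case False
        have "\<bar>drift * mean_time 1 r A - (ln A + overshoot_limit - ell r)\<bar> \<le> B"
          unfolding B_def by (rule mean_time_global_bound[OF r elim(2)])
        also have "B = \<eta> * sqrt K" using \<open>0 \<le> B\<close> assms by (simp add: K_def)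
        also have "\<dots> \<le> \<eta> * (1 + sqrt r)" 
        proof (intro mult_left_mono)
          have "sqrt K \<le> sqrt r" using False by simp
          then show "sqrt K \<le> 1 + sqrt r" by linarith
        qed (use assms in simp)
        finally show ?thesis .
      qed
    qed
  qed
qed

end


section \<open>Averages along the statistic before the alarm\<close>

lemma ln_one_plus_squared_le: "0 \<le> x \<Longrightarrow> (ln (1 + x))\<^sup>2 \<le> 16 * sqrt x" for x :: real
proof -
  assume x: "0 \<le> x"
  have "1 + x \<le> (1 + sqrt x)\<^sup>2" using x by (simp add: power2_eq_square algebra_simps)
  then have "ln (1 + x) \<le> ln ((1 + sqrt x)\<^sup>2)" using x by (intro ln_mono) auto
  also have "\<dots> = 2 * ln (1 + sqrt x)" using x by (subst ln_realpow) (auto intro: add_pos_nonneg)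
  also have "\<dots> \<le> 4 * sqrt (sqrt x)" using ln_one_plus_le_sqrt[of "sqrt x"] x by simp
  finally have "(ln (1 + x))\<^sup>2 \<le> (4 * sqrt (sqrt x))\<^sup>2" using x by (intro power_mono) auto
  then show ?thesis using x by (simp add: power_mult_distrib)
qed

context likelihood_walk
begin

lemma borel_measurable_F: "h \<in> borel_measurable borel \<Longrightarrow> h \<in> borel_measurable F"
  using measurable_cong_sets[OF sets_F refl] by blast

definition survival :: "real \<Rightarrow> nat \<Rightarrow> real" where "survival A n = measure FS {x. alive 1 0 A x n}"

lemma survival_bounds: "0 \<le> survival A n" "survival A n \<le> 1" by (auto simp: survival_def)

lemma survival_antimono: "m \<le> n \<Longrightarrow> survival A n \<le> survival A m"
  unfolding survival_def by (intro FS.P.finite_measure_mono) (auto intro: alive_antimono)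

lemma F_ge_1_pos: "0 < measure F {1..}"
proof (rule ccontr)
  assume "\<not> ?thesis"
  then have "measure F {1..} = 0" by (simp add: zero_less_measure_iff)
  then have "{1..} \<in> null_sets F" by (auto simp: null_sets_def F.emeasure_eq_measure sets_F)
  then have ae: "AE x in F. x < 1" using AE_not_in by (auto elim: eventually_mono dest: AE_not_in)
  have i: "integrable F (\<lambda>x. 1 - x)" using integrable_F_id by auto
  have "(\<integral>x. 1 - x \<partial>F) = 0" using integrable_F_id integral_F_id by simp
  then have "AE x in F. 1 - x = 0"
    using i ae by (subst (asm) integral_nonneg_eq_0_iff_AE) (auto elim: eventually_mono)
  with ae have "AE x in F. False" by eventually_elim simp
  then show False using F.AE_False by simp
qed

lemma sr_path_ge_run:
  assumes "\<And>i. i < m \<Longrightarrow> 1 \<le> x i" "0 \<le> r"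
  shows "r + real m \<le> sr_path 1 r x m"
  using assms(1)
proof (induction m)
  case (Suc m)
  then have IH: "r + real m \<le> sr_path 1 r x m" and x: "1 \<le> x m" by auto
  have "(1 + sr_path 1 r x m) * 1 \<le> (1 + sr_path 1 r x m) * x m" using IH x assms(2) by (intro mult_left_mono) auto
  then show ?case using IH by simp
qed simp

text \<open>From any start, a run of at least \<open>A\<close> ratios that are \<open>1\<close> or more raises
  the statistic to \<open>A\<close>.\<close>

lemma survival_geometric:
  assumes "0 < A"
  obtains m \<theta> where "0 \<le> \<theta>" "\<theta> < 1" "\<And>n. survival A (n + m) \<le> \<theta> * survival A n"
proof -
  \<comment> \<open>the length of a run that reaches \<open>A\<close> from \<open>0\<close>\<close>
  define m where "m = nat \<lceil>A\<rceil>"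
  define E where "E = {y. \<forall>i<m. (1::real) \<le> y i}"
  have E: "E \<in> sets FS"
  proof -
    have "{y \<in> space FS. \<forall>i<m. (1::real) \<le> y i} \<in> sets FS" by measurable
    then show ?thesis by (simp add: E_def)
  qed
  have Ec: "- E \<in> sets FS" using sets.compl_sets[OF E] by (simp add: Compl_eq_Diff_UNIV)
  have "emeasure FS E = (\<Prod>i\<in>{..<m}. emeasure F {1..})"
    using FS.emeasure_PiM_Collect[of "{..<m}" "\<lambda>_. {1..}"] by (simp add: E_def sets_F Ball_def)
  then have "measure FS E = (measure F {1..}) ^ m"
    by (simp add: FS.P.emeasure_eq_measure F.emeasure_eq_measure ennreal_power)
  then have q: "0 < measure FS E" using F_ge_1_pos by simp
  let ?\<theta> = "1 - measure FS E"
  have c: "measure FS (- E) = ?\<theta>" using FS.P.prob_compl[OF E] by (simp add: Compl_eq_Diff_UNIV)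
  have "survival A (n + m) \<le> ?\<theta> * survival A n" for n
  proof -
    have "emeasure FS {x. alive 1 0 A x (n + m)} = (\<integral>\<^sup>+x. indicator {x. alive 1 0 A x (n + m)} x \<partial>FS)" by simp
    also have "\<dots> = (\<integral>\<^sup>+x. \<integral>\<^sup>+y. indicator {x. alive 1 0 A x (n + m)} (comb_seq n x y) \<partial>FS \<partial>FS)"
      by (rule FS.nn_integral_comb_seq) measurable
    also have "\<dots> \<le> (\<integral>\<^sup>+x. \<integral>\<^sup>+y. indicator {x. alive 1 0 A x n} x * indicator (- E) y \<partial>FS \<partial>FS)"
      using FS_nonneg
    proof (intro nn_integral_mono_AE, eventually_elim)
      case (elim x)
      show ?case
      proof (intro nn_integral_mono)
        fix y
        show "indicator {x. alive 1 0 A x (n + m)} (comb_seq n x y) \<le> indicator {x. alive 1 0 A x n} x * (indicator (- E) y :: ennreal)"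
        proof (cases "alive 1 0 A (comb_seq n x y) (n + m)")
          case True
          then have a: "alive 1 0 A x n" "alive 1 (sr_path 1 0 x n) A y m" by (auto simp: alive_comb_seq_add)
          have "y \<notin> E"
          proof
            assume "y \<in> E"
            have "0 \<le> sr_path 1 0 x n" using elim by (intro sr_path_nonneg) auto
            then have "real m \<le> sr_path 1 (sr_path 1 0 x n) y m"
              using sr_path_ge_run[of m y "sr_path 1 0 x n"] \<open>y \<in> E\<close> by (auto simp: E_def)
            moreover have "sr_path 1 (sr_path 1 0 x n) y m < A" using a(2) by (auto simp: alive_def)
            ultimately show False unfolding m_def by linarith
          qed
          then show ?thesis using a by (simp add: indicator_def)
        qed simp
      qed
    qed
    also have "\<dots> = emeasure FS {x. alive 1 0 A x n} * emeasure FS (- E)"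
      using Ec by (simp add: nn_integral_cmult nn_integral_multc)
    finally show ?thesis
      unfolding survival_def using c q measure_nonneg[of FS E] FS.P.prob_le_1[of E]
      by (simp add: FS.P.emeasure_eq_measure ennreal_mult'[symmetric] mult.commute)
  qed
  moreover have "0 \<le> ?\<theta>" "?\<theta> < 1" using q FS.P.prob_le_1[of E] by auto
  ultimately show ?thesis by (intro that[of ?\<theta> m])
qed

lemma summable_survival:
  assumes "0 < A" shows "summable (survival A)"
proof -
  obtain m \<theta> where t: "0 \<le> \<theta>" "\<theta> < 1" "\<And>n. survival A (n + m) \<le> \<theta> * survival A n"
    using survival_geometric[OF assms] by metis
  show ?thesis
  proof (rule summableI_nonneg_bounded)
    fix N
    let ?S = "sum (survival A) {..<N}"
    have "?S \<le> sum (survival A) {..<N + m}" by (intro sum_mono2) (auto simp: survival_bounds)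
    also have "\<dots> = sum (survival A) {..<m} + (\<Sum>n<N. survival A (n + m))"
      by (induction N) (auto simp: algebra_simps)
    also have "\<dots> \<le> real m + \<theta> * ?S"
    proof (rule add_mono)
      have "sum (survival A) {..<m} \<le> (\<Sum>i<m. 1)" by (intro sum_mono) (simp add: survival_bounds)
      then show "sum (survival A) {..<m} \<le> real m" by simp
      show "(\<Sum>n<N. survival A (n + m)) \<le> \<theta> * ?S" unfolding sum_distrib_left by (intro sum_mono t)
    qed
    \<comment> \<open>shifting the sum by \<open>m\<close> loses at most \<open>m\<close> and multiplies it by at most \<open>\<theta>\<close>, which bounds it by itself\<close>
    finally have "(1 - \<theta>) * ?S \<le> real m" by (simp add: algebra_simps)
    then show "?S \<le> real m / (1 - \<theta>)" using t by (simp add: field_simps)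
  qed (simp add: survival_bounds)
qed

text \<open>The mean time to a false alarm.\<close>

definition run_length :: "real \<Rightarrow> real" where "run_length A = (\<Sum>n. survival A n)"

lemma run_length_ge:
  assumes "0 < A" shows "real k * survival A k \<le> run_length A"
proof -
  have "(\<Sum>n<k. survival A k) \<le> (\<Sum>n<k. survival A n)" by (intro sum_mono survival_antimono) auto
  also have "\<dots> \<le> run_length A" unfolding run_length_def using summable_survival[OF assms] by (intro sum_le_suminf) (auto simp: survival_bounds)
  finally show ?thesis by simp
qed

lemma run_length_at_top: "filterlim run_length at_top at_top"
  unfolding filterlim_at_top
proof
  fix B :: real
  define k where "k = nat \<lceil>2 * \<bar>B\<bar>\<rceil>"
  have "((\<lambda>A. \<integral>x. indicator {x. alive 1 0 A x k} x \<partial>FS) \<longlongrightarrow> (\<integral>x. (1::real) \<partial>FS)) at_top"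
  proof (rule integral_dominated_convergence_at_top[where w="\<lambda>_. 1"])
    show "AE x in FS. ((\<lambda>A. indicator {x. alive 1 0 A x k} x :: real) \<longlongrightarrow> 1) at_top"
    proof (rule AE_I2, rule tendsto_eventually)
      fix x :: "nat \<Rightarrow> real"
      have "\<forall>\<^sub>F A in at_top. \<forall>j\<in>{..k}. sr_path 1 0 x j < A"
        by (intro eventually_ball_finite ballI eventually_gt_at_top) simp
      then show "\<forall>\<^sub>F A in at_top. indicator {x. alive 1 0 A x k} x = (1::real)"
        by eventually_elim (simp add: alive_def)
    qed
  qed (auto simp: indicator_def)
  then have "((\<lambda>A. survival A k) \<longlongrightarrow> 1) at_top" by (simp add: survival_def)
  then have "\<forall>\<^sub>F A in at_top. 1/2 < survival A k" by (rule order_tendstoD) simp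
  then show "\<forall>\<^sub>F A in at_top. B \<le> run_length A" using eventually_gt_at_top[of 0]
  proof eventually_elim
    case (elim A)
    have "B \<le> real k * (1/2)" unfolding k_def by linarith
    also have "\<dots> \<le> real k * survival A k" using elim by (intro mult_left_mono) auto
    also have "\<dots> \<le> run_length A" by (rule run_length_ge[OF elim(2)])
    finally show ?case .
  qed
qed

lemma run_length_pos: "0 < A \<Longrightarrow> 1 \<le> run_length A"
proof -
  assume A: "0 < A"
  have "survival A 0 = 1" using A by (simp add: survival_def alive_def)
  moreover have "(\<Sum>n<1. survival A n) \<le> run_length A"
    unfolding run_length_def using summable_survival[OF A] by (intro sum_le_suminf) (auto simp: survival_bounds)
  ultimately show ?thesis by simp
qed

definition sqrt_bound :: real where "sqrt_bound = \<rho> / (1 - \<rho>)"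

lemma sqrt_bound_nonneg: "0 \<le> sqrt_bound" using \<rho>_nonneg \<rho>_less_1 by (simp add: sqrt_bound_def)
lemma sqrt_bound_eq: "\<rho> * (1 + sqrt_bound) = sqrt_bound" using \<rho>_less_1 by (simp add: sqrt_bound_def field_simps)

text \<open>The inequality \<open>sqrt (1 + r) \<le> 1 + sqrt r\<close> and the factor \<open>\<rho>\<close>
  make the square root a Lyapunov function for the statistic before the change.\<close>

lemma nn_sqrt_step:
  assumes [measurable]: "Measurable.pred FS Q" and det: "\<And>x y. Q (comb_seq n x y) \<longleftrightarrow> Q x"
  shows "(\<integral>\<^sup>+x. indicator {x. Q x} x * ennreal (sqrt (sr_path 1 0 x (Suc n))) \<partial>FS)
     \<le> ennreal \<rho> * (emeasure FS {x. Q x} + (\<integral>\<^sup>+x. indicator {x. Q x} x * ennreal (sqrt (sr_path 1 0 x n)) \<partial>FS))"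
proof -
  have [measurable]: "{x. Q x} \<in> sets FS" using assms(1) unfolding pred_def by simp
  have "(\<integral>\<^sup>+x. indicator {x. Q x} x * ennreal (sqrt (sr_path 1 0 x (Suc n))) \<partial>FS)
     = (\<integral>\<^sup>+x. \<integral>\<^sup>+y. indicator {x. Q x} x * ennreal (sqrt ((1 + sr_path 1 0 x n) * y 0)) \<partial>FS \<partial>FS)"
    by (subst FS.nn_integral_comb_seq[of _ n]) (auto simp: det indicator_def sr_path_comb_seq_le comb_seq_def)
  also have "\<dots> \<le> (\<integral>\<^sup>+x. \<integral>\<^sup>+y. (indicator {x. Q x} x * (1 + ennreal (sqrt (sr_path 1 0 x n)))) * ennreal (sqrt (y 0)) \<partial>FS \<partial>FS)"
    using FS_nonneg
  proof (intro nn_integral_mono_AE, eventually_elim)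
    case (elim x)
    have s: "0 \<le> sr_path 1 0 x n" using elim by (intro sr_path_nonneg) auto
    have l: "sqrt (1 + sr_path 1 0 x n) \<le> 1 + sqrt (sr_path 1 0 x n)" using sqrt_add_le_add_sqrt[of 1 "sr_path 1 0 x n"] s by simp
    show ?case using FS_nonneg
    proof (intro nn_integral_mono_AE, eventually_elim)
      case (elim y)
      have "sqrt ((1 + sr_path 1 0 x n) * y 0) \<le> (1 + sqrt (sr_path 1 0 x n)) * sqrt (y 0)"
        unfolding real_sqrt_mult using l elim by (intro mult_right_mono) auto
      then have "ennreal (sqrt ((1 + sr_path 1 0 x n) * y 0)) \<le> ennreal ((1 + sqrt (sr_path 1 0 x n)) * sqrt (y 0))" by (rule ennreal_leI)
      also have "\<dots> = (1 + ennreal (sqrt (sr_path 1 0 x n))) * ennreal (sqrt (y 0))"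
        using s elim by (subst ennreal_mult) (auto simp: ennreal_plus)
      finally show ?case by (auto simp: indicator_def)
    qed
  qed
  also have "\<dots> = (\<integral>\<^sup>+x. indicator {x. Q x} x * (1 + ennreal (sqrt (sr_path 1 0 x n))) \<partial>FS) * ennreal \<rho>"
    using FS.nn_integral_component[of "\<lambda>y. ennreal (sqrt y)" 0] nn_integral_F_sqrt
    by (simp add: nn_integral_cmult nn_integral_multc borel_measurable_F)
  also have "\<dots> = ennreal \<rho> * (emeasure FS {x. Q x} + (\<integral>\<^sup>+x. indicator {x. Q x} x * ennreal (sqrt (sr_path 1 0 x n)) \<partial>FS))"
    by (simp add: distrib_left nn_integral_add mult.commute)
  finally show ?thesis .
qed

lemma nn_sqrt_bound: "(\<integral>\<^sup>+x. ennreal (sqrt (sr_path 1 0 x n)) \<partial>FS) \<le> ennreal sqrt_bound"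
proof (induction n)
  case (Suc n)
  have "(\<integral>\<^sup>+x. ennreal (sqrt (sr_path 1 0 x (Suc n))) \<partial>FS) \<le> ennreal \<rho> * (1 + (\<integral>\<^sup>+x. ennreal (sqrt (sr_path 1 0 x n)) \<partial>FS))"
    using nn_sqrt_step[of "\<lambda>_. True" n] by simp
  also have "\<dots> \<le> ennreal \<rho> * (1 + ennreal sqrt_bound)" by (intro mult_left_mono add_left_mono Suc) auto
  also have "\<dots> = ennreal (\<rho> * (1 + sqrt_bound))" using \<rho>_nonneg sqrt_bound_nonneg by (subst ennreal_mult) (auto simp: ennreal_plus)
  finally show ?case unfolding sqrt_bound_eq .
qed (simp add: sqrt_bound_nonneg)

lemma FS_sr_path_nonneg: "AE x in FS. 0 \<le> sr_path 1 0 x n"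
  using FS_nonneg by eventually_elim (intro sr_path_nonneg, auto)

lemma integrable_sqrt_sr_path: "integrable FS (\<lambda>x. sqrt (sr_path 1 0 x n))" and integral_sqrt_sr_path: "(\<integral>x. sqrt (sr_path 1 0 x n) \<partial>FS) \<le> sqrt_bound"
proof -
  show i: "integrable FS (\<lambda>x. sqrt (sr_path 1 0 x n))"
    using nn_sqrt_bound[of n] FS_sr_path_nonneg[of n]
    by (intro integrableI_nonneg) (auto elim: eventually_mono simp: top_unique less_top[symmetric])
  show "(\<integral>x. sqrt (sr_path 1 0 x n) \<partial>FS) \<le> sqrt_bound"
    using nn_sqrt_bound[of n] FS_sr_path_nonneg[of n] sqrt_bound_nonneg
    by (subst (asm) nn_integral_eq_integral[OF i]) (auto elim: eventually_mono)
qed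

text \<open>Divided by \<open>run_length A\<close> and summed over \<open>n\<close>, this is the mean of the
  square root under the normalized occupation measure of the statistic up to the alarm.\<close>

definition stopped_sqrt :: "real \<Rightarrow> nat \<Rightarrow> real" where
  "stopped_sqrt A n = (\<integral>x. indicator {x. alive 1 0 A x n} x * sqrt (sr_path 1 0 x n) \<partial>FS)"

lemma integrable_alive_F:
  fixes h :: "_ \<Rightarrow> real"
  assumes "integrable FS h"
  shows "integrable FS (\<lambda>x. indicator {x. alive 1 0 A x n} x * h x)"
  using integrable_real_mult_indicator[OF alive_sets_F assms] by (simp add: mult.commute)

lemma stopped_sqrt_nonneg: "0 \<le> stopped_sqrt A n"
  unfolding stopped_sqrt_def using FS_sr_path_nonneg[of n] by (intro integral_nonneg_AE) (auto elim: eventually_mono)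

lemma stopped_sqrt_nn: "(\<integral>\<^sup>+x. indicator {x. alive 1 0 A x n} x * ennreal (sqrt (sr_path 1 0 x n)) \<partial>FS) = ennreal (stopped_sqrt A n)"
proof -
  have "(\<integral>\<^sup>+x. indicator {x. alive 1 0 A x n} x * ennreal (sqrt (sr_path 1 0 x n)) \<partial>FS)
    = (\<integral>\<^sup>+x. ennreal (indicator {x. alive 1 0 A x n} x * sqrt (sr_path 1 0 x n)) \<partial>FS)"
    by (intro nn_integral_cong) (auto simp: indicator_def)
  then show ?thesis unfolding stopped_sqrt_def using FS_sr_path_nonneg[of n]
    by (subst nn_integral_eq_integral[OF integrable_alive_F[OF integrable_sqrt_sr_path], symmetric]) (auto elim: eventually_mono)
qed

lemma stopped_sqrt_step: "stopped_sqrt A (Suc n) \<le> \<rho> * (survival A n + stopped_sqrt A n)"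
proof -
  have "ennreal (stopped_sqrt A (Suc n)) \<le> (\<integral>\<^sup>+x. indicator {x. alive 1 0 A x n} x * ennreal (sqrt (sr_path 1 0 x (Suc n))) \<partial>FS)"
    unfolding stopped_sqrt_nn[symmetric]
    by (intro nn_integral_mono mult_right_mono) (auto simp: indicator_def intro: alive_antimono[of _ _ _ _ "Suc n"])
  also have "\<dots> \<le> ennreal \<rho> * (emeasure FS {x. alive 1 0 A x n} + (\<integral>\<^sup>+x. indicator {x. alive 1 0 A x n} x * ennreal (sqrt (sr_path 1 0 x n)) \<partial>FS))"
    by (rule nn_sqrt_step) (auto simp: alive_comb_seq_le)
  also have "\<dots> = ennreal (\<rho> * (survival A n + stopped_sqrt A n))"
    using \<rho>_nonneg stopped_sqrt_nonneg[of A n] by (simp add: stopped_sqrt_nn survival_def FS.P.emeasure_eq_measure ennreal_mult ennreal_plus)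
  finally show ?thesis using \<rho>_nonneg stopped_sqrt_nonneg[of A n] survival_bounds[of A n] by (subst (asm) ennreal_le_iff) auto
qed

lemma stopped_sqrt_0: "stopped_sqrt A 0 = 0" by (simp add: stopped_sqrt_def)

lemma summable_stopped_sqrt: "0 < A \<Longrightarrow> summable (stopped_sqrt A)" and sum_stopped_sqrt: "0 < A \<Longrightarrow> (\<Sum>n. stopped_sqrt A n) \<le> sqrt_bound * run_length A"
proof -
  assume A: "0 < A"
  have b: "(\<Sum>n<N. stopped_sqrt A n) \<le> sqrt_bound * run_length A" for N
  proof -
    let ?S = "(\<Sum>n<N. stopped_sqrt A n)"
    have "?S \<le> (\<Sum>n<Suc N. stopped_sqrt A n)" using stopped_sqrt_nonneg by simp
    also have "\<dots> = (\<Sum>n<N. stopped_sqrt A (Suc n))" by (subst sum.lessThan_Suc_shift) (simp add: stopped_sqrt_0)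
    also have "\<dots> \<le> (\<Sum>n<N. \<rho> * (survival A n + stopped_sqrt A n))" by (intro sum_mono stopped_sqrt_step)
    also have "\<dots> = \<rho> * ((\<Sum>n<N. survival A n) + ?S)" by (simp add: sum.distrib flip: sum_distrib_left)
    also have "\<dots> \<le> \<rho> * (run_length A + ?S)"
      unfolding run_length_def using summable_survival[OF A] \<rho>_nonneg
      by (intro mult_left_mono add_right_mono sum_le_suminf) (auto simp: survival_bounds)
    finally have "(1 - \<rho>) * ?S \<le> \<rho> * run_length A" by (simp add: algebra_simps)
    then show ?thesis using \<rho>_less_1 by (simp add: sqrt_bound_def field_simps)
  qed
  show s: "summable (stopped_sqrt A)" by (rule summableI_nonneg_bounded[OF stopped_sqrt_nonneg b])
  show "(\<Sum>n. stopped_sqrt A n) \<le> sqrt_bound * run_length A" by (rule suminf_le_const[OF s b])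
qed

text \<open>Continued by a constant to the negative half line, so as to be continuous everywhere.\<close>

definition ell_pos :: "real \<Rightarrow> real" where "ell_pos r = ell (max 0 r)"

lemma ell_pos_nonneg: "0 \<le> ell_pos r" by (simp add: ell_pos_def ell_nonneg)

lemma ell_pos_lipschitz: "\<bar>ell_pos r - ell_pos s\<bar> \<le> \<bar>r - s\<bar>"
proof -
  have main: "\<bar>ell_pos r - ell_pos s\<bar> \<le> s - r" if "r \<le> s" for r s
  proof -
    have "max 0 s = max 0 r + (max 0 s - max 0 r)" by simp
    moreover have d: "0 \<le> max 0 s - max 0 r" "max 0 s - max 0 r \<le> s - r" using that by auto
    ultimately have "ell_pos r \<le> ell_pos s" "ell_pos s \<le> ell_pos r + ln (1 + (max 0 s - max 0 r))"
      unfolding ell_pos_def using ell_increment[of "max 0 r" "max 0 s - max 0 r"] by auto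
    moreover have "ln (1 + (max 0 s - max 0 r)) \<le> max 0 s - max 0 r" using d by (intro ln_add_one_self_le_self) auto
    ultimately show ?thesis using d by linarith
  qed
  show ?thesis using main[of r s] main[of s r] by (cases "r \<le> s") auto
qed

lemma ell_pos_continuous: "continuous_on UNIV ell_pos"
  by (intro lipschitz_on_continuous_on[of 1] lipschitz_onI) (auto simp: dist_real_def ell_pos_lipschitz)

lemma measurable_ell_pos[measurable]: "ell_pos \<in> borel_measurable borel"
  by (rule borel_measurable_continuous_onI[OF ell_pos_continuous])

lemma ell_pos_add_le: "0 \<le> r \<Longrightarrow> 0 \<le> s \<Longrightarrow> \<bar>ell_pos (r + s) - ell_pos r\<bar> \<le> 2 * sqrt s"
  using ell_increment[of r s] ln_one_plus_le_sqrt[of s] by (simp add: ell_pos_def)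

lemma ell_pos_le: "0 \<le> r \<Longrightarrow> ell_pos r \<le> ell 0 + 2 * sqrt r"
  using ell_pos_add_le[of 0 r] by (simp add: ell_pos_def)

definition ell_sq_bound :: real where "ell_sq_bound = 2 * (ell 0)\<^sup>2 + 32"

lemma ell_sq_bound_pos: "0 < ell_sq_bound" by (simp add: ell_sq_bound_def add_nonneg_pos)

lemma ell_pos_squared_le: assumes "0 \<le> r" shows "(ell_pos r)\<^sup>2 \<le> ell_sq_bound * (1 + sqrt r)"
proof -
  have "ell_pos r \<le> ell 0 + ln (1 + r)" using ell_increment[of 0 r] assms by (simp add: ell_pos_def)
  then have "(ell_pos r)\<^sup>2 \<le> (ell 0 + ln (1 + r))\<^sup>2" using ell_pos_nonneg by (intro power_mono) auto
  also have "\<dots> \<le> 2 * (ell 0)\<^sup>2 + 2 * (ln (1 + r))\<^sup>2"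
  proof -
    have "0 \<le> (ell 0 - ln (1 + r))\<^sup>2" by simp
    then show ?thesis by (simp add: power2_eq_square algebra_simps)
  qed
  also have "\<dots> \<le> 2 * (ell 0)\<^sup>2 + 32 * sqrt r" using ln_one_plus_squared_le[OF assms] by simp
  also have "\<dots> \<le> ell_sq_bound * (1 + sqrt r)" using assms by (simp add: ell_sq_bound_def algebra_simps)
  finally show ?thesis .
qed

lemma integrable_ell_pos_sr_path: "integrable FS (\<lambda>x. ell_pos (sr_path 1 0 x n))"
proof (rule Bochner_Integration.integrable_bound)
  show "integrable FS (\<lambda>x. ell 0 + 2 * sqrt (sr_path 1 0 x n))" using integrable_sqrt_sr_path by auto
  show "AE x in FS. norm (ell_pos (sr_path 1 0 x n)) \<le> norm (ell 0 + 2 * sqrt (sr_path 1 0 x n))"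
    using FS_sr_path_nonneg[of n]
  proof eventually_elim
    case (elim x) then show ?case using ell_pos_le[OF elim] ell_pos_nonneg[of "sr_path 1 0 x n"] by simp
  qed
qed measurable

definition mean_ell :: "nat \<Rightarrow> real" where "mean_ell k = (\<integral>x. ell_pos (sr_path 1 0 x k) \<partial>FS)"

lemma mean_ell_bounds: "0 \<le> mean_ell k" "mean_ell k \<le> ell 0 + 2 * sqrt_bound"
proof -
  show "0 \<le> mean_ell k" unfolding mean_ell_def by (intro Bochner_Integration.integral_nonneg ell_pos_nonneg)
  have "mean_ell k \<le> (\<integral>x. ell 0 + 2 * sqrt (sr_path 1 0 x k) \<partial>FS)"
    unfolding mean_ell_def using FS_sr_path_nonneg[of k] integrable_sqrt_sr_path
    by (intro integral_mono_AE integrable_ell_pos_sr_path) (auto elim!: eventually_mono intro: ell_pos_le)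
  also have "\<dots> \<le> ell 0 + 2 * sqrt_bound" using integral_sqrt_sr_path[of k] integrable_sqrt_sr_path by simp
  finally show "mean_ell k \<le> ell 0 + 2 * sqrt_bound" .
qed

end


context likelihood_walk
begin

lemma integrable_sqrt_lr_prod: "integrable FS (\<lambda>y. sqrt (lr_prod y k))" and integral_sqrt_lr_prod: "(\<integral>y. sqrt (lr_prod y k) \<partial>FS) = \<rho> ^ k"
proof -
  have p: "AE y in FS. 0 \<le> sqrt (lr_prod y k)"
    using FS_nonneg by eventually_elim (simp add: lr_prod_nonneg)
  show "integrable FS (\<lambda>y. sqrt (lr_prod y k))"
    using nn_integral_FS_lr_prod[of k] p by (intro integrableI_nonneg) auto
  show "(\<integral>y. sqrt (lr_prod y k) \<partial>FS) = \<rho> ^ k"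
    using nn_integral_FS_lr_prod[of k] p \<rho>_nonneg by (subst integral_eq_nn_integral) auto
qed

text \<open>Exponential forgetting of the start.\<close>

lemma ell_pos_restart_bound:
  assumes r: "0 \<le> r"
  shows "integrable FS (\<lambda>y. ell_pos (sr_path 1 r y k))" "\<bar>(\<integral>y. ell_pos (sr_path 1 r y k) \<partial>FS) - mean_ell k\<bar> \<le> 2 * \<rho> ^ k * sqrt r"
proof -
  have b: "AE y in FS. \<bar>ell_pos (sr_path 1 r y k) - ell_pos (sr_path 1 0 y k)\<bar> \<le> 2 * sqrt r * sqrt (lr_prod y k)"
    using FS_nonneg
  proof eventually_elim
    case (elim y)
    have "0 \<le> sr_path 1 0 y k" "0 \<le> lr_prod y k" using elim by (auto intro!: sr_path_nonneg lr_prod_nonneg)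
    then show ?case using ell_pos_add_le[of "sr_path 1 0 y k" "r * lr_prod y k"] r
      by (simp add: sr_path_affine[of 1 r] real_sqrt_mult)
  qed
  have d: "integrable FS (\<lambda>y. ell_pos (sr_path 1 r y k) - ell_pos (sr_path 1 0 y k))"
    by (rule Bochner_Integration.integrable_bound[of _ "\<lambda>y. 2 * sqrt r * sqrt (lr_prod y k)"])
      (use integrable_sqrt_lr_prod b r in \<open>auto elim!: eventually_mono\<close>)
  from Bochner_Integration.integrable_add[OF d integrable_ell_pos_sr_path[of k]]
  show i: "integrable FS (\<lambda>y. ell_pos (sr_path 1 r y k))" by simp
  have "\<bar>(\<integral>y. ell_pos (sr_path 1 r y k) \<partial>FS) - mean_ell k\<bar> = \<bar>\<integral>y. ell_pos (sr_path 1 r y k) - ell_pos (sr_path 1 0 y k) \<partial>FS\<bar>"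
    unfolding mean_ell_def using i integrable_ell_pos_sr_path by simp
  also have "\<dots> \<le> (\<integral>y. \<bar>ell_pos (sr_path 1 r y k) - ell_pos (sr_path 1 0 y k)\<bar> \<partial>FS)" by (rule integral_abs_bound)
  also have "\<dots> \<le> (\<integral>y. 2 * sqrt r * sqrt (lr_prod y k) \<partial>FS)"
    using d b integrable_sqrt_lr_prod by (intro integral_mono_AE) auto
  also have "\<dots> = 2 * \<rho> ^ k * sqrt r" by (simp add: integral_sqrt_lr_prod)
  finally show "\<bar>(\<integral>y. ell_pos (sr_path 1 r y k) \<partial>FS) - mean_ell k\<bar> \<le> 2 * \<rho> ^ k * sqrt r" .
qed

text \<open>The mean of \<open>ell\<close> at time \<open>n + k\<close> on survival at the earlier time
  \<open>n\<close>. The case \<open>k = 0\<close> is the one to be averaged; for large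
  \<open>k\<close> the two factors are nearly independent.\<close>

definition stopped_ell :: "real \<Rightarrow> nat \<Rightarrow> nat \<Rightarrow> real" where
  "stopped_ell A n k = (\<integral>x. indicator {x. alive 1 0 A x n} x * ell_pos (sr_path 1 0 x (n + k)) \<partial>FS)"

lemma stopped_ell_approx: "\<bar>stopped_ell A n k - mean_ell k * survival A n\<bar> \<le> 2 * \<rho> ^ k * stopped_sqrt A n"
proof -
  define I where "I r = (\<integral>y. ell_pos (sr_path 1 r y k) \<partial>FS)" for r
  have [measurable]: "I \<in> borel_measurable borel"
    unfolding I_def by (rule FS.P.borel_measurable_lebesgue_integral) (simp add: split_beta')
  have e: "stopped_ell A n k = (\<integral>x. indicator {x. alive 1 0 A x n} x * I (sr_path 1 0 x n) \<partial>FS)"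
  proof -
    have ic: "indicator {x. alive 1 0 A x n} (comb_seq n x y) = (indicator {x. alive 1 0 A x n} x :: real)" for x y
      by (simp add: indicator_def alive_comb_seq_le)
    show ?thesis
      using FS.integral_comb_seq[OF integrable_alive_F[OF integrable_ell_pos_sr_path[of "n + k"], of A n], of n]
      unfolding stopped_ell_def I_def by (simp add: sr_path_comb_seq_add ic)
  qed
  have b: "AE x in FS. \<bar>I (sr_path 1 0 x n) - mean_ell k\<bar> \<le> 2 * \<rho> ^ k * sqrt (sr_path 1 0 x n)"
    using FS_sr_path_nonneg[of n] unfolding I_def by eventually_elim (rule ell_pos_restart_bound)
  have i: "integrable FS (\<lambda>x. I (sr_path 1 0 x n) - mean_ell k)"
    by (rule Bochner_Integration.integrable_bound[of _ "\<lambda>x. 2 * \<rho> ^ k * sqrt (sr_path 1 0 x n)"])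
      (use integrable_sqrt_sr_path b in \<open>auto elim!: eventually_mono\<close>)
  have i2: "integrable FS (\<lambda>x. I (sr_path 1 0 x n))" using Bochner_Integration.integrable_add[OF i FS.P.integrable_const[of "mean_ell k"]] by simp
  have s: "mean_ell k * survival A n = (\<integral>x. indicator {x. alive 1 0 A x n} x * mean_ell k \<partial>FS)"
    by (simp add: survival_def)
  have "\<bar>stopped_ell A n k - mean_ell k * survival A n\<bar> = \<bar>\<integral>x. indicator {x. alive 1 0 A x n} x * (I (sr_path 1 0 x n) - mean_ell k) \<partial>FS\<bar>"
    unfolding e s using integrable_alive_F[OF i2, of A n] integrable_alive_F[of "\<lambda>_. mean_ell k" A n]
    by (simp add: right_diff_distrib)
  also have "\<dots> \<le> (\<integral>x. \<bar>indicator {x. alive 1 0 A x n} x * (I (sr_path 1 0 x n) - mean_ell k)\<bar> \<partial>FS)" by (rule integral_abs_bound)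
  also have "\<dots> \<le> (\<integral>x. 2 * \<rho> ^ k * (indicator {x. alive 1 0 A x n} x * sqrt (sr_path 1 0 x n)) \<partial>FS)"
  proof (rule integral_mono_AE)
    show "AE x in FS. \<bar>indicator {x. alive 1 0 A x n} x * (I (sr_path 1 0 x n) - mean_ell k)\<bar> \<le> 2 * \<rho> ^ k * (indicator {x. alive 1 0 A x n} x * sqrt (sr_path 1 0 x n))"
      using b by eventually_elim (auto simp: indicator_def)
  qed (intro integrable_abs integrable_alive_F i integrable_mult_right integrable_sqrt_sr_path)+
  also have "\<dots> = 2 * \<rho> ^ k * stopped_sqrt A n" by (simp add: stopped_sqrt_def)
  finally show ?thesis .
qed

lemma sqrt_later: "(\<integral>x. indicator {x. alive 1 0 A x n} x * sqrt (sr_path 1 0 x (n + k)) \<partial>FS) \<le> sqrt_bound * survival A n + stopped_sqrt A n"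
proof -
  let ?Y = "\<lambda>k. (\<integral>\<^sup>+x. indicator {x. alive 1 0 A x n} x * ennreal (sqrt (sr_path 1 0 x (n + k))) \<partial>FS)"
  have n: "0 \<le> sqrt_bound * survival A n + stopped_sqrt A n" using sqrt_bound_nonneg survival_bounds stopped_sqrt_nonneg by simp
  have Y: "?Y k \<le> ennreal (sqrt_bound * survival A n + stopped_sqrt A n)"
  proof (induction k)
    case 0
    show ?case using sqrt_bound_nonneg survival_bounds[of A n] by (simp add: stopped_sqrt_nn ennreal_leI)
  next
    case (Suc k)
    have "?Y (Suc k) \<le> ennreal \<rho> * (emeasure FS {x. alive 1 0 A x n} + ?Y k)"
      using nn_sqrt_step[of "\<lambda>x. alive 1 0 A x n" "n + k"] by (simp add: alive_comb_seq_le del: sr_path.simps)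
    also have "\<dots> \<le> ennreal \<rho> * (ennreal (survival A n) + ennreal (sqrt_bound * survival A n + stopped_sqrt A n))"
      using Suc by (intro mult_left_mono add_mono) (auto simp: survival_def FS.P.emeasure_eq_measure)
    also have "\<dots> = ennreal (\<rho> * (survival A n + (sqrt_bound * survival A n + stopped_sqrt A n)))"
      using \<rho>_nonneg n survival_bounds[of A n] by (simp add: ennreal_mult ennreal_plus)
    also have "\<rho> * (survival A n + (sqrt_bound * survival A n + stopped_sqrt A n)) = (\<rho> * (1 + sqrt_bound)) * survival A n + \<rho> * stopped_sqrt A n" by (simp add: algebra_simps)
    also have "\<dots> \<le> sqrt_bound * survival A n + stopped_sqrt A n"
      unfolding sqrt_bound_eq using \<rho>_less_1 stopped_sqrt_nonneg[of A n] by (intro add_left_mono) (simp add: mult_left_le_one_le \<rho>_nonneg)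
    finally show ?case by (simp add: ennreal_leI)
  qed
  have i: "integrable FS (\<lambda>x. indicator {x. alive 1 0 A x n} x * sqrt (sr_path 1 0 x (n + k)))"
    by (rule integrable_alive_F[OF integrable_sqrt_sr_path])
  have "?Y k = (\<integral>\<^sup>+x. ennreal (indicator {x. alive 1 0 A x n} x * sqrt (sr_path 1 0 x (n + k))) \<partial>FS)"
    by (intro nn_integral_cong) (auto simp: indicator_def)
  also have "\<dots> = ennreal (\<integral>x. indicator {x. alive 1 0 A x n} x * sqrt (sr_path 1 0 x (n + k)) \<partial>FS)"
    using FS_sr_path_nonneg[of "n + k"] by (intro nn_integral_eq_integral i) (auto elim: eventually_mono)
  finally show ?thesis using Y n by (simp add: ennreal_le_iff)
qed

text \<open>The difference lives on alarms between \<open>n\<close> and \<open>n + k\<close>. On that event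
  \<open>l \<le> d * l\<^sup>2 + 1 / (4 * d)\<close> separates the unbounded function from the
  small probability.\<close>

lemma stopped_ell_gap:
  assumes d: "0 < d"
  shows "0 \<le> stopped_ell A n k - stopped_ell A (n + k) 0"
    "stopped_ell A n k - stopped_ell A (n + k) 0 \<le> d * ell_sq_bound * ((1 + sqrt_bound) * survival A n + stopped_sqrt A n) + (survival A n - survival A (n + k)) / (4 * d)"
proof -
  let ?i = "\<lambda>m x. indicator {x. alive 1 0 A x m} x :: real"
  let ?l = "\<lambda>x. ell_pos (sr_path 1 0 x (n + k))"
  have ii: "?i (n + k) x \<le> ?i n x" for x by (auto simp: indicator_def intro: alive_antimono[of _ _ _ _ "n + k"])
  have e: "stopped_ell A n k - stopped_ell A (n + k) 0 = (\<integral>x. ?i n x * ?l x - ?i (n + k) x * ?l x \<partial>FS)"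
    unfolding stopped_ell_def using integrable_alive_F[OF integrable_ell_pos_sr_path] by simp
  show "0 \<le> stopped_ell A n k - stopped_ell A (n + k) 0"
    unfolding e using ii ell_pos_nonneg by (intro Bochner_Integration.integral_nonneg) (simp add: mult_right_mono)
  have iS: "integrable FS (\<lambda>x. ?i n x * sqrt (sr_path 1 0 x (n + k)))"
    by (rule integrable_alive_F[OF integrable_sqrt_sr_path])
  have i01: "integrable FS (?i m)" for m by (intro integrable_real_indicator) (auto simp: FS.P.emeasure_eq_measure)
  have "stopped_ell A n k - stopped_ell A (n + k) 0 \<le> (\<integral>x. d * (ell_sq_bound * (?i n x + ?i n x * sqrt (sr_path 1 0 x (n + k)))) + (?i n x - ?i (n + k) x) / (4 * d) \<partial>FS)"
    unfolding e
  proof (rule integral_mono_AE)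
    show "AE x in FS. ?i n x * ?l x - ?i (n + k) x * ?l x \<le> d * (ell_sq_bound * (?i n x + ?i n x * sqrt (sr_path 1 0 x (n + k)))) + (?i n x - ?i (n + k) x) / (4 * d)"
      using FS_sr_path_nonneg[of "n + k"]
    proof eventually_elim
      case (elim x)
      have l: "?l x \<le> d * (?l x)\<^sup>2 + 1 / (4 * d)"
      proof -
        \<comment> \<open>completing the square\<close>
        have "0 \<le> (2 * d * ?l x - 1)\<^sup>2 / (4 * d)" using d by simp
        also have "\<dots> = d * (?l x)\<^sup>2 + 1 / (4 * d) - ?l x" using d by (simp add: power2_eq_square field_simps)
        finally show ?thesis by simp
      qed
      have "d * (?l x)\<^sup>2 \<le> d * (ell_sq_bound * (1 + sqrt (sr_path 1 0 x (n + k))))"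
        using ell_pos_squared_le[OF elim] d by simp
      moreover have "0 \<le> d * (ell_sq_bound * (1 + sqrt (sr_path 1 0 x (n + k))))" using elim ell_sq_bound_pos d by (intro mult_nonneg_nonneg) auto
      moreover have "?i (n + k) x = 1 \<longrightarrow> ?i n x = 1" using ii[of x] by (auto simp: indicator_def split: if_splits)
      ultimately show ?case using l by (auto simp: indicator_def split: if_splits)
    qed
  qed (use iS i01 integrable_alive_F[OF integrable_ell_pos_sr_path] in auto)
  also have "\<dots> = d * (ell_sq_bound * (\<integral>x. ?i n x + ?i n x * sqrt (sr_path 1 0 x (n + k)) \<partial>FS)) + (survival A n - survival A (n + k)) / (4 * d)"
    using iS i01 by (simp add: survival_def)
  also have "(\<integral>x. ?i n x + ?i n x * sqrt (sr_path 1 0 x (n + k)) \<partial>FS) = survival A n + (\<integral>x. ?i n x * sqrt (sr_path 1 0 x (n + k)) \<partial>FS)"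
    using i01 integrable_alive_F[OF integrable_sqrt_sr_path] by (simp add: survival_def)
  also have "d * (ell_sq_bound * (survival A n + (\<integral>x. ?i n x * sqrt (sr_path 1 0 x (n + k)) \<partial>FS))) \<le> d * (ell_sq_bound * ((1 + sqrt_bound) * survival A n + stopped_sqrt A n))"
    using sqrt_later[of A n k] d ell_sq_bound_pos by (intro mult_left_mono) (auto simp: algebra_simps)
  finally show "stopped_ell A n k - stopped_ell A (n + k) 0 \<le> d * ell_sq_bound * ((1 + sqrt_bound) * survival A n + stopped_sqrt A n) + (survival A n - survival A (n + k)) / (4 * d)"
    by (simp add: mult.assoc)
qed

lemma stopped_ell_0_bounds: "0 \<le> stopped_ell A n 0" "stopped_ell A n 0 \<le> ell 0 + 2 * sqrt_bound"
proof -
  show "0 \<le> stopped_ell A n 0" unfolding stopped_ell_def by (intro Bochner_Integration.integral_nonneg) (simp add: ell_pos_nonneg)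
  have "stopped_ell A n 0 \<le> mean_ell n" unfolding stopped_ell_def mean_ell_def
    using integrable_alive_F[OF integrable_ell_pos_sr_path[of n]] integrable_ell_pos_sr_path[of n]
    by (intro integral_mono) (auto simp: indicator_def ell_pos_nonneg)
  then show "stopped_ell A n 0 \<le> ell 0 + 2 * sqrt_bound" using mean_ell_bounds(2)[of n] by simp
qed

lemma summable_stopped_ell: "0 < A \<Longrightarrow> summable (\<lambda>n. stopped_ell A n k)"
proof -
  assume A: "0 < A"
  have "summable (\<lambda>n. mean_ell k * survival A n + 2 * \<rho> ^ k * stopped_sqrt A n)"
    using summable_survival[OF A] summable_stopped_sqrt[OF A] by (intro summable_add summable_mult)
  then show ?thesis
  proof (rule summable_comparison_test')
    fix n
    have "0 \<le> stopped_ell A n k" unfolding stopped_ell_def by (intro Bochner_Integration.integral_nonneg) (simp add: ell_pos_nonneg)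
    then show "norm (stopped_ell A n k) \<le> mean_ell k * survival A n + 2 * \<rho> ^ k * stopped_sqrt A n"
      using stopped_ell_approx[of A n k] unfolding real_norm_def by linarith
  qed
qed

text \<open>Summed over \<open>n\<close>, the probabilities of an alarm between \<open>n\<close> and \<open>n
  + k\<close> telescope to at most \<open>k\<close>, which is negligible against the run length.\<close>

lemma sum_stopped_ell_approx:
  assumes A: "0 < A" and d: "0 < d"
  shows "\<bar>(\<Sum>n. stopped_ell A n 0) - mean_ell k * run_length A\<bar>
     \<le> (2 * \<rho> ^ k * sqrt_bound + d * ell_sq_bound * (1 + 2 * sqrt_bound)) * run_length A + real k / (4 * d) + real k * (ell 0 + 2 * sqrt_bound)"
proof -
  note sS = summable_survival[OF A] and sQ = summable_stopped_sqrt[OF A] and sL = summable_stopped_ell[OF A]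
  have sLk: "summable (\<lambda>n. stopped_ell A (n + k) 0)" using sL[of 0] by (rule summable_ignore_initial_segment)
  have split: "(\<Sum>n. stopped_ell A n 0) = (\<Sum>n. stopped_ell A (n + k) 0) + (\<Sum>n<k. stopped_ell A n 0)"
    by (rule suminf_split_initial_segment[OF sL])
  have init: "0 \<le> (\<Sum>n<k. stopped_ell A n 0)" "(\<Sum>n<k. stopped_ell A n 0) \<le> real k * (ell 0 + 2 * sqrt_bound)"
  proof -
    show "0 \<le> (\<Sum>n<k. stopped_ell A n 0)" by (intro sum_nonneg stopped_ell_0_bounds)
    have "(\<Sum>n<k. stopped_ell A n 0) \<le> (\<Sum>n<k. ell 0 + 2 * sqrt_bound)" by (intro sum_mono stopped_ell_0_bounds)
    then show "(\<Sum>n<k. stopped_ell A n 0) \<le> real k * (ell 0 + 2 * sqrt_bound)" by simp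
  qed
  have qpos: "0 \<le> 2 * \<rho> ^ k" using \<rho>_nonneg by simp
  have main: "\<bar>(\<Sum>n. stopped_ell A n k) - mean_ell k * run_length A\<bar> \<le> 2 * \<rho> ^ k * sqrt_bound * run_length A"
  proof -
    have "(\<Sum>n. stopped_ell A n k) - mean_ell k * run_length A = (\<Sum>n. stopped_ell A n k - mean_ell k * survival A n)"
      unfolding run_length_def suminf_mult[OF sS, symmetric] by (rule suminf_diff[OF sL summable_mult[OF sS]])
    moreover have sd: "summable (\<lambda>n. \<bar>stopped_ell A n k - mean_ell k * survival A n\<bar>)"
      by (rule summable_comparison_test'[OF summable_mult[OF sQ, of "2 * \<rho> ^ k"]]) (use stopped_ell_approx in auto)
    moreover have "\<bar>\<Sum>n. stopped_ell A n k - mean_ell k * survival A n\<bar> \<le> (\<Sum>n. \<bar>stopped_ell A n k - mean_ell k * survival A n\<bar>)"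
      using summable_rabs[OF sd] .
    moreover have "(\<Sum>n. \<bar>stopped_ell A n k - mean_ell k * survival A n\<bar>) \<le> (\<Sum>n. 2 * \<rho> ^ k * stopped_sqrt A n)"
      by (intro suminf_le stopped_ell_approx sd summable_mult sQ)
    moreover have "(\<Sum>n. 2 * \<rho> ^ k * stopped_sqrt A n) = 2 * \<rho> ^ k * (\<Sum>n. stopped_sqrt A n)" by (rule suminf_mult[OF sQ])
    moreover have "2 * \<rho> ^ k * (\<Sum>n. stopped_sqrt A n) \<le> 2 * \<rho> ^ k * (sqrt_bound * run_length A)"
      using sum_stopped_sqrt[OF A] qpos by (rule mult_left_mono)
    ultimately show ?thesis by (simp add: mult.assoc)
  qed
  let ?g = "\<lambda>n. stopped_ell A n k - stopped_ell A (n + k) 0"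
  have sg: "summable ?g" using sL sLk by (intro summable_diff)
  have g: "(\<Sum>n. ?g n) = (\<Sum>n. stopped_ell A n k) - (\<Sum>n. stopped_ell A (n + k) 0)" using sL sLk by (rule suminf_diff[symmetric])
  have g0: "0 \<le> (\<Sum>n. ?g n)" using stopped_ell_gap(1)[OF d] by (intro suminf_nonneg sg)
  have sSk: "summable (\<lambda>n. survival A (n + k))" using sS by (rule summable_ignore_initial_segment)
  have tel: "(\<Sum>n. survival A n - survival A (n + k)) \<le> real k"
  proof -
    have "(\<Sum>n. survival A n - survival A (n + k)) = (\<Sum>n<k. survival A n)"
      using suminf_diff[OF sS sSk] suminf_split_initial_segment[OF sS, of k] by simp
    also have "\<dots> \<le> (\<Sum>n<k. 1)" by (intro sum_mono survival_bounds)
    finally show ?thesis by simp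
  qed
  have "(\<Sum>n. ?g n) \<le> (\<Sum>n. d * ell_sq_bound * ((1 + sqrt_bound) * survival A n + stopped_sqrt A n) + (survival A n - survival A (n + k)) / (4 * d))"
    using sS sQ sSk by (intro suminf_le stopped_ell_gap(2)[OF d] sg summable_add summable_mult summable_divide summable_diff)
  also have "\<dots> = d * ell_sq_bound * ((1 + sqrt_bound) * run_length A + (\<Sum>n. stopped_sqrt A n)) + (\<Sum>n. survival A n - survival A (n + k)) / (4 * d)"
  proof -
    have "(\<lambda>n. d * ell_sq_bound * ((1 + sqrt_bound) * survival A n + stopped_sqrt A n) + (survival A n - survival A (n + k)) / (4 * d)) sums
       (d * ell_sq_bound * ((1 + sqrt_bound) * run_length A + (\<Sum>n. stopped_sqrt A n)) + (\<Sum>n. survival A n - survival A (n + k)) / (4 * d))"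
      unfolding run_length_def by (intro sums_add sums_mult sums_divide summable_sums sS sQ summable_diff sSk)
    then show ?thesis by (rule sums_unique[symmetric])
  qed
  also have "\<dots> \<le> d * ell_sq_bound * ((1 + sqrt_bound) * run_length A + sqrt_bound * run_length A) + real k / (4 * d)"
    using sum_stopped_sqrt[OF A] tel d ell_sq_bound_pos sqrt_bound_nonneg by (intro add_mono mult_left_mono divide_right_mono) auto
  also have "\<dots> = d * ell_sq_bound * (1 + 2 * sqrt_bound) * run_length A + real k / (4 * d)" by (simp add: algebra_simps)
  finally have g1: "(\<Sum>n. ?g n) \<le> d * ell_sq_bound * (1 + 2 * sqrt_bound) * run_length A + real k / (4 * d)" .
  have ex: "(2 * \<rho> ^ k * sqrt_bound + d * ell_sq_bound * (1 + 2 * sqrt_bound)) * run_length A = 2 * \<rho> ^ k * sqrt_bound * run_length A + d * ell_sq_bound * (1 + 2 * sqrt_bound) * run_length A"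
    by (simp add: distrib_right)
  have g2: "0 \<le> real k / (4 * d)" using d by simp
  show ?thesis using split init main g g0 g1 g2 unfolding ex by linarith
qed

text \<open>Weak convergence applies to the truncations of \<open>ell_pos\<close>. The second moments of
  \<open>ell_pos\<close> are bounded along the statistic, which makes the truncation error uniform
  in time.\<close>

lemma stationary_limit:
  assumes Q: "real_distribution Q"
    and lim: "\<And>x. (\<lambda>n. measure FS {w. sr_path 1 0 w n \<le> x}) \<longlonglongrightarrow> cdf Q x"
  shows "AE x in Q. 0 \<le> x" "integrable Q ell_pos" "mean_ell \<longlonglongrightarrow> (\<integral>x. ell_pos x \<partial>Q)"
proof -
  interpret Q: real_distribution Q by fact
  let ?D = "\<lambda>n. distr FS borel (\<lambda>w. sr_path 1 0 w n)"
  have D: "real_distribution (?D n)" for n by (rule FS.P.real_distribution_distr) simp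
  have cdf: "cdf (?D n) x = measure FS {w. sr_path 1 0 w n \<le> x}" for n x
    by (simp add: cdf_def measure_distr vimage_def)
  have weak: "weak_conv_m ?D Q"
    unfolding weak_conv_m_def weak_conv_def cdf using lim by auto
  have neg: "cdf Q x = 0" if "x < 0" for x
  proof -
    have "measure FS {w. sr_path 1 0 w n \<le> x} = 0" for n
    proof -
      have "AE w in FS. w \<notin> {w. sr_path 1 0 w n \<le> x}" using FS_sr_path_nonneg[of n] by eventually_elim (use that in auto)
      moreover have "{w \<in> space FS. sr_path 1 0 w n \<le> x} \<in> sets FS" by measurable
      ultimately show ?thesis by (simp add: FS.P.prob_eq_0)
    qed
    then show ?thesis using lim[of x] by (simp add: LIMSEQ_const_iff)
  qed
  show ae: "AE x in Q. 0 \<le> x"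
  proof -
    have "AE x in Q. \<forall>n::nat. \<not> x \<le> - (1 / (real n + 1))"
      unfolding AE_all_countable
    proof
      fix n :: nat
      have "measure Q {..- (1 / (real n + 1))} = 0" using neg[of "- (1 / (real n + 1))"] by (simp add: cdf_def)
      then have "{..- (1 / (real n + 1))} \<in> null_sets Q" by (simp add: null_sets_def Q.emeasure_eq_measure)
      from AE_not_in[OF this] show "AE x in Q. \<not> x \<le> - (1 / (real n + 1))" by (rule eventually_mono) simp
    qed
    then show ?thesis
    proof eventually_elim
      case (elim x)
      show ?case
      proof (rule ccontr)
        assume "\<not> 0 \<le> x"
        then obtain n where "inverse (real (Suc n)) < - x" using reals_Archimedean[of "- x"] by auto
        then show False using elim[rule_format, of n] by (simp add: inverse_eq_divide add.commute)
      qed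
    qed
  qed
  define trunc where "trunc M r = min (real M) (ell_pos r)" for M :: nat and r
  have ct: "continuous_on UNIV (trunc M)" for M
    unfolding trunc_def by (intro continuous_intros ell_pos_continuous)
  have [measurable]: "trunc M \<in> borel_measurable borel" for M by (rule borel_measurable_continuous_onI[OF ct])
  have tb: "0 \<le> trunc M r" "trunc M r \<le> real M" "trunc M r \<le> ell_pos r" for M r by (auto simp: trunc_def ell_pos_nonneg)
  have tconv: "(\<lambda>n. \<integral>w. trunc M (sr_path 1 0 w n) \<partial>FS) \<longlonglongrightarrow> (\<integral>x. trunc M x \<partial>Q)" for M
  proof -
    have "(\<lambda>n. integral\<^sup>L (?D n) (trunc M)) \<longlonglongrightarrow> integral\<^sup>L Q (trunc M)"
      by (rule weak_conv_imp_integral_bdd_continuous_conv[OF D Q weak, where B="real M"])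
        (use ct tb in \<open>auto simp: continuous_on_eq_continuous_at\<close>)
    then show ?thesis by (simp add: integral_distr)
  qed
  have itF: "integrable FS (\<lambda>w. trunc M (sr_path 1 0 w n))" for M n
    by (rule FS.P.integrable_const_bound[of _ "real M"]) (use tb in auto)
  have itQ: "integrable Q (trunc M)" for M
    by (rule Q.integrable_const_bound[of _ "real M"]) (use tb in auto)
  \<comment> \<open>\<open>l - min M l \<le> l\<^sup>2 / M\<close>\<close>
  have gap: "0 \<le> mean_ell n - (\<integral>w. trunc M (sr_path 1 0 w n) \<partial>FS) \<and> mean_ell n - (\<integral>w. trunc M (sr_path 1 0 w n) \<partial>FS) \<le> ell_sq_bound * (1 + sqrt_bound) / real M"
    if "0 < M" for n M
  proof -
    have e: "mean_ell n - (\<integral>w. trunc M (sr_path 1 0 w n) \<partial>FS) = (\<integral>w. ell_pos (sr_path 1 0 w n) - trunc M (sr_path 1 0 w n) \<partial>FS)"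
      unfolding mean_ell_def using itF integrable_ell_pos_sr_path by simp
    have "0 \<le> (\<integral>w. ell_pos (sr_path 1 0 w n) - trunc M (sr_path 1 0 w n) \<partial>FS)"
      using tb by (intro Bochner_Integration.integral_nonneg) auto
    moreover have "(\<integral>w. ell_pos (sr_path 1 0 w n) - trunc M (sr_path 1 0 w n) \<partial>FS) \<le> (\<integral>w. ell_sq_bound * (1 + sqrt (sr_path 1 0 w n)) / real M \<partial>FS)"
    proof (rule integral_mono_AE)
      show "AE w in FS. ell_pos (sr_path 1 0 w n) - trunc M (sr_path 1 0 w n) \<le> ell_sq_bound * (1 + sqrt (sr_path 1 0 w n)) / real M"
        using FS_sr_path_nonneg[of n]
      proof eventually_elim
        case (elim w)
        let ?l = "ell_pos (sr_path 1 0 w n)"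
        have "(?l - trunc M (sr_path 1 0 w n)) * real M \<le> ?l\<^sup>2"
        proof (cases "?l \<le> real M")
          case True then show ?thesis by (simp add: trunc_def)
        next
          case False
          have "(?l - real M) * real M \<le> ?l * ?l" using False that ell_pos_nonneg by (intro mult_mono) auto
          then show ?thesis using False by (simp add: trunc_def power2_eq_square)
        qed
        also have "\<dots> \<le> ell_sq_bound * (1 + sqrt (sr_path 1 0 w n))" by (rule ell_pos_squared_le[OF elim])
        finally show ?case using that by (simp add: field_simps)
      qed
    qed (use itF integrable_ell_pos_sr_path integrable_sqrt_sr_path in auto)
    moreover have "(\<integral>w. ell_sq_bound * (1 + sqrt (sr_path 1 0 w n)) / real M \<partial>FS) = ell_sq_bound * (1 + (\<integral>w. sqrt (sr_path 1 0 w n) \<partial>FS)) / real M"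
      using integrable_sqrt_sr_path[of n] by simp
    moreover have "ell_sq_bound * (1 + (\<integral>w. sqrt (sr_path 1 0 w n) \<partial>FS)) / real M \<le> ell_sq_bound * (1 + sqrt_bound) / real M"
      using integral_sqrt_sr_path[of n] ell_sq_bound_pos that by (intro divide_right_mono mult_left_mono) auto
    ultimately show ?thesis unfolding e by linarith
  qed
  have bQ: "(\<integral>x. trunc M x \<partial>Q) \<le> ell 0 + 2 * sqrt_bound" for M
  proof (rule tendsto_upperbound[OF tconv])
    have "(\<integral>w. trunc M (sr_path 1 0 w n) \<partial>FS) \<le> mean_ell n" for n
      unfolding mean_ell_def using tb by (intro integral_mono itF integrable_ell_pos_sr_path)
    then show "\<forall>\<^sub>F n in sequentially. (\<integral>w. trunc M (sr_path 1 0 w n) \<partial>FS) \<le> ell 0 + 2 * sqrt_bound"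
      by (intro always_eventually allI) (rule order_trans[OF _ mean_ell_bounds(2)])
  qed simp
  have tmono: "mono (\<lambda>M. trunc M x)" for x by (auto simp: mono_def trunc_def)
  have tlim: "(\<lambda>M. trunc M x) \<longlonglongrightarrow> ell_pos x" for x
  proof (rule tendsto_eventually)
    show "\<forall>\<^sub>F M in sequentially. trunc M x = ell_pos x"
      using eventually_ge_at_top[of "nat \<lceil>ell_pos x\<rceil>"]
    proof eventually_elim
      case (elim M)
      then have "ell_pos x \<le> real M" by linarith
      then show ?case by (simp add: trunc_def)
    qed
  qed
  have inc: "incseq (\<lambda>M. \<integral>x. trunc M x \<partial>Q)"
    by (intro incseq_SucI integral_mono itQ) (auto simp: trunc_def)
  then obtain L where L: "(\<lambda>M. \<integral>x. trunc M x \<partial>Q) \<longlonglongrightarrow> L"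
    using incseq_convergent[OF inc, of "ell 0 + 2 * sqrt_bound"] bQ by blast
  have mc: "integrable Q ell_pos \<and> (\<integral>x. ell_pos x \<partial>Q) = L"
  proof
    note mc = integral_monotone_convergence_nonneg[of Q trunc ell_pos L, OF itQ AE_I2[OF tmono] AE_I2[OF tb(1)] AE_I2[OF tlim] L]
    have "ell_pos \<in> borel_measurable Q"
      using measurable_ell_pos by (subst measurable_cong_sets[OF Q.events_eq_borel refl])
    then show "integrable Q ell_pos" "(\<integral>x. ell_pos x \<partial>Q) = L" using mc by blast+
  qed
  then show "integrable Q ell_pos" by simp
  show "mean_ell \<longlonglongrightarrow> (\<integral>x. ell_pos x \<partial>Q)"
  proof (rule LIMSEQ_I)
    fix r :: real assume "0 < r"
    have "(\<lambda>M. ell_sq_bound * (1 + sqrt_bound) / real M) \<longlonglongrightarrow> 0" by (rule lim_const_over_n)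
    then have 1: "\<forall>\<^sub>F M in sequentially. ell_sq_bound * (1 + sqrt_bound) / real M < r/3" using \<open>0 < r\<close> by (intro order_tendstoD(2)) auto
    have 2: "\<forall>\<^sub>F M in sequentially. dist (\<integral>x. trunc M x \<partial>Q) (\<integral>x. ell_pos x \<partial>Q) < r/3" 
      using tendstoD[OF L, of "r/3"] mc \<open>0 < r\<close> by simp
    from eventually_happens'[OF _ eventually_conj[OF eventually_conj[OF 1 2] eventually_gt_at_top[of 0]]]
    obtain M where M: "ell_sq_bound * (1 + sqrt_bound) / real M < r/3" "dist (\<integral>x. trunc M x \<partial>Q) (\<integral>x. ell_pos x \<partial>Q) < r/3" "0 < M" by auto
    have "\<forall>\<^sub>F n in sequentially. dist (\<integral>w. trunc M (sr_path 1 0 w n) \<partial>FS) (\<integral>x. trunc M x \<partial>Q) < r/3"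
      using tendstoD[OF tconv[of M], of "r/3"] \<open>0 < r\<close> by simp
    then have "\<forall>\<^sub>F n in sequentially. norm (mean_ell n - (\<integral>x. ell_pos x \<partial>Q)) < r"
    proof eventually_elim
      case (elim n)
      then show ?case using gap[OF M(3), of n] M(1,2) unfolding dist_real_def real_norm_def by linarith
    qed
    then show "\<exists>no. \<forall>n\<ge>no. norm (mean_ell n - (\<integral>x. ell_pos x \<partial>Q)) < r" by (simp add: eventually_sequentially)
  qed
qed

text \<open>The occupation measure of the statistic up to the alarm approaches its stationary law, as far as
  \<open>ell_pos\<close> can tell.\<close>

theorem average_of_ell_pos:
  assumes lim: "mean_ell \<longlonglongrightarrow> c"
  shows "((\<lambda>A. (\<Sum>n. stopped_ell A n 0) / run_length A) \<longlongrightarrow> c) at_top"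
proof (rule tendstoI)
  fix r :: real assume r: "0 < r"
  have l1: "\<forall>\<^sub>F k in sequentially. dist (mean_ell k) c < r/4" using tendstoD[OF lim, of "r/4"] r by simp
  have "(\<lambda>k. 2 * \<rho> ^ k * sqrt_bound) \<longlonglongrightarrow> 2 * 0 * sqrt_bound" using \<rho>_nonneg \<rho>_less_1 by (intro tendsto_intros LIMSEQ_realpow_zero) auto
  then have l2: "\<forall>\<^sub>F k in sequentially. 2 * \<rho> ^ k * sqrt_bound < r/4" by (rule order_tendstoD(2)) (use r in simp)
  from eventually_happens'[OF _ eventually_conj[OF l1 l2]]
  obtain k where k: "dist (mean_ell k) c < r/4" "2 * \<rho> ^ k * sqrt_bound < r/4" by auto
  \<comment> \<open>first \<open>k\<close>, then \<open>d\<close>, and finally \<open>A\<close>, since the constant \<open>B\<close> depends on both\<close>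
  define d where "d = r / (4 * ell_sq_bound * (1 + 2 * sqrt_bound))"
  have cs: "0 < ell_sq_bound * (1 + 2 * sqrt_bound)" using ell_sq_bound_pos sqrt_bound_nonneg by (intro mult_pos_pos) auto
  have d: "0 < d" "d * ell_sq_bound * (1 + 2 * sqrt_bound) = r/4" using r cs by (auto simp: d_def field_simps)
  define B where "B = real k / (4 * d) + real k * (ell 0 + 2 * sqrt_bound)"
  have "((\<lambda>A. B / run_length A) \<longlongrightarrow> 0) at_top"
    by (rule tendsto_divide_0[OF tendsto_const filterlim_at_top_imp_at_infinity[OF run_length_at_top]])
  then have "\<forall>\<^sub>F A in at_top. B / run_length A < r/4" by (rule order_tendstoD(2)) (use r in simp)
  then show "\<forall>\<^sub>F A in at_top. dist ((\<Sum>n. stopped_ell A n 0) / run_length A) c < r" using eventually_gt_at_top[of 0]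
  proof eventually_elim
    case (elim A)
    have T: "0 < run_length A" using run_length_pos[OF elim(2)] by simp
    have "\<bar>(\<Sum>n. stopped_ell A n 0) - mean_ell k * run_length A\<bar> \<le> (2 * \<rho> ^ k * sqrt_bound + r/4) * run_length A + B"
      using sum_stopped_ell_approx[OF elim(2) d(1), of k] unfolding d(2) B_def by simp
    then have "\<bar>(\<Sum>n. stopped_ell A n 0) - mean_ell k * run_length A\<bar> / run_length A \<le> ((2 * \<rho> ^ k * sqrt_bound + r/4) * run_length A + B) / run_length A"
      using T by (intro divide_right_mono) auto
    also have "\<dots> = 2 * \<rho> ^ k * sqrt_bound + r/4 + B / run_length A" using T by (simp add: add_divide_distrib)
    also have "\<bar>(\<Sum>n. stopped_ell A n 0) - mean_ell k * run_length A\<bar> / run_length A = \<bar>((\<Sum>n. stopped_ell A n 0) - mean_ell k * run_length A) / run_length A\<bar>"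
      using T by simp
    also have "((\<Sum>n. stopped_ell A n 0) - mean_ell k * run_length A) / run_length A = (\<Sum>n. stopped_ell A n 0) / run_length A - mean_ell k"
      using T by (simp add: diff_divide_distrib)
    finally have "\<bar>(\<Sum>n. stopped_ell A n 0) / run_length A - mean_ell k\<bar> \<le> 2 * \<rho> ^ k * sqrt_bound + r/4 + B / run_length A" .
    then show ?case using k elim(1) unfolding dist_real_def by linarith
  qed
qed

end


context likelihood_walk
begin

definition stopped_delay :: "real \<Rightarrow> nat \<Rightarrow> real" where
  "stopped_delay A n = (\<integral>x. indicator {x. alive 1 0 A x n} x * mean_time 1 (sr_path 1 0 x n) A \<partial>FS)"

lemma integrable_stopped_delay:
  assumes b: "\<And>r. 0 \<le> r \<Longrightarrow> r < A \<Longrightarrow> \<bar>drift * mean_time 1 r A - (ln A + overshoot_limit - ell r)\<bar> \<le> \<eta> * (1 + sqrt r)"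
  shows "integrable FS (\<lambda>x. indicator {x. alive 1 0 A x n} x * mean_time 1 (sr_path 1 0 x n) A)"
    "\<bar>drift * stopped_delay A n - ((ln A + overshoot_limit) * survival A n - stopped_ell A n 0)\<bar> \<le> \<eta> * (survival A n + stopped_sqrt A n)"
proof -
  let ?i = "\<lambda>x. indicator {x. alive 1 0 A x n} x :: real"
  let ?m = "\<lambda>x. ?i x * mean_time 1 (sr_path 1 0 x n) A"
  let ?e = "\<lambda>x. (ln A + overshoot_limit) * ?i x - ?i x * ell_pos (sr_path 1 0 x n)"
  let ?b = "\<lambda>x. \<eta> * (?i x + ?i x * sqrt (sr_path 1 0 x n))"
  have ii: "integrable FS ?i" by (intro integrable_real_indicator) (auto simp: FS.P.emeasure_eq_measure)
  have ie: "integrable FS ?e" using ii integrable_alive_F[OF integrable_ell_pos_sr_path] by auto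
  have ib: "integrable FS ?b" using ii integrable_alive_F[OF integrable_sqrt_sr_path] by auto
  have ae: "AE x in FS. \<bar>drift * ?m x - ?e x\<bar> \<le> ?b x"
    using FS_sr_path_nonneg[of n]
  proof eventually_elim
    case (elim x)
    show ?case
    proof (cases "alive 1 0 A x n")
      case True
      then have "sr_path 1 0 x n < A" by (auto simp: alive_def)
      with b[OF elim] True elim show ?thesis by (simp add: ell_pos_def)
    qed simp
  qed
  have [measurable]: "?m \<in> borel_measurable FS" by measurable
  have "integrable FS (\<lambda>x. drift * ?m x - ?e x)"
    by (rule Bochner_Integration.integrable_bound[OF ib]) (use ae in \<open>auto elim!: eventually_mono\<close>)
  from Bochner_Integration.integrable_add[OF this ie] have "integrable FS (\<lambda>x. drift * ?m x)" by simp
  then show im: "integrable FS ?m" using drift_pos by simp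
  have "\<bar>drift * stopped_delay A n - ((ln A + overshoot_limit) * survival A n - stopped_ell A n 0)\<bar> = \<bar>\<integral>x. drift * ?m x - ?e x \<partial>FS\<bar>"
    unfolding stopped_delay_def stopped_ell_def survival_def using im ii integrable_alive_F[OF integrable_ell_pos_sr_path] by simp
  also have "\<dots> \<le> (\<integral>x. \<bar>drift * ?m x - ?e x\<bar> \<partial>FS)" by (rule integral_abs_bound)
  also have "\<dots> \<le> (\<integral>x. ?b x \<partial>FS)" using im ie ib ae by (intro integral_mono_AE) auto
  also have "\<dots> = \<eta> * (survival A n + stopped_sqrt A n)"
    unfolding survival_def stopped_sqrt_def using ii integrable_alive_F[OF integrable_sqrt_sr_path] by simp
  finally show "\<bar>drift * stopped_delay A n - ((ln A + overshoot_limit) * survival A n - stopped_ell A n 0)\<bar> \<le> \<eta> * (survival A n + stopped_sqrt A n)" .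
qed

lemma stopped_delay_nn:
  assumes A: "0 < A" and i: "integrable FS (\<lambda>x. indicator {x. alive 1 0 A x n} x * mean_time 1 (sr_path 1 0 x n) A)"
  shows "(\<integral>\<^sup>+x. indicator {x. alive 1 0 A x n} x * mean_time_nn 1 (sr_path 1 0 x n) A \<partial>FS) = ennreal (stopped_delay A n)" "0 \<le> stopped_delay A n"
proof -
  have p: "AE x in FS. 0 \<le> indicator {x. alive 1 0 A x n} x * mean_time 1 (sr_path 1 0 x n) A"
    using FS_sr_path_nonneg[of n] by eventually_elim (use A mean_time_nonneg in \<open>auto simp: indicator_def\<close>)
  have "(\<integral>\<^sup>+x. indicator {x. alive 1 0 A x n} x * mean_time_nn 1 (sr_path 1 0 x n) A \<partial>FS)
     = (\<integral>\<^sup>+x. ennreal (indicator {x. alive 1 0 A x n} x * mean_time 1 (sr_path 1 0 x n) A) \<partial>FS)"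
    using FS_sr_path_nonneg[of n]
  proof (intro nn_integral_cong_AE, eventually_elim)
    case (elim x)
    then show ?case using A by (simp add: mean_time_nn_eq indicator_def)
  qed
  then show "(\<integral>\<^sup>+x. indicator {x. alive 1 0 A x n} x * mean_time_nn 1 (sr_path 1 0 x n) A \<partial>FS) = ennreal (stopped_delay A n)"
    unfolding stopped_delay_def using p by (simp add: nn_integral_eq_integral[OF i])
  show "0 \<le> stopped_delay A n" unfolding stopped_delay_def using p by (rule integral_nonneg_AE)
qed

lemma emeasure_alive_sum: "0 < A \<Longrightarrow> (\<Sum>n. emeasure FS {x. alive 1 0 A x n}) = ennreal (run_length A)"
  unfolding run_length_def using summable_survival[of A]
  by (subst suminf_ennreal2[symmetric]) (auto simp: survival_def FS.P.emeasure_eq_measure)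

text \<open>The numerator of the average delay is the sum over \<open>n\<close> of the mean passage time from
  the statistic at time \<open>n\<close>, on survival until then. Inserting the expansion of the
  mean passage time under the occupation measure leaves the average of \<open>ell\<close>.\<close>

theorem delay_ratio_expansion:
  assumes lim: "mean_ell \<longlonglongrightarrow> c"
  defines "J \<equiv> \<lambda>A. (\<Sum>n. \<integral>\<^sup>+x. indicator {x. alive 1 0 A x n} x * mean_time_nn 1 (sr_path 1 0 x n) A \<partial>FS)
                     / (\<Sum>n. emeasure FS {x. alive 1 0 A x n})"
  shows "\<exists>j. (\<forall>\<^sub>F A in at_top. J A = ennreal (j A) \<and> 0 \<le> j A) \<and>
     ((\<lambda>A. j A - 1 / drift * (ln A + overshoot_limit - c)) \<longlongrightarrow> 0) at_top"
proof -
  define j where "j A = (\<Sum>n. stopped_delay A n) / run_length A" for A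
  have good: "\<forall>\<^sub>F A in at_top. J A = ennreal (j A) \<and> 0 \<le> j A \<and>
       \<bar>drift * j A - (ln A + overshoot_limit - (\<Sum>n. stopped_ell A n 0) / run_length A)\<bar> \<le> \<eta> * (1 + sqrt_bound)" if \<eta>: "0 < \<eta>" for \<eta>
    using mean_time_expansion[OF \<eta>] eventually_gt_at_top[of 0]
  proof eventually_elim
    case (elim A)
    then have b: "\<bar>drift * mean_time 1 r A - (ln A + overshoot_limit - ell r)\<bar> \<le> \<eta> * (1 + sqrt r)" if "0 \<le> r" "r < A" for r
      using that by blast
    note A = elim(2)
    note im = integrable_stopped_delay[OF b]
    note nn = stopped_delay_nn[OF A im(1)]
    have T: "1 \<le> run_length A" by (rule run_length_pos[OF A])
    note sS = summable_survival[OF A] and sQ = summable_stopped_sqrt[OF A] and sL = summable_stopped_ell[OF A, of 0]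
    let ?d = "\<lambda>n. drift * stopped_delay A n - ((ln A + overshoot_limit) * survival A n - stopped_ell A n 0)"
    have sb: "summable (\<lambda>n. \<eta> * (survival A n + stopped_sqrt A n))" using sS sQ by (intro summable_mult summable_add)
    have sd: "summable (\<lambda>n. \<bar>?d n\<bar>)" by (rule summable_comparison_test'[OF sb]) (use im in auto)
    have se: "summable (\<lambda>n. (ln A + overshoot_limit) * survival A n - stopped_ell A n 0)" using sS sL by (intro summable_diff summable_mult)
    from summable_add[OF summable_rabs_cancel[OF sd] se] have "summable (\<lambda>n. drift * stopped_delay A n)" by simp
    then have sm: "summable (stopped_delay A)" using drift_pos by simp
    have s1: "(\<Sum>n. ?d n) = drift * (\<Sum>n. stopped_delay A n) - ((ln A + overshoot_limit) * run_length A - (\<Sum>n. stopped_ell A n 0))"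
      unfolding run_length_def
      by (intro sums_unique[symmetric] sums_diff sums_mult summable_sums sm sS sL)
    have "\<bar>\<Sum>n. ?d n\<bar> \<le> (\<Sum>n. \<bar>?d n\<bar>)" by (rule summable_rabs[OF sd])
    also have "\<dots> \<le> (\<Sum>n. \<eta> * (survival A n + stopped_sqrt A n))" by (intro suminf_le im(2) sd sb)
    also have "\<dots> = \<eta> * (run_length A + (\<Sum>n. stopped_sqrt A n))"
      unfolding run_length_def by (intro sums_unique[symmetric] sums_add sums_mult summable_sums sS sQ)
    also have "\<dots> \<le> \<eta> * ((1 + sqrt_bound) * run_length A)" using sum_stopped_sqrt[OF A] \<eta> by (simp add: algebra_simps)
    finally have "\<bar>drift * (\<Sum>n. stopped_delay A n) - ((ln A + overshoot_limit) * run_length A - (\<Sum>n. stopped_ell A n 0))\<bar> / run_length A \<le> \<eta> * ((1 + sqrt_bound) * run_length A) / run_length A"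
      unfolding s1 using T by (intro divide_right_mono) auto
    also have "\<dots> = \<eta> * (1 + sqrt_bound)" using T by simp
    also have "\<bar>drift * (\<Sum>n. stopped_delay A n) - ((ln A + overshoot_limit) * run_length A - (\<Sum>n. stopped_ell A n 0))\<bar> / run_length A
        = \<bar>(drift * (\<Sum>n. stopped_delay A n) - ((ln A + overshoot_limit) * run_length A - (\<Sum>n. stopped_ell A n 0))) / run_length A\<bar>" using T by simp
    also have "(drift * (\<Sum>n. stopped_delay A n) - ((ln A + overshoot_limit) * run_length A - (\<Sum>n. stopped_ell A n 0))) / run_length A
       = drift * j A - (ln A + overshoot_limit - (\<Sum>n. stopped_ell A n 0) / run_length A)"
      unfolding j_def using T by (simp add: diff_divide_distrib)
    finally have 1: "\<bar>drift * j A - (ln A + overshoot_limit - (\<Sum>n. stopped_ell A n 0) / run_length A)\<bar> \<le> \<eta> * (1 + sqrt_bound)" .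
    have 2: "0 \<le> j A" unfolding j_def using T by (intro divide_nonneg_nonneg suminf_nonneg sm nn(2)) auto
    have "J A = ennreal (\<Sum>n. stopped_delay A n) / ennreal (run_length A)"
    proof -
      have "(\<Sum>n. \<integral>\<^sup>+x. indicator {x. alive 1 0 A x n} x * mean_time_nn 1 (sr_path 1 0 x n) A \<partial>FS) = (\<Sum>n. ennreal (stopped_delay A n))"
        by (intro suminf_cong nn(1))
      also have "\<dots> = ennreal (\<Sum>n. stopped_delay A n)" using nn(2) sm by (rule suminf_ennreal2)
      finally show ?thesis unfolding J_def emeasure_alive_sum[OF A] by simp
    qed
    also have "\<dots> = ennreal (j A)" unfolding j_def using T by (intro divide_ennreal suminf_nonneg sm nn(2)) auto
    finally show ?case using 1 2 by blast
  qed
  have "((\<lambda>A. drift * j A - (ln A + overshoot_limit - (\<Sum>n. stopped_ell A n 0) / run_length A)) \<longlongrightarrow> 0) at_top"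
  proof (rule tendstoI)
    fix e :: real assume e: "0 < e"
    have "0 < e / (2 * (1 + sqrt_bound))" using e sqrt_bound_nonneg by simp
    from good[OF this] show "\<forall>\<^sub>F A in at_top. dist (drift * j A - (ln A + overshoot_limit - (\<Sum>n. stopped_ell A n 0) / run_length A)) 0 < e"
    proof eventually_elim
      case (elim A)
      have "e / (2 * (1 + sqrt_bound)) * (1 + sqrt_bound) = e / 2" using sqrt_bound_nonneg by (simp add: field_simps)
      then show ?case using elim e unfolding dist_real_def by linarith
    qed
  qed
  from tendsto_diff[OF this average_of_ell_pos[OF lim]]
  have "((\<lambda>A. drift * j A - (ln A + overshoot_limit - (\<Sum>n. stopped_ell A n 0) / run_length A) - (\<Sum>n. stopped_ell A n 0) / run_length A) \<longlongrightarrow> 0 - c) at_top" .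
  moreover have "drift * j A - (ln A + overshoot_limit - s) - s = drift * j A - (ln A + overshoot_limit)" for A s by simp
  ultimately have "((\<lambda>A. drift * j A - (ln A + overshoot_limit)) \<longlongrightarrow> 0 - c) at_top" by (simp only:)
  from tendsto_mult[OF tendsto_const[of "1 / drift"] tendsto_add[OF this tendsto_const[of c]]]
  have "((\<lambda>A. 1 / drift * (drift * j A - (ln A + overshoot_limit) + c)) \<longlongrightarrow> 0) at_top" by simp
  then have "((\<lambda>A. j A - 1 / drift * (ln A + overshoot_limit - c)) \<longlongrightarrow> 0) at_top"
    using drift_pos by (simp add: field_simps)
  moreover have "\<forall>\<^sub>F A in at_top. J A = ennreal (j A) \<and> 0 \<le> j A"
    using good[OF zero_less_one] by eventually_elim blast
  ultimately show ?thesis by blast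
qed

text \<open>With the change after \<open>\<nu>\<close> observations, the first \<open>\<nu>\<close> ratios
  come from a pre-change sequence and the others from an independent post-change sequence.\<close>

lemma PiM_mixed_eq_distr_comb_seq:
  "(\<Pi>\<^sub>M n\<in>UNIV. if n < \<nu> then F else G) = distr (FS \<Otimes>\<^sub>M GS) (\<Pi>\<^sub>M n\<in>UNIV. if n < \<nu> then F else G) (\<lambda>(x, y). comb_seq \<nu> x y)"
proof -
  let ?M = "\<lambda>n. if n < \<nu> then F else G"
  have sM: "sets (\<Pi>\<^sub>M n\<in>UNIV. ?M n) = sets (\<Pi>\<^sub>M n\<in>(UNIV::nat set). (borel :: real measure))"
    by (intro sets_PiM_cong) (auto simp: sets_F sets_G)
  have sF: "sets FS = sets (\<Pi>\<^sub>M n\<in>(UNIV::nat set). (borel :: real measure))" by (intro sets_PiM_cong) (auto simp: sets_F)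
  have sG: "sets GS = sets (\<Pi>\<^sub>M n\<in>(UNIV::nat set). (borel :: real measure))" by (intro sets_PiM_cong) (auto simp: sets_G)
  have m: "(\<lambda>(x, y). comb_seq \<nu> x y) \<in> measurable (FS \<Otimes>\<^sub>M GS) (\<Pi>\<^sub>M n\<in>UNIV. ?M n)"
    using measurable_comb_seq[of \<nu> "borel :: real measure"]
    unfolding measurable_cong_sets[OF sets_pair_measure_cong[OF sF sG] sM] .
  interpret M: prob_space "?M n" for n by (simp add: prob_F prob_G)
  interpret MM: product_prob_space ?M UNIV by unfold_locales
  have "distr (FS \<Otimes>\<^sub>M GS) (\<Pi>\<^sub>M n\<in>UNIV. ?M n) (\<lambda>(x, y). comb_seq \<nu> x y) = (\<Pi>\<^sub>M n\<in>UNIV. ?M n)"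
  proof (rule MM.PiM_eq)
    fix J :: "nat set" and E assume J: "finite J" "J \<subseteq> UNIV" "\<And>j. j \<in> J \<Longrightarrow> E j \<in> sets (?M j)"
    have E: "E j \<in> sets borel" if "j \<in> J" for j
      using J(3)[OF that] by (cases "j < \<nu>") (simp_all add: sets_F sets_G)
    define J1 where "J1 = J \<inter> {..<\<nu>}"
    define J2 where "J2 = {i. i + \<nu> \<in> J}"
    have fin: "finite J1" "finite J2"
      using J(1) finite_vimageI[of J "\<lambda>i. i + \<nu>"] by (auto simp: J1_def J2_def vimage_def inj_on_def)
    have JJ: "J = J1 \<union> (\<lambda>i. i + \<nu>) ` J2"
      by (auto simp: J1_def J2_def image_iff) (metis le_add_diff_inverse2 not_less)
    have disj: "J1 \<inter> (\<lambda>i. i + \<nu>) ` J2 = {}" by (auto simp: J1_def)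
    let ?A = "{x. \<forall>j\<in>J1. x j \<in> E j}" and ?B = "{y. \<forall>j\<in>J2. y j \<in> E (j + \<nu>)}"
    have eA: "emeasure FS ?A = (\<Prod>j\<in>J1. emeasure F (E j))"
      using FS.emeasure_PiM_Collect[of J1 E] fin E by (simp add: J1_def sets_F)
    have eB: "emeasure GS ?B = (\<Prod>j\<in>J2. emeasure G (E (j + \<nu>)))"
      using GS.emeasure_PiM_Collect[of J2 "\<lambda>j. E (j + \<nu>)"] fin E by (simp add: J2_def sets_G)
    have mA: "?A \<in> sets FS"
    proof -
      have "{x \<in> space FS. \<forall>j\<in>J1. x j \<in> E j} \<in> sets FS"
        using fin E by (intro sets.sets_Collect_finite_All sets_Collect_single') (auto simp: J1_def sets_F)
      then show ?thesis by simp
    qed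
    have mB: "?B \<in> sets GS"
    proof -
      have "{x \<in> space GS. \<forall>j\<in>J2. x j \<in> E (j + \<nu>)} \<in> sets GS"
        using fin E by (intro sets.sets_Collect_finite_All sets_Collect_single') (auto simp: J2_def sets_G)
      then show ?thesis by simp
    qed
    let ?X = "prod_emb UNIV ?M J (Pi\<^sub>E J E)"
    have X: "?X \<in> sets (\<Pi>\<^sub>M n\<in>UNIV. ?M n)" using J by (intro sets_PiM_I) auto
    have sp: "space (?M n) = UNIV" for n by simp
    have Xe: "?X = {z. \<forall>j\<in>J. z j \<in> E j}"
      by (auto simp: prod_emb_def sp restrict_def PiE_iff extensional_def)
    have pre: "(\<lambda>(x, y). comb_seq \<nu> x y) -` ?X \<inter> space (FS \<Otimes>\<^sub>M GS) = ?A \<times> ?B"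
    proof -
      have "(\<forall>j\<in>J. comb_seq \<nu> x y j \<in> E j) \<longleftrightarrow> x \<in> ?A \<and> y \<in> ?B" for x y
        unfolding JJ ball_Un by (auto simp: J1_def comb_seq_less comb_seq_add)
      then show ?thesis unfolding Xe by (simp add: set_eq_iff space_pair_measure)
    qed
    have "emeasure (distr (FS \<Otimes>\<^sub>M GS) (\<Pi>\<^sub>M n\<in>UNIV. ?M n) (\<lambda>(x, y). comb_seq \<nu> x y)) ?X = emeasure (FS \<Otimes>\<^sub>M GS) (?A \<times> ?B)"
      using m X by (simp add: emeasure_distr pre)
    also have "\<dots> = emeasure FS ?A * emeasure GS ?B" by (rule GS.P.emeasure_pair_measure_Times[OF mA mB])
    also have "\<dots> = (\<Prod>j\<in>J1. emeasure (?M j) (E j)) * (\<Prod>j\<in>(\<lambda>i. i + \<nu>) ` J2. emeasure (?M j) (E j))"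
      unfolding eA eB by (subst prod.reindex) (auto simp: J1_def inj_on_def intro!: arg_cong2[where f="(*)"] prod.cong)
    also have "\<dots> = (\<Prod>j\<in>J. emeasure (?M j) (E j))"
      using fin disj unfolding JJ by (subst prod.union_disjoint) auto
    finally show "emeasure (distr (FS \<Otimes>\<^sub>M GS) (\<Pi>\<^sub>M n\<in>UNIV. ?M n) (\<lambda>(x, y). comb_seq \<nu> x y)) ?X = (\<Prod>j\<in>J. emeasure (?M j) (E j))" .
  qed simp
  then show ?thesis by simp
qed

lemma nn_integral_mixed:
  assumes h: "h \<in> borel_measurable (\<Pi>\<^sub>M n\<in>UNIV. borel)"
  shows "(\<integral>\<^sup>+z. h z \<partial>(\<Pi>\<^sub>M n\<in>UNIV. if n < \<nu> then F else G)) = (\<integral>\<^sup>+x. \<integral>\<^sup>+y. h (comb_seq \<nu> x y) \<partial>GS \<partial>FS)"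
proof -
  let ?M = "\<lambda>n. if n < \<nu> then F else G"
  have sM: "sets (\<Pi>\<^sub>M n\<in>UNIV. ?M n) = sets (\<Pi>\<^sub>M n\<in>(UNIV::nat set). (borel :: real measure))"
    by (intro sets_PiM_cong) (auto simp: sets_F sets_G)
  have sF: "sets FS = sets (\<Pi>\<^sub>M n\<in>(UNIV::nat set). (borel :: real measure))" by (intro sets_PiM_cong) (auto simp: sets_F)
  have sG: "sets GS = sets (\<Pi>\<^sub>M n\<in>(UNIV::nat set). (borel :: real measure))" by (intro sets_PiM_cong) (auto simp: sets_G)
  have m: "(\<lambda>(x, y). comb_seq \<nu> x y) \<in> measurable (FS \<Otimes>\<^sub>M GS) (\<Pi>\<^sub>M n\<in>UNIV. ?M n)"
    using measurable_comb_seq[of \<nu> "borel :: real measure"]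
    unfolding measurable_cong_sets[OF sets_pair_measure_cong[OF sF sG] sM] .
  have h': "h \<in> borel_measurable (\<Pi>\<^sub>M n\<in>UNIV. ?M n)" using h unfolding measurable_cong_sets[OF sM refl] .
  have "(\<integral>\<^sup>+z. h z \<partial>(\<Pi>\<^sub>M n\<in>UNIV. ?M n)) = (\<integral>\<^sup>+z. h (case z of (x, y) \<Rightarrow> comb_seq \<nu> x y) \<partial>(FS \<Otimes>\<^sub>M GS))"
    by (subst PiM_mixed_eq_distr_comb_seq, subst nn_integral_distr[OF m]) (simp_all add: h')
  also have "\<dots> = (\<integral>\<^sup>+x. \<integral>\<^sup>+y. h (comb_seq \<nu> x y) \<partial>GS \<partial>FS)"
    using GS.P.nn_integral_fst[OF measurable_compose[OF m h'], symmetric] by simp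
  finally show ?thesis .
qed

end


section \<open>Transfer to the changepoint model\<close>

text \<open>The remaining time is the number of future instants of survival, also when it is infinite.\<close>

lemma ennreal_of_enat_minus_eq_sum:
  "ennreal_of_enat (T - enat n) * (if enat n < T then 1 else 0) = (\<Sum>k. if enat (n + k) < T then 1 else 0)"
proof (cases T)
  case (enat t)
  have "(\<Sum>k. if enat (n + k) < T then 1 else (0::ennreal)) = (\<Sum>k<t - n. if enat (n + k) < T then 1 else 0)"
    by (rule suminf_finite) (auto simp: enat)
  also have "\<dots> = (\<Sum>k<t - n. 1)" by (rule sum.cong) (auto simp: enat)
  finally show ?thesis by (auto simp: enat ennreal_of_enat_enat)
next
  case infinity
  have "(\<Sum>k. 1 :: ennreal) = \<infinity>"
    using nn_integral_count_space_nat[of "\<lambda>_. 1 :: ennreal"] by simp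
  then show ?thesis using infinity by simp
qed

lemma SR_stat_eq_sr_path: "SR_stat L n w = sr_path 1 0 (\<lambda>i. L (Suc i) w) n"
  by (induction n) auto

lemma less_SR_time_iff:
  assumes "0 < A"
  shows "enat n < SR_time L A w \<longleftrightarrow> alive 1 0 A (\<lambda>i. L (Suc i) w) n"
proof
  assume a: "enat n < SR_time L A w"
  show "alive 1 0 A (\<lambda>i. L (Suc i) w) n" unfolding alive_def
  proof (intro allI impI)
    fix j assume "j \<le> n"
    show "sr_path 1 0 (\<lambda>i. L (Suc i) w) j < A"
    proof (cases "j = 0")
      case False
      show ?thesis
      proof (rule ccontr)
        assume "\<not> ?thesis"
        then have "SR_time L A w \<le> enat j"
          unfolding SR_time_def using False by (intro Inf_lower) (auto simp: SR_stat_eq_sr_path)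
        then show False using a \<open>j \<le> n\<close> by (meson enat_ord_simps(1) leD order_trans)
      qed
    qed (use assms in simp)
  qed
next
  assume a: "alive 1 0 A (\<lambda>i. L (Suc i) w) n"
  have "enat (Suc n) \<le> SR_time L A w"
    unfolding SR_time_def
  proof (rule Inf_greatest)
    fix t assume "t \<in> {enat n |n. 1 \<le> n \<and> A \<le> SR_stat L n w}"
    then obtain m where m: "t = enat m" "A \<le> sr_path 1 0 (\<lambda>i. L (Suc i) w) m" by (auto simp: SR_stat_eq_sr_path)
    then have "\<not> m \<le> n" using a unfolding alive_def by (metis not_le)
    then show "enat (Suc n) \<le> t" using m by simp
  qed
  then show "enat n < SR_time L A w" by (meson Suc_ile_eq)
qed

lemma walk_eq_ln_lr_prod:
  assumes "\<And>i. 0 < x i" "\<And>i. Z (Suc i) w = ln (x i)"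
  shows "walk Z n w = ln (lr_prod x n)"
proof -
  have "walk Z n w = (\<Sum>i<n. Z (Suc i) w)"
    unfolding walk_def by (rule sum.reindex_bij_witness[of _ "\<lambda>i. Suc i" "\<lambda>i. i - 1"]) auto
  also have "\<dots> = (\<Sum>i<n. ln (x i))" by (simp add: assms(2))
  also have "\<dots> = ln (lr_prod x n)" unfolding lr_prod_def using assms(1) by (subst ln_prod) (auto simp: less_imp_neq[symmetric])
  finally show ?thesis .
qed

text \<open>The overshoot coincides with the stopped walk on sequence space only almost surely; for its
  Bochner integral its measurability must be known too, and this form shows it.\<close>

lemma overshoot_eq_Least:
  "overshoot Z a w = (if \<exists>n. 1 \<le> n \<and> a \<le> walk Z n w then walk Z (LEAST n. 1 \<le> n \<and> a \<le> walk Z n w) w - a else 0)"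
proof (cases "\<exists>n. 1 \<le> n \<and> a \<le> walk Z n w")
  case True
  let ?n = "LEAST n. 1 \<le> n \<and> a \<le> walk Z n w"
  have "1 \<le> ?n \<and> a \<le> walk Z ?n w" using True by (rule LeastI_ex)
  then have "passage_time Z a w = enat ?n"
    unfolding passage_time_def by (intro antisym Inf_lower Inf_greatest) (auto intro: Least_le)
  then show ?thesis using True by (simp add: overshoot_def)
next
  case False
  then have e: "{enat n |n. 1 \<le> n \<and> a \<le> walk Z n w} = {}" by blast
  have "passage_time Z a w = \<infinity>" by (simp only: passage_time_def e Inf_empty top_enat_def)
  then show ?thesis unfolding if_not_P[OF False] overshoot_def by simp
qed

lemma measurable_overshoot:
  assumes [measurable]: "\<And>i. 1 \<le> i \<Longrightarrow> Z i \<in> borel_measurable M"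
  shows "overshoot Z a \<in> borel_measurable M"
proof -
  have [measurable]: "walk Z n \<in> borel_measurable M" for n
    unfolding walk_def by (rule borel_measurable_sum) (use assms in auto)
  have [measurable]: "(\<lambda>w. LEAST n. 1 \<le> n \<and> a \<le> walk Z n w) \<in> measurable M (count_space UNIV)" by measurable
  have [measurable]: "(\<lambda>w. walk Z (LEAST n. 1 \<le> n \<and> a \<le> walk Z n w) w) \<in> borel_measurable M"
    by (rule measurable_compose_countable[where f="\<lambda>n w. walk Z n w"]) measurable
  have "overshoot Z a = (\<lambda>w. if \<exists>n. 1 \<le> n \<and> a \<le> walk Z n w then walk Z (LEAST n. 1 \<le> n \<and> a \<le> walk Z n w) w - a else 0)"
    by (simp add: fun_eq_iff overshoot_eq_Least)
  then show ?thesis by simp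
qed

lemma overshoot_eq_stopped:
  assumes x: "\<And>i. 0 < x i" and Z: "\<And>i. Z (Suc i) w = ln (x i)" and a: "0 < a" and hit: "\<exists>n. exp a \<le> sr_path 0 1 x n"
  shows "overshoot Z a w = ln (sr_path 0 1 x (hit_time 0 1 (exp a) x) / exp a)"
proof -
  let ?N = "hit_time 0 1 (exp a) x"
  have p: "0 < lr_prod x n" for n using x by (rule lr_prod_pos)
  have w: "walk Z n w = ln (lr_prod x n)" for n by (rule walk_eq_ln_lr_prod[of x Z w n, OF x Z])
  have iff: "a \<le> walk Z n w \<longleftrightarrow> exp a \<le> sr_path 0 1 x n" for n
    unfolding w sr_path_0 using p[of n] by (simp add: ln_ge_iff)
  have fh: "first_hit 0 1 (exp a) x ?N" using first_hit_iff[OF hit] by simp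
  have N: "1 \<le> ?N" using hit_time_pos[OF hit] a by simp
  have "passage_time Z a w = enat ?N"
    unfolding passage_time_def
  proof (rule antisym)
    show "Inf {enat n |n. 1 \<le> n \<and> a \<le> walk Z n w} \<le> enat ?N"
      using fh N by (intro Inf_lower) (auto simp: iff first_hit_def)
    show "enat ?N \<le> Inf {enat n |n. 1 \<le> n \<and> a \<le> walk Z n w}"
    proof (rule Inf_greatest)
      fix t assume "t \<in> {enat n |n. 1 \<le> n \<and> a \<le> walk Z n w}"
      then obtain m where m: "t = enat m" "exp a \<le> sr_path 0 1 x m" by (auto simp: iff)
      then have "\<not> m < ?N" using fh unfolding first_hit_def by (metis not_le)
      then show "enat ?N \<le> t" using m by simp
    qed
  qed
  then show ?thesis unfolding overshoot_def using p[of ?N] by (simp add: w sr_path_0 ln_div)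
qed

locale changepoint =
  fixes \<mu> :: "'a measure" and f g :: "'a \<Rightarrow> real" and P :: "enat \<Rightarrow> 'w measure" and X :: "nat \<Rightarrow> 'w \<Rightarrow> 'a"
  assumes model: "changepoint_model \<mu> f g P X"
    and second_moment: "llr_second_moment f g (P 0) X < \<infinity>"
    and non_arithmetic: "non_arithmetic (P 0) (llr f g X 1)"
begin

abbreviation L :: "nat \<Rightarrow> 'w \<Rightarrow> real" where "L \<equiv> lik_ratio f g X"
definition lr :: "'a \<Rightarrow> real" where "lr x = g x / f x"
definition pre_law :: "real measure" where "pre_law = distr (P \<infinity>) borel (L 1)"
definition post_law :: "real measure" where "post_law = distr (P 0) borel (L 1)"
definition obs :: "'w \<Rightarrow> nat \<Rightarrow> real" where "obs w = (\<lambda>i. L (Suc i) w)"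

lemma densities: "f \<in> borel_measurable \<mu>" "g \<in> borel_measurable \<mu>" "\<And>x. x \<in> space \<mu> \<Longrightarrow> 0 \<le> f x" "\<And>x. x \<in> space \<mu> \<Longrightarrow> 0 \<le> g x"
  using model unfolding changepoint_model_def by auto

lemma prob_P: "prob_space (P \<nu>)" using model unfolding changepoint_model_def by blast

lemma indep_X: "prob_space.indep_vars (P \<nu>) (\<lambda>_. \<mu>) X {1..}" using model unfolding changepoint_model_def by blast

lemma distributed_X: "1 \<le> i \<Longrightarrow> distributed (P \<nu>) \<mu> (X i) (\<lambda>x. ennreal (if enat i \<le> \<nu> then f x else g x))"
  using model unfolding changepoint_model_def by blast

lemma measurable_X: "1 \<le> i \<Longrightarrow> X i \<in> measurable (P \<nu>) \<mu>"
  using distributed_X[of i \<nu>] by (simp add: distributed_def)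

lemma measurable_lr[measurable]: "lr \<in> borel_measurable \<mu>"
  unfolding lr_def using densities(1,2) by measurable

lemma L_eq: "L i = (\<lambda>w. lr (X i w))" by (simp add: fun_eq_iff lik_ratio_def lr_def)

lemma measurable_L: "1 \<le> i \<Longrightarrow> L i \<in> borel_measurable (P \<nu>)"
  unfolding L_eq by (rule measurable_compose[OF measurable_X measurable_lr])

lemma distr_L_density:
  assumes "1 \<le> i"
  shows "distr (P \<nu>) borel (L i) = distr (density \<mu> (\<lambda>x. ennreal (if enat i \<le> \<nu> then f x else g x))) borel lr"
proof -
  have "distr (P \<nu>) borel (L i) = distr (distr (P \<nu>) \<mu> (X i)) borel lr"
    unfolding L_eq by (subst distr_distr[OF measurable_lr measurable_X[OF assms]]) (simp add: comp_def)
  also have "distr (P \<nu>) \<mu> (X i) = density \<mu> (\<lambda>x. ennreal (if enat i \<le> \<nu> then f x else g x))"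
    using distributed_X[OF assms] by (simp add: distributed_def)
  finally show ?thesis .
qed

lemma pre_law_density: "pre_law = distr (density \<mu> (\<lambda>x. ennreal (f x))) borel lr"
  unfolding pre_law_def by (subst distr_L_density) auto

lemma post_law_density: "post_law = distr (density \<mu> (\<lambda>x. ennreal (g x))) borel lr"
  unfolding post_law_def by (subst distr_L_density) (auto simp: zero_enat_def)

lemma distr_L: "1 \<le> i \<Longrightarrow> distr (P \<nu>) borel (L i) = (if enat i \<le> \<nu> then pre_law else post_law)"
  by (subst distr_L_density) (auto simp: pre_law_density post_law_density)

text \<open>The second moment of the log-likelihood ratio counts \<open>f = 0\<close> as infinite.\<close>

lemma AE_f_nonzero: "AE x in \<mu>. 0 < g x \<longrightarrow> f x \<noteq> 0"
proof -
  note [measurable] = densities(1,2) measurable_X[OF le_refl[of "1::nat"], of 0]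
  have m: "(\<lambda>w. if f (X 1 w) = 0 then \<infinity> else ennreal (\<bar>llr f g X 1 w\<bar>\<^sup>2)) \<in> borel_measurable (P 0)"
    unfolding llr_def lik_ratio_def by measurable
  have "AE w in P 0. (if f (X 1 w) = 0 then \<infinity> else ennreal (\<bar>llr f g X 1 w\<bar>\<^sup>2)) \<noteq> \<infinity>"
    using second_moment unfolding llr_second_moment_def by (intro nn_integral_noteq_infinite m) auto
  then have "AE w in P 0. f (X 1 w) \<noteq> 0" by eventually_elim (auto split: if_splits)
  then have "AE x in distr (P 0) \<mu> (X 1). f x \<noteq> 0"
    by (subst AE_distr_iff[OF measurable_X[OF le_refl]]) measurable
  moreover have "distr (P 0) \<mu> (X 1) = density \<mu> (\<lambda>x. ennreal (g x))"
    using distributed_X[of 1 0] by (simp add: distributed_def zero_enat_def)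
  ultimately have "AE x in density \<mu> (\<lambda>x. ennreal (g x)). f x \<noteq> 0" by (simp only:)
  then show ?thesis using densities(2) by (subst (asm) AE_density) auto
qed

lemma likelihood_walk_laws: "likelihood_walk pre_law post_law"
proof (rule likelihood_walk.intro)
  interpret P0: prob_space "P 0" by (rule prob_P)
  interpret Pi: prob_space "P \<infinity>" by (rule prob_P)
  note [measurable] = densities(1,2) measurable_L[OF le_refl[of "1::nat"], of 0] measurable_L[OF le_refl[of "1::nat"], of "\<infinity>"]
  show "prob_space pre_law" unfolding pre_law_def by (rule Pi.prob_space_distr) measurable
  show "prob_space post_law" unfolding post_law_def by (rule P0.prob_space_distr) measurable
  show "sets pre_law = sets borel" by (simp add: pre_law_def)
  show "AE x in pre_law. 0 \<le> x"
    unfolding pre_law_density by (subst AE_distr_iff) (auto simp: lr_def densities intro!: AE_I2 divide_nonneg_nonneg)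
  show "post_law = density pre_law (\<lambda>x. ennreal x)"
  proof (rule measure_eqI)
    show "sets post_law = sets (density pre_law (\<lambda>x. ennreal x))" by (simp add: post_law_def pre_law_def)
    fix B assume "B \<in> sets post_law"
    then have B[measurable]: "B \<in> sets borel" by (simp add: post_law_def)
    have "emeasure (density pre_law (\<lambda>x. ennreal x)) B = (\<integral>\<^sup>+x. ennreal x * indicator B x \<partial>pre_law)"
      by (rule emeasure_density) (auto simp: pre_law_def)
    also have "\<dots> = (\<integral>\<^sup>+x. ennreal (lr x) * indicator B (lr x) \<partial>density \<mu> (\<lambda>x. ennreal (f x)))"
      unfolding pre_law_density by (rule nn_integral_distr) measurable
    also have "\<dots> = (\<integral>\<^sup>+x. ennreal (f x) * (ennreal (lr x) * indicator B (lr x)) \<partial>\<mu>)"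
      by (rule nn_integral_density) measurable
    also have "\<dots> = (\<integral>\<^sup>+x. ennreal (g x) * indicator B (lr x) \<partial>\<mu>)"
      using AE_f_nonzero AE_space[of \<mu>]
    proof (intro nn_integral_cong_AE, eventually_elim)
      case (elim x)
      have "f x * lr x = g x" using elim densities(3,4)[of x] by (cases "g x = 0") (auto simp: lr_def)
      then show ?case using densities(3)[of x] elim by (simp add: mult.assoc[symmetric] ennreal_mult'[symmetric])
    qed
    also have "\<dots> = (\<integral>\<^sup>+x. indicator B (lr x) \<partial>density \<mu> (\<lambda>x. ennreal (g x)))"
      by (rule nn_integral_density[symmetric]) measurable
    also have "\<dots> = (\<integral>\<^sup>+x. indicator B x \<partial>post_law)"
      unfolding post_law_density by (rule nn_integral_distr[symmetric]) measurable
    also have "\<dots> = emeasure post_law B" by (simp add: post_law_def)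
    finally show "emeasure post_law B = emeasure (density pre_law (\<lambda>x. ennreal x)) B" by simp
  qed
  show "integrable post_law (\<lambda>x. (ln x)\<^sup>2)"
  proof (rule integrableI_bounded)
    have "(\<integral>\<^sup>+x. ennreal (norm ((ln x)\<^sup>2)) \<partial>post_law) = (\<integral>\<^sup>+w. ennreal (\<bar>llr f g X 1 w\<bar>\<^sup>2) \<partial>P 0)"
      unfolding post_law_def by (subst nn_integral_distr[OF measurable_L[OF le_refl]]) (auto simp: llr_def)
    also have "\<dots> \<le> llr_second_moment f g (P 0) X"
      unfolding llr_second_moment_def by (intro nn_integral_mono) auto
    finally show "(\<integral>\<^sup>+x. ennreal (norm ((ln x)\<^sup>2)) \<partial>post_law) < \<infinity>" using second_moment by (rule le_less_trans)
  qed (simp add: post_law_def)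
  show "\<not> (\<exists>d>0. AE x in post_law. \<exists>k::int. ln x = d * of_int k)"
  proof
    assume "\<exists>d>0. AE x in post_law. \<exists>k::int. ln x = d * of_int k"
    then obtain d where d: "d > 0" "AE x in post_law. \<exists>k::int. ln x = d * of_int k" by (elim exE conjE)
    have "AE w in P 0. \<exists>k::int. ln (L 1 w) = d * of_int k"
      by (rule AE_distrD[OF _ d(2)[unfolded post_law_def]]) measurable
    then have "AE w in P 0. \<exists>k::int. llr f g X 1 w = d * of_int k" by (simp add: llr_def)
    with d(1) have "\<exists>d>0. AE w in P 0. \<exists>k::int. llr f g X 1 w = d * of_int k" by (intro exI[of _ d] conjI)
    then show False using non_arithmetic unfolding non_arithmetic_def by (rule notE[rotated])
  qed
qed

sublocale likelihood_walk pre_law post_law by (rule likelihood_walk_laws)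

lemma sets_post: "sets GS = sets (\<Pi>\<^sub>M n\<in>(UNIV::nat set). (borel :: real measure))"
  by (intro sets_PiM_cong) (auto simp: sets_G)

lemma measurable_obs: "obs \<in> measurable (P \<nu>) (\<Pi>\<^sub>M n\<in>UNIV. borel)"
  unfolding obs_def by (rule measurable_PiM_single') (auto intro: measurable_L)

text \<open>One identity of laws for the whole sequence of likelihood ratios carries every statement about the
  statistic over to sequence space.\<close>

lemma law_obs: "distr (P \<nu>) (\<Pi>\<^sub>M n\<in>UNIV. borel) obs = (\<Pi>\<^sub>M n\<in>UNIV. if enat (Suc n) \<le> \<nu> then pre_law else post_law)"
proof -
  interpret P: prob_space "P \<nu>" by (rule prob_P)
  let ?M = "\<lambda>i. distr (P \<nu>) borel (L i)"
  let ?r = "\<lambda>w. \<lambda>i\<in>{1..}. L i w"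
  let ?t = "\<lambda>z. \<lambda>n\<in>UNIV. (z (Suc n) :: real)"
  have iv: "P.indep_vars (\<lambda>_. borel) L {1..}"
    unfolding L_eq by (rule P.indep_vars_compose2[OF indep_X]) simp
  have 1: "distr (P \<nu>) (\<Pi>\<^sub>M i\<in>{1..}. borel) ?r = (\<Pi>\<^sub>M i\<in>{1..}. ?M i)"
    using iv by (subst (asm) P.indep_vars_iff_distr_eq_PiM') (auto intro: measurable_L)
  have sM: "sets (\<Pi>\<^sub>M i\<in>{1::nat..}. ?M i) = sets (\<Pi>\<^sub>M i\<in>{1::nat..}. (borel :: real measure))" by (intro sets_PiM_cong) auto
  have sU: "sets (\<Pi>\<^sub>M n\<in>(UNIV::nat set). ?M (Suc n)) = sets (\<Pi>\<^sub>M n\<in>(UNIV::nat set). (borel :: real measure))" by (intro sets_PiM_cong) auto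
  have mr: "?r \<in> measurable (P \<nu>) (\<Pi>\<^sub>M i\<in>{1..}. borel)" by (intro measurable_restrict measurable_L) simp
  have mt: "?t \<in> measurable (\<Pi>\<^sub>M i\<in>{1..}. borel) (\<Pi>\<^sub>M n\<in>UNIV. borel)"
    by (intro measurable_restrict measurable_component_singleton) simp
  have "obs = ?t \<circ> ?r" by (simp add: fun_eq_iff obs_def)
  then have "distr (P \<nu>) (\<Pi>\<^sub>M n\<in>UNIV. borel) obs = distr (distr (P \<nu>) (\<Pi>\<^sub>M i\<in>{1..}. borel) ?r) (\<Pi>\<^sub>M n\<in>UNIV. borel) ?t"
    using distr_distr[OF mt mr] by simp
  also have "\<dots> = distr (\<Pi>\<^sub>M i\<in>{1..}. ?M i) (\<Pi>\<^sub>M n\<in>UNIV. ?M (Suc n)) ?t"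
    unfolding 1 by (intro distr_cong refl sU[symmetric])
  also have "\<dots> = (\<Pi>\<^sub>M n\<in>UNIV. ?M (Suc n))"
  proof (rule distr_PiM_reindex)
    show "prob_space (?M i)" if "i \<in> {1..}" for i using that by (intro P.prob_space_distr measurable_L) simp
  qed auto
  also have "\<dots> = (\<Pi>\<^sub>M n\<in>UNIV. if enat (Suc n) \<le> \<nu> then pre_law else post_law)"
    by (intro PiM_cong) (auto simp: distr_L)
  finally show ?thesis .
qed

lemma nn_integral_obs:
  assumes h: "h \<in> borel_measurable (\<Pi>\<^sub>M n\<in>UNIV. borel)"
  shows "(\<integral>\<^sup>+w. h (obs w) \<partial>P (enat \<nu>)) = (\<integral>\<^sup>+x. \<integral>\<^sup>+y. h (comb_seq \<nu> x y) \<partial>GS \<partial>FS)"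
    "(\<integral>\<^sup>+w. h (obs w) \<partial>P \<infinity>) = (\<integral>\<^sup>+x. h x \<partial>FS)"
proof -
  have "(\<integral>\<^sup>+w. h (obs w) \<partial>P (enat \<nu>)) = (\<integral>\<^sup>+z. h z \<partial>distr (P (enat \<nu>)) (\<Pi>\<^sub>M n\<in>UNIV. borel) obs)"
    by (rule nn_integral_distr[OF measurable_obs, symmetric]) (simp add: h)
  also have "\<dots> = (\<integral>\<^sup>+z. h z \<partial>(\<Pi>\<^sub>M n\<in>UNIV. if n < \<nu> then pre_law else post_law))"
    unfolding law_obs by (simp add: Suc_le_eq)
  finally show "(\<integral>\<^sup>+w. h (obs w) \<partial>P (enat \<nu>)) = (\<integral>\<^sup>+x. \<integral>\<^sup>+y. h (comb_seq \<nu> x y) \<partial>GS \<partial>FS)"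
    by (simp add: nn_integral_mixed[OF h])
  have "(\<integral>\<^sup>+w. h (obs w) \<partial>P \<infinity>) = (\<integral>\<^sup>+z. h z \<partial>distr (P \<infinity>) (\<Pi>\<^sub>M n\<in>UNIV. borel) obs)"
    by (rule nn_integral_distr[OF measurable_obs, symmetric]) (simp add: h)
  then show "(\<integral>\<^sup>+w. h (obs w) \<partial>P \<infinity>) = (\<integral>\<^sup>+x. h x \<partial>FS)" unfolding law_obs by simp
qed

lemma measurable_obs_GS: "obs \<in> measurable (P 0) GS"
  using measurable_obs unfolding measurable_cong_sets[OF refl sets_post[symmetric]] .

lemma law_obs_GS: "distr (P 0) GS obs = GS"
proof -
  have "distr (P 0) GS obs = distr (P 0) (\<Pi>\<^sub>M n\<in>UNIV. borel) obs" by (intro distr_cong refl sets_post)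
  then show ?thesis unfolding law_obs by (simp add: zero_enat_def)
qed

lemma AE_obs_regular: "AE w in P 0. regular (obs w)"
proof (rule AE_distrD[OF measurable_obs_GS])
  show "AE x in distr (P 0) GS obs. regular x" unfolding law_obs_GS by (rule AE_regular)
qed

lemma integral_obs_GS: "h \<in> borel_measurable GS \<Longrightarrow> (\<integral>w. h (obs w) \<partial>P 0) = (\<integral>x. h x \<partial>GS)" for h :: "(nat \<Rightarrow> real) \<Rightarrow> real"
  using integral_distr[OF measurable_obs_GS, of h] law_obs_GS by simp

lemma survival_indicator:
  assumes "0 < A"
  shows "enat n < SR_time L A w \<longleftrightarrow> alive 1 0 A (obs w) n"
  unfolding obs_def by (rule less_SR_time_iff[OF assms])

lemma measurable_alive_borel: "(\<lambda>z. indicator {z. alive 1 0 A z n} z :: ennreal) \<in> borel_measurable (\<Pi>\<^sub>M n\<in>UNIV. (borel :: real measure))"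
proof -
  have [measurable]: "Measurable.pred (\<Pi>\<^sub>M n\<in>UNIV. (borel :: real measure)) (\<lambda>z. alive 1 0 A z n)"
    by (rule measurable_alive[OF refl]) auto
  have "(\<lambda>z. indicator {z. alive 1 0 A z n} z :: ennreal) = (\<lambda>z. if alive 1 0 A z n then 1 else 0)"
    by (auto simp: fun_eq_iff indicator_def)
  then show ?thesis by simp
qed

lemma emeasure_survival:
  assumes "0 < A"
  shows "emeasure (P (enat n)) {w \<in> space (P (enat n)). enat n < SR_time L A w} = emeasure FS {x. alive 1 0 A x n}"
    "emeasure (P \<infinity>) {w \<in> space (P \<infinity>). enat n < SR_time L A w} = emeasure FS {x. alive 1 0 A x n}"
proof -
  let ?h = "\<lambda>z. indicator {z. alive 1 0 A z n} z :: ennreal"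
  have sets: "{w \<in> space (P \<nu>). enat n < SR_time L A w} \<in> sets (P \<nu>)" for \<nu>
  proof -
    have "Measurable.pred (P \<nu>) (\<lambda>w. alive 1 0 A (obs w) n)"
      by (rule measurable_alive[OF refl measurable_obs]) auto
    then show ?thesis unfolding survival_indicator[OF assms] by simp
  qed
  have e: "emeasure (P \<nu>) {w \<in> space (P \<nu>). enat n < SR_time L A w} = (\<integral>\<^sup>+w. ?h (obs w) \<partial>P \<nu>)" for \<nu>
    unfolding nn_integral_indicator[OF sets, symmetric]
    by (intro nn_integral_cong) (auto simp: indicator_def survival_indicator[OF assms])
  show "emeasure (P (enat n)) {w \<in> space (P (enat n)). enat n < SR_time L A w} = emeasure FS {x. alive 1 0 A x n}"
    unfolding e nn_integral_obs(1)[OF measurable_alive_borel]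
  proof -
    have "(\<integral>\<^sup>+x. \<integral>\<^sup>+y. ?h (comb_seq n x y) \<partial>GS \<partial>FS) = (\<integral>\<^sup>+x. \<integral>\<^sup>+y. ?h x \<partial>GS \<partial>FS)"
      by (intro nn_integral_cong) (auto simp: indicator_def alive_comb_seq_le)
    then show "(\<integral>\<^sup>+x. \<integral>\<^sup>+y. ?h (comb_seq n x y) \<partial>GS \<partial>FS) = emeasure FS {x. alive 1 0 A x n}" by simp
  qed
  show "emeasure (P \<infinity>) {w \<in> space (P \<infinity>). enat n < SR_time L A w} = emeasure FS {x. alive 1 0 A x n}"
    unfolding e nn_integral_obs(2)[OF measurable_alive_borel] by simp
qed

text \<open>Survival beyond \<open>n\<close> depends on observations before the change and has the same
  probability under \<open>P n\<close> and \<open>P \<infinity>\<close>, so the conditioning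
  cancels. What remains of the delay is a passage time from the current value of the statistic.\<close>

lemma delay_term:
  assumes A: "0 < A"
  shows "cond_delay (P (enat n)) n (SR_time L A) * emeasure (P \<infinity>) {w \<in> space (P \<infinity>). enat n < SR_time L A w}
     = (\<integral>\<^sup>+x. indicator {x. alive 1 0 A x n} x * mean_time_nn 1 (sr_path 1 0 x n) A \<partial>FS)"
proof -
  let ?h = "\<lambda>z. (\<Sum>k. indicator {z. alive 1 0 A z (n + k)} z) :: ennreal"
  have h: "?h \<in> borel_measurable (\<Pi>\<^sub>M n\<in>UNIV. (borel :: real measure))"
    by (intro borel_measurable_suminf_order measurable_alive_borel)
  let ?D = "\<integral>\<^sup>+w. ennreal_of_enat (SR_time L A w - enat n) * indicator {w. enat n < SR_time L A w} w \<partial>P (enat n)"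
  have "?D = (\<integral>\<^sup>+w. ?h (obs w) \<partial>P (enat n))"
  proof (intro nn_integral_cong)
    fix w
    have "ennreal_of_enat (SR_time L A w - enat n) * indicator {w. enat n < SR_time L A w} w
       = (\<Sum>k. if enat (n + k) < SR_time L A w then 1 else 0)"
      unfolding ennreal_of_enat_minus_eq_sum[symmetric] by (simp add: indicator_def)
    also have "\<dots> = ?h (obs w)" by (intro suminf_cong) (simp add: survival_indicator[OF A] indicator_def)
    finally show "ennreal_of_enat (SR_time L A w - enat n) * indicator {w. enat n < SR_time L A w} w = ?h (obs w)" .
  qed
  also have "\<dots> = (\<integral>\<^sup>+x. \<integral>\<^sup>+y. ?h (comb_seq n x y) \<partial>GS \<partial>FS)" by (rule nn_integral_obs(1)[OF h])
  also have "\<dots> = (\<integral>\<^sup>+x. indicator {x. alive 1 0 A x n} x * mean_time_nn 1 (sr_path 1 0 x n) A \<partial>FS)"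
  proof (intro nn_integral_cong)
    fix x
    have "(\<integral>\<^sup>+y. ?h (comb_seq n x y) \<partial>GS) = (\<integral>\<^sup>+y. indicator {x. alive 1 0 A x n} x * (\<Sum>k. indicator {y. alive 1 (sr_path 1 0 x n) A y k} y) \<partial>GS)"
      by (intro nn_integral_cong) (simp add: alive_comb_seq_add indicator_def)
    also have "\<dots> = indicator {x. alive 1 0 A x n} x * mean_time_nn 1 (sr_path 1 0 x n) A"
      unfolding mean_time_nn_def by (rule nn_integral_cmult) measurable
    finally show "(\<integral>\<^sup>+y. ?h (comb_seq n x y) \<partial>GS) = indicator {x. alive 1 0 A x n} x * mean_time_nn 1 (sr_path 1 0 x n) A" .
  qed
  finally have D: "?D = (\<integral>\<^sup>+x. indicator {x. alive 1 0 A x n} x * mean_time_nn 1 (sr_path 1 0 x n) A \<partial>FS)" .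
  have "?D / p * p = ?D" if p: "p = emeasure FS {x. alive 1 0 A x n}" for p
  proof (cases "p = 0")
    case True
    then have "{x. alive 1 0 A x n} \<in> null_sets FS" using p by (simp add: null_sets_def)
    from AE_not_in[OF this]
    have "(\<integral>\<^sup>+x. indicator {x. alive 1 0 A x n} x * mean_time_nn 1 (sr_path 1 0 x n) A \<partial>FS) = (\<integral>\<^sup>+x. 0 \<partial>FS)"
      by (intro nn_integral_cong_AE) (auto elim: eventually_mono)
    then show ?thesis using D by simp
  next
    case False
    have "p \<noteq> \<infinity>" unfolding p by simp
    then have "?D * p / p = ?D" using False by (intro ennreal_mult_divide_eq) auto
    then show ?thesis by (simp only: mult.commute[of "?D / p"] mult.commute[of ?D] ennreal_times_divide)
  qed
  then show ?thesis unfolding cond_delay_def emeasure_survival[OF A] using D by simp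
qed

lemma mean_time_SR:
  assumes A: "0 < A"
  shows "(\<integral>\<^sup>+w. ennreal_of_enat (SR_time L A w) \<partial>P \<infinity>) = (\<Sum>n. emeasure FS {x. alive 1 0 A x n})"
proof -
  let ?h = "\<lambda>z. (\<Sum>k. indicator {z. alive 1 0 A z k} z) :: ennreal"
  have h: "?h \<in> borel_measurable (\<Pi>\<^sub>M n\<in>UNIV. (borel :: real measure))"
    by (intro borel_measurable_suminf_order measurable_alive_borel)
  have "(\<integral>\<^sup>+w. ennreal_of_enat (SR_time L A w) \<partial>P \<infinity>) = (\<integral>\<^sup>+w. ?h (obs w) \<partial>P \<infinity>)"
  proof (intro nn_integral_cong)
    fix w
    have "enat 0 < SR_time L A w" using survival_indicator[OF A, of 0 w] A by (simp add: alive_def)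
    then have "ennreal_of_enat (SR_time L A w) = (\<Sum>k. if enat k < SR_time L A w then 1 else 0)"
      using ennreal_of_enat_minus_eq_sum[of "SR_time L A w" 0] by (simp flip: zero_enat_def)
    also have "\<dots> = ?h (obs w)" by (intro suminf_cong) (simp add: survival_indicator[OF A] indicator_def)
    finally show "ennreal_of_enat (SR_time L A w) = ?h (obs w)" .
  qed
  also have "\<dots> = (\<integral>\<^sup>+x. ?h x \<partial>FS)" by (rule nn_integral_obs(2)[OF h])
  also have "\<dots> = (\<Sum>n. emeasure FS {x. alive 1 0 A x n})" by (subst nn_integral_suminf) auto
  finally show ?thesis .
qed

lemma integral_avg_delay_eq:
  assumes A: "0 < A"
  shows "integral_avg_delay P (SR_time L A) = (\<Sum>n. \<integral>\<^sup>+x. indicator {x. alive 1 0 A x n} x * mean_time_nn 1 (sr_path 1 0 x n) A \<partial>FS)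
                     / (\<Sum>n. emeasure FS {x. alive 1 0 A x n})"
  unfolding integral_avg_delay_def delay_term[OF A] mean_time_SR[OF A] ..

lemma drift_eq: "drift = (\<integral>w. llr f g X 1 w \<partial>P 0)"
proof -
  have "drift = (\<integral>x. ln x \<partial>distr (P 0) borel (L 1))" unfolding drift_def post_law_def[symmetric] ..
  also have "\<dots> = (\<integral>w. ln (L 1 w) \<partial>P 0)" by (rule integral_distr[OF measurable_L[OF le_refl]]) measurable
  finally show ?thesis by (simp only: llr_def)
qed

lemma limiting_overshoot_eq: "limiting_overshoot (P 0) (llr f g X) = overshoot_limit"
proof -
  have e: "(\<integral>w. overshoot (llr f g X) a w \<partial>P 0) = excess a" if a: "0 < a" for a
  proof -
    have hits: "AE w in P 0. \<exists>n. exp a \<le> sr_path 0 1 (obs w) n"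
    proof (rule AE_distrD[OF measurable_obs_GS])
      show "AE x in distr (P 0) GS obs. \<exists>n. exp a \<le> sr_path 0 1 x n" unfolding law_obs_GS by (rule AE_hits) auto
    qed
    have ae: "AE w in P 0. overshoot (llr f g X) a w = log_overshoot 0 1 (exp a) (obs w)"
      using hits AE_obs_regular
    proof eventually_elim
      case (elim w)
      have x: "0 < obs w i" for i using elim(2) by (simp add: regular_def)
      show ?case unfolding log_overshoot_def
        by (rule overshoot_eq_stopped[OF x _ a elim(1)]) (simp add: llr_def obs_def)
    qed
    have "(\<integral>w. overshoot (llr f g X) a w \<partial>P 0) = (\<integral>w. log_overshoot 0 1 (exp a) (obs w) \<partial>P 0)"
      using ae by (intro integral_cong_AE measurable_overshoot measurable_compose[OF measurable_obs_GS measurable_log_overshoot])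
        (auto simp: llr_def[abs_def] intro!: borel_measurable_ln measurable_L)
    also have "\<dots> = (\<integral>x. log_overshoot 0 1 (exp a) x \<partial>GS)" by (rule integral_obs_GS) measurable
    finally show ?thesis using excess_eq_mean_overshoot[OF a] by simp
  qed
  have "((\<lambda>a. \<integral>w. overshoot (llr f g X) a w \<partial>P 0) \<longlongrightarrow> overshoot_limit) at_top"
  proof (rule Lim_transform_eventually[OF excess_tendsto])
    show "\<forall>\<^sub>F a in at_top. excess a = (\<integral>w. overshoot (llr f g X) a w \<partial>P 0)"
      using eventually_gt_at_top[of 0] by eventually_elim (simp add: e)
  qed
  then show ?thesis unfolding limiting_overshoot_def by (intro tendsto_Lim) auto
qed

lemma V_inf_eq: "regular (obs w) \<Longrightarrow> V_inf (llr f g X) w = perpetuity (obs w) - 1"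
proof -
  assume r: "regular (obs w)"
  have x: "0 < obs w i" for i using r by (simp add: regular_def)
  have s: "summable (\<lambda>j. 1 / lr_prod (obs w) j)" using r by (simp add: regular_def)
  have "exp (- walk (llr f g X) n w) = 1 / lr_prod (obs w) n" for n
  proof -
    have "walk (llr f g X) n w = ln (lr_prod (obs w) n)"
      by (rule walk_eq_ln_lr_prod[of "obs w"]) (simp_all add: x, simp add: llr_def obs_def)
    then show ?thesis using lr_prod_pos[of "obs w" n, OF x] by (simp add: exp_minus inverse_eq_divide)
  qed
  then show ?thesis unfolding V_inf_def perpetuity_def using suminf_split_head[OF s] by simp
qed

lemma measurable_V_inf: "V_inf (llr f g X) \<in> borel_measurable (P 0)"
proof -
  have "(\<lambda>w. walk (llr f g X) n w) \<in> borel_measurable (P 0)" for n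
    unfolding walk_def llr_def by (intro borel_measurable_sum borel_measurable_ln measurable_L) simp
  note [measurable] = this
  have "(\<lambda>w. \<Sum>j. exp (- walk (llr f g X) (Suc j) w)) \<in> borel_measurable (P 0)" by measurable
  then show ?thesis by (simp add: V_inf_def[abs_def])
qed

text \<open>Both half lines carry the full mass, and Fubini's theorem makes the double integral the mean of
  \<open>ell\<close> under the stationary law.\<close>

lemma C_inf_eq:
  assumes Q: "real_distribution Q" and nn: "AE x in Q. 0 \<le> x" and iQ: "integrable Q ell_pos"
  shows "C_inf (P 0) (llr f g X) Q = (\<integral>x. ell_pos x \<partial>Q)"
proof -
  interpret Q: real_distribution Q by fact
  interpret PP: pair_sigma_finite Q GS by unfold_locales
  define I where "I y = (LINT x:{0..}|Q. ln (1 + x + y))" for y :: real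
  have Ie: "I y = (\<integral>x. ln (max 0 x + (1 + y)) \<partial>Q)" for y
    unfolding I_def set_lebesgue_integral_def
  proof (rule integral_cong_AE)
    show "AE x in Q. indicator {0..} x *\<^sub>R ln (1 + x + y) = ln (max 0 x + (1 + y))"
      using nn by eventually_elim (simp add: ac_simps)
  qed auto
  have mI[measurable]: "I \<in> borel_measurable borel"
    unfolding Ie by (rule Q.borel_measurable_lebesgue_integral) (simp add: split_beta')
  have mjoint: "(\<lambda>(x, z). ln (max 0 x + perpetuity z)) \<in> borel_measurable (Q \<Otimes>\<^sub>M GS)"
  proof -
    have [measurable]: "fst \<in> borel_measurable (Q \<Otimes>\<^sub>M GS)"
      using measurable_fst[of Q GS] measurable_cong_sets[OF refl Q.events_eq_borel] by blast
    have [measurable]: "(\<lambda>p. perpetuity (snd p)) \<in> borel_measurable (Q \<Otimes>\<^sub>M GS)"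
      by (rule measurable_compose[OF measurable_snd measurable_perpetuity])
    show ?thesis unfolding split_beta' by measurable
  qed
  have inner: "integrable GS (\<lambda>z. ln (max 0 x + perpetuity z))" "(\<integral>z. norm (ln (max 0 x + perpetuity z)) \<partial>GS) = ell_pos x" for x :: real
  proof -
    show i: "integrable GS (\<lambda>z. ln (max 0 x + perpetuity z))" by (rule integrable_ln_add_perpetuity) simp
    have "(\<integral>z. norm (ln (max 0 x + perpetuity z)) \<partial>GS) = (\<integral>z. ln (max 0 x + perpetuity z) \<partial>GS)"
    proof (rule integral_cong_AE)
      show "AE z in GS. norm (ln (max 0 x + perpetuity z)) = ln (max 0 x + perpetuity z)"
        using AE_regular by eventually_elim (simp add: ln_add_perpetuity_bounds)
    qed measurable
    then show "(\<integral>z. norm (ln (max 0 x + perpetuity z)) \<partial>GS) = ell_pos x" by (simp add: ell_pos_def ell_def)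
  qed
  have joint: "integrable (Q \<Otimes>\<^sub>M GS) (\<lambda>(x, z). ln (max 0 x + perpetuity z))"
    by (rule PP.Fubini_integrable[OF mjoint]) (use inner iQ in auto)
  have "C_inf (P 0) (llr f g X) Q = (LINT y:{0..}|distr (P 0) borel (V_inf (llr f g X)). I y)"
    unfolding C_inf_def I_def ..
  also have "\<dots> = (\<integral>w. indicator {0..} (V_inf (llr f g X) w) *\<^sub>R I (V_inf (llr f g X) w) \<partial>P 0)"
    unfolding set_lebesgue_integral_def by (rule integral_distr[OF measurable_V_inf]) measurable
  also have "\<dots> = (\<integral>w. I (perpetuity (obs w) - 1) \<partial>P 0)"
  proof (rule integral_cong_AE)
    show "AE w in P 0. indicator {0..} (V_inf (llr f g X) w) *\<^sub>R I (V_inf (llr f g X) w) = I (perpetuity (obs w) - 1)"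
      using AE_obs_regular
    proof eventually_elim
      case (elim w)
      show ?case using regular_perpetuity_sum(3)[OF elim] by (simp add: V_inf_eq[OF elim])
    qed
    note [measurable] = measurable_V_inf measurable_compose[OF measurable_obs_GS measurable_perpetuity]
    show "(\<lambda>w. indicator {0..} (V_inf (llr f g X) w) *\<^sub>R I (V_inf (llr f g X) w)) \<in> borel_measurable (P 0)" by measurable
    show "(\<lambda>w. I (perpetuity (obs w) - 1)) \<in> borel_measurable (P 0)" by measurable
  qed
  also have "\<dots> = (\<integral>z. I (perpetuity z - 1) \<partial>GS)" by (rule integral_obs_GS) measurable
  also have "\<dots> = (\<integral>z. (\<integral>x. ln (max 0 x + perpetuity z) \<partial>Q) \<partial>GS)" by (simp add: Ie)
  also have "\<dots> = (\<integral>x. (\<integral>z. ln (max 0 x + perpetuity z) \<partial>GS) \<partial>Q)" using PP.Fubini_integral[OF joint] by simp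
  also have "\<dots> = (\<integral>x. ell_pos x \<partial>Q)" by (simp add: ell_pos_def ell_def)
  finally show ?thesis .
qed

lemma stationary_law_of_obs:
  assumes "stationary_distribution (P \<infinity>) L Q"
  shows "real_distribution Q" "(\<lambda>n. measure FS {z. sr_path 1 0 z n \<le> x}) \<longlonglongrightarrow> cdf Q x"
proof -
  show "real_distribution Q" using assms by (simp add: stationary_distribution_def)
  have e: "\<P>(w in P \<infinity>. SR_stat L n w \<le> x) = measure FS {z. sr_path 1 0 z n \<le> x}" for n
  proof -
    have m: "{z. sr_path 1 0 z n \<le> x} \<in> sets (\<Pi>\<^sub>M n\<in>UNIV. (borel :: real measure))"
    proof -
      have [measurable]: "(\<lambda>z. sr_path 1 0 z n) \<in> borel_measurable (\<Pi>\<^sub>M n\<in>UNIV. (borel :: real measure))"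
        by (rule measurable_sr_path[OF refl]) auto
      have "{z \<in> space (\<Pi>\<^sub>M n\<in>UNIV. (borel :: real measure)). sr_path 1 0 z n \<le> x} \<in> sets (\<Pi>\<^sub>M n\<in>UNIV. (borel :: real measure))" by measurable
      then show ?thesis by (simp add: space_PiM)
    qed
    have "measure FS {z. sr_path 1 0 z n \<le> x} = measure (distr (P \<infinity>) (\<Pi>\<^sub>M n\<in>UNIV. borel) obs) {z. sr_path 1 0 z n \<le> x}"
      unfolding law_obs by simp
    also have "\<dots> = measure (P \<infinity>) (obs -` {z. sr_path 1 0 z n \<le> x} \<inter> space (P \<infinity>))"
      by (rule measure_distr[OF measurable_obs m])
    also have "obs -` {z. sr_path 1 0 z n \<le> x} \<inter> space (P \<infinity>) = {w \<in> space (P \<infinity>). SR_stat L n w \<le> x}"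
      by (auto simp: SR_stat_eq_sr_path obs_def)
    finally show ?thesis by simp
  qed
  show "(\<lambda>n. measure FS {z. sr_path 1 0 z n \<le> x}) \<longlonglongrightarrow> cdf Q x"
    unfolding e[symmetric] using assms unfolding stationary_distribution_def by blast
qed

end

theorem theorem3p5:
  fixes \<mu> :: "'a measure"
    and f g :: "'a \<Rightarrow> real"
    and P :: "enat \<Rightarrow> 'w measure"
    and X :: "nat \<Rightarrow> 'w \<Rightarrow> 'a"
    and Qst :: "real measure"
    and QA :: "real \<Rightarrow> real measure"
  assumes model: "changepoint_model \<mu> f g P X"
    and Qst: "stationary_distribution (P \<infinity>) (lik_ratio f g X) Qst"
    and QA: "\<forall>\<^sub>F A in at_top. quasi_stationary_distribution (P \<infinity>) (lik_ratio f g X) A (QA A)"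
    and second_moment: "llr_second_moment f g (P 0) X < \<infinity>"
    and non_arithmetic: "non_arithmetic (P 0) (llr f g X 1)"
  shows "((\<lambda>A. enn2ereal (integral_avg_delay P (SR_time (lik_ratio f g X) A))
             - ereal (1 / (\<integral>\<omega>. llr f g X 1 \<omega> \<partial>P 0) *
                 (ln A + limiting_overshoot (P 0) (llr f g X) - C_inf (P 0) (llr f g X) Qst)))
           \<longlongrightarrow> 0) at_top"
proof -
  interpret changepoint \<mu> f g P X by unfold_locales (fact model second_moment non_arithmetic)+
  note S = stationary_law_of_obs[OF Qst]
  note lim = stationary_limit[OF S]
  let ?c = "\<integral>x. ell_pos x \<partial>Qst"
  let ?j0 = "\<lambda>A. (\<Sum>n. \<integral>\<^sup>+x. indicator {x. alive 1 0 A x n} x * mean_time_nn 1 (sr_path 1 0 x n) A \<partial>FS)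
                     / (\<Sum>n. emeasure FS {x. alive 1 0 A x n})"
  obtain j where j: "\<forall>\<^sub>F A in at_top. ?j0 A = ennreal (j A) \<and> 0 \<le> j A"
    and conv: "((\<lambda>A. j A - 1 / drift * (ln A + overshoot_limit - ?c)) \<longlongrightarrow> 0) at_top"
    using delay_ratio_expansion[OF lim(3)] by blast
  have C: "C_inf (P 0) (llr f g X) Qst = ?c" by (rule C_inf_eq[OF S(1) lim(1,2)])
  have "\<forall>\<^sub>F A in at_top. ereal (j A - 1 / drift * (ln A + overshoot_limit - ?c))
     = enn2ereal (integral_avg_delay P (SR_time L A))
             - ereal (1 / (\<integral>w. llr f g X 1 w \<partial>P 0) *
                 (ln A + limiting_overshoot (P 0) (llr f g X) - C_inf (P 0) (llr f g X) Qst))"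
    using j eventually_gt_at_top[of 0]
  proof eventually_elim
    case (elim A)
    then have "integral_avg_delay P (SR_time L A) = ennreal (j A)" by (simp add: integral_avg_delay_eq)
    then show ?case using elim unfolding C limiting_overshoot_eq drift_eq[symmetric] by simp
  qed
  moreover have "((\<lambda>A. ereal (j A - 1 / drift * (ln A + overshoot_limit - ?c))) \<longlongrightarrow> 0) at_top"
    using conv by (simp add: zero_ereal_def)
  ultimately show ?thesis by (rule Lim_transform_eventually[rotated])
qed

end
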